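(* Let $f\in L^\infty(\mathbb{R}^{2d})$ and $\psi_1,\psi_2\in L^2(\mathbb{R}^d)$. The localization operator $\mathcal{A}^{\psi_1,\psi_2}_f$ is compact on $L^2(\mathbb{R}^d)$ if and only if $$f\ast\left(V_{\varphi_0}\psi_2\,\overline{V_{\varphi_0}\psi_1}\right)\in C_0(\mathbb{R}^{2d}).$$
   Context: For $z=(x,\omega)\in\mathbb{R}^{2d}$, $(\pi(z)\psi)(t)=e^{2\pi i\omega\cdot t}\psi(t-x)$, and $V_\phi\psi(z)=\langle\psi,\pi(z)\phi\rangle_{L^2}$ for $\psi,\phi\in L^2(\mathbb{R}^d)$. $\varphi_0(t)=2^{d/4}e^{-\pi|t|^2}$ is the normalized Gaussian on $\mathbb{R}^d$. For $f\in L^\infty(\mathbb{R}^{2d})$ and $\psi_1,\psi_2\in L^2(\mathbb{R}^d)$, the localization operator $\mathcal{A}_f^{\psi_1,\psi_2}$ is the bounded operator on $L^2(\mathbb{R}^d)$ given weakly by $\mathcal{A}_f^{\psi_1,\psi_2}\psi=\int_{\mathbb{R}^{2d}}f(z)V_{\psi_1}\psi(z)\pi(z)\psi_2\,dz$, i.e. $\langle\mathcal{A}_f^{\psi_1,\psi_2}\psi,\phi\rangle=\int_{\mathbb{R}^{2d}}f(z)V_{\psi_1}\psi(z)\overline{V_{\psi_2}\phi(z)}\,dz$ for $\psi,\phi\in L^2(\mathbb{R}^d)$. $\ast$ is the convolution of functions on $\mathbb{R}^{2d}$. *)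

theory Defs
  imports "HOL-Probability.Probability"
begin

section \<open>The Hilbert space of square-integrable functions\<close>

text \<open>Every almost-everywhere class of Lebesgue measurable functions has a Borel measurable
  representative, so the quotient below is the usual \<open>L\<^sup>2\<close>.\<close>

definition square_integrable :: "('a::euclidean_space \<Rightarrow> complex) \<Rightarrow> bool" where
  "square_integrable f \<longleftrightarrow>
     f \<in> borel_measurable lborel \<and> integrable lborel (\<lambda>t. (cmod (f t))\<^sup>2)"

lemma square_integrable_zero: "square_integrable (\<lambda>_. 0)"
  by (simp add: square_integrable_def)

lemma square_integrable_scale:
  assumes "square_integrable f" shows "square_integrable (\<lambda>t. c * f t)"
  using assms by (auto simp: square_integrable_def norm_mult power_mult_distrib)

lemma square_integrable_add:
  assumes f: "square_integrable f" and g: "square_integrable g"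
  shows "square_integrable (\<lambda>t. f t + g t)"
proof -
  have [measurable]: "f \<in> borel_measurable lborel" "g \<in> borel_measurable lborel"
    using f g by (auto simp: square_integrable_def)
  have "integrable lborel (\<lambda>t. (cmod (f t + g t))\<^sup>2)"
  proof (rule Bochner_Integration.integrable_bound)
    show "integrable lborel (\<lambda>t. 2 * (cmod (f t))\<^sup>2 + 2 * (cmod (g t))\<^sup>2)"
      using f g by (auto simp: square_integrable_def)
    show "AE t in lborel. norm ((cmod (f t + g t))\<^sup>2)
            \<le> norm (2 * (cmod (f t))\<^sup>2 + 2 * (cmod (g t))\<^sup>2)"
    proof (rule AE_I2)
      fix t
      have "(cmod (f t + g t))\<^sup>2 \<le> (cmod (f t) + cmod (g t))\<^sup>2"
        by (simp add: norm_triangle_ineq power_mono)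
      also have "\<dots> \<le> 2 * (cmod (f t))\<^sup>2 + 2 * (cmod (g t))\<^sup>2"
        using sum_squares_bound[of "cmod (f t)" "cmod (g t)"] by (simp add: power2_sum)
      finally show "norm ((cmod (f t + g t))\<^sup>2)
            \<le> norm (2 * (cmod (f t))\<^sup>2 + 2 * (cmod (g t))\<^sup>2)" by simp
    qed
  qed measurable
  then show ?thesis by (simp add: square_integrable_def)
qed

lemma integrable_square_integrable_mult_cnj:
  assumes f: "square_integrable f" and g: "square_integrable g"
  shows "integrable lborel (\<lambda>t. f t * cnj (g t))"
proof -
  have [measurable]: "f \<in> borel_measurable lborel" "g \<in> borel_measurable lborel"
    using f g by (auto simp: square_integrable_def)
  have cnj: "cnj \<in> borel_measurable borel"
    by (intro borel_measurable_continuous_onI continuous_intros)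
  show ?thesis
  proof (rule Bochner_Integration.integrable_bound)
    show "integrable lborel (\<lambda>t. (cmod (f t))\<^sup>2 + (cmod (g t))\<^sup>2)"
      using f g by (auto simp: square_integrable_def)
    show "AE t in lborel. norm (f t * cnj (g t)) \<le> norm ((cmod (f t))\<^sup>2 + (cmod (g t))\<^sup>2)"
    proof (rule AE_I2)
      fix t
      have "cmod (f t) * cmod (g t) \<ge> 0" by simp
      then show "norm (f t * cnj (g t)) \<le> norm ((cmod (f t))\<^sup>2 + (cmod (g t))\<^sup>2)"
        using sum_squares_bound[of "cmod (f t)" "cmod (g t)"]
        unfolding norm_mult complex_mod_cnj real_norm_def by linarith
    qed
  qed (auto intro!: borel_measurable_times measurable_compose[OF _ cnj])
qed

quotient_type (overloaded) 'a L2 = "'a::euclidean_space \<Rightarrow> complex" /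
  partial: "\<lambda>f g. square_integrable f \<and> square_integrable g \<and> (AE t in lborel. f t = g t)"
proof (rule part_equivpI)
  show "\<exists>f::'a \<Rightarrow> complex.
          square_integrable f \<and> square_integrable f \<and> (AE t in lborel. f t = f t)"
    using square_integrable_zero by blast
  show "symp (\<lambda>f (g::'a \<Rightarrow> complex).
          square_integrable f \<and> square_integrable g \<and> (AE t in lborel. f t = g t))"
    by (auto simp: symp_def elim: AE_mp)
  show "transp (\<lambda>f (g::'a \<Rightarrow> complex).
          square_integrable f \<and> square_integrable g \<and> (AE t in lborel. f t = g t))"
    unfolding transp_def by (auto elim: AE_mp)
qed

text \<open>Linear in the first and conjugate-linear in the second argument.\<close>

lift_definition cinner_L2 :: "'a::euclidean_space L2 \<Rightarrow> 'a L2 \<Rightarrow> complex"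
  is "\<lambda>f g. LINT t|lborel. f t * cnj (g t)"
proof -
  fix f f' g g' :: "'a \<Rightarrow> complex"
  assume f: "square_integrable f \<and> square_integrable f' \<and> (AE t in lborel. f t = f' t)"
    and g: "square_integrable g \<and> square_integrable g' \<and> (AE t in lborel. g t = g' t)"
  show "(LINT t|lborel. f t * cnj (g t)) = (LINT t|lborel. f' t * cnj (g' t))"
  proof (rule integral_cong_AE)
    show "AE t in lborel. f t * cnj (g t) = f' t * cnj (g' t)"
      using conjunct2[OF conjunct2[OF f]] conjunct2[OF conjunct2[OF g]] by eventually_elim simp
  qed (use f g in \<open>blast intro: borel_measurable_integrable integrable_square_integrable_mult_cnj\<close>)+
qed

lift_definition scaleC_L2 :: "complex \<Rightarrow> 'a::euclidean_space L2 \<Rightarrow> 'a L2"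
  is "\<lambda>c f t. c * f t"
  by (auto simp: square_integrable_scale elim: AE_mp)

instantiation L2 :: (euclidean_space) real_inner
begin

lift_definition zero_L2 :: "'a L2" is "\<lambda>_. 0"
  by (simp add: square_integrable_zero)

lift_definition plus_L2 :: "'a L2 \<Rightarrow> 'a L2 \<Rightarrow> 'a L2" is "\<lambda>f g t. f t + g t"
  by (auto intro: square_integrable_add elim!: AE_mp)

definition scaleR_L2 :: "real \<Rightarrow> 'a L2 \<Rightarrow> 'a L2" where
  "scaleR_L2 r = scaleC_L2 (of_real r)"

definition uminus_L2 :: "'a L2 \<Rightarrow> 'a L2" where
  "uminus_L2 = scaleC_L2 (- 1)"

definition minus_L2 :: "'a L2 \<Rightarrow> 'a L2 \<Rightarrow> 'a L2" where
  "minus_L2 x y = x + - y"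

definition inner_L2 :: "'a L2 \<Rightarrow> 'a L2 \<Rightarrow> real" where
  "inner_L2 x y = Re (cinner_L2 x y)"

definition norm_L2 :: "'a L2 \<Rightarrow> real" where
  "norm_L2 x = sqrt (x \<bullet> x)"

definition sgn_L2 :: "'a L2 \<Rightarrow> 'a L2" where
  "sgn_L2 x = inverse (norm x) *\<^sub>R x"

definition dist_L2 :: "'a L2 \<Rightarrow> 'a L2 \<Rightarrow> real" where
  "dist_L2 x y = norm (x - y)"

definition uniformity_L2 :: "('a L2 \<times> 'a L2) filter" where
  "uniformity_L2 = (INF e\<in>{0 <..}. principal {(x, y). dist x y < e})"

definition open_L2 :: "'a L2 set \<Rightarrow> bool" where
  "open_L2 U \<longleftrightarrow> (\<forall>x\<in>U. eventually (\<lambda>(x', y). x' = x \<longrightarrow> y \<in> U) uniformity)"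

lemma cinner_L2_self: "Re (cinner_L2 (x::'a L2) x) \<ge> 0 \<and> (Re (cinner_L2 x x) = 0 \<longleftrightarrow> x = 0)"
proof transfer
  fix f :: "'a \<Rightarrow> complex"
  assume "square_integrable f \<and> square_integrable f \<and> (AE t in lborel. f t = f t)"
  then have f: "square_integrable f" by simp
  then have [measurable]: "f \<in> borel_measurable lborel"
    and int: "integrable lborel (\<lambda>t. (cmod (f t))\<^sup>2)"
    by (auto simp: square_integrable_def)
  have eq: "Re (LINT t|lborel. f t * cnj (f t)) = (LINT t|lborel. (cmod (f t))\<^sup>2)"
    by (simp add: complex_norm_square[symmetric] flip: of_real_power)
  have "(LINT t|lborel. (cmod (f t))\<^sup>2) = 0 \<longleftrightarrow> (AE t in lborel. f t = 0)"
    by (subst integral_nonneg_eq_0_iff_AE[OF int]) auto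
  then show "0 \<le> Re (LINT t|lborel. f t * cnj (f t)) \<and>
      (Re (LINT t|lborel. f t * cnj (f t)) = 0 \<longleftrightarrow>
        square_integrable f \<and> square_integrable (\<lambda>_::'a. 0::complex) \<and> (AE t in lborel. f t = 0))"
    unfolding eq using f square_integrable_zero[where 'a='a] by simp
qed

instance
proof
  fix x y z :: "'a L2" and r s :: real
  show "x + y + z = x + (y + z)"
    by transfer (auto simp: add.assoc intro!: square_integrable_add)
  show "x + y = y + x"
    by transfer (auto simp: add.commute intro!: square_integrable_add)
  show "0 + x = x"
    by transfer auto
  show "- x + x = 0"
    unfolding uminus_L2_def
    by transfer (auto simp: square_integrable_zero)
  show "x - y = x + - y"
    by (fact minus_L2_def)
  show "r *\<^sub>R (x + y) = r *\<^sub>R x + r *\<^sub>R y"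
    unfolding scaleR_L2_def
    by transfer (auto simp: ring_distribs intro!: square_integrable_add square_integrable_scale)
  show "(r + s) *\<^sub>R x = r *\<^sub>R x + s *\<^sub>R x"
    unfolding scaleR_L2_def
    by transfer (auto simp: ring_distribs intro!: square_integrable_add square_integrable_scale)
  show "r *\<^sub>R s *\<^sub>R x = (r * s) *\<^sub>R x"
    unfolding scaleR_L2_def
    by transfer (auto simp: mult.assoc
        intro!: square_integrable_scale[of "\<lambda>t. _ * _ t"] square_integrable_scale)
  show "1 *\<^sub>R x = x"
    unfolding scaleR_L2_def by transfer auto
  show "sgn x = inverse (norm x) *\<^sub>R x" by (fact sgn_L2_def)
  show "dist x y = norm (x - y)" by (fact dist_L2_def)
  show "(uniformity :: ('a L2 \<times> 'a L2) filter) = (INF e\<in>{0 <..}. principal {(x, y). dist x y < e})"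
    by (fact uniformity_L2_def)
  show "open U \<longleftrightarrow> (\<forall>x\<in>U. eventually (\<lambda>(x', y). x' = x \<longrightarrow> y \<in> U) uniformity)"
    for U :: "'a L2 set"
    by (fact open_L2_def)
  have "(LINT t|lborel. f t * cnj (g t)) = cnj (LINT t|lborel. g t * cnj (f t))"
    for f g :: "'a \<Rightarrow> complex"
    using Bochner_Integration.integral_cnj[of lborel "\<lambda>t. g t * cnj (f t)"] by (simp add: mult.commute)
  then have "cinner_L2 x y = cnj (cinner_L2 y x)"
    by transfer blast
  then show "x \<bullet> y = y \<bullet> x" by (simp add: inner_L2_def)
  have "cinner_L2 (x + y) z = cinner_L2 x z + cinner_L2 y z"
    by transfer (simp add: ring_distribs integrable_square_integrable_mult_cnj)
  then show "(x + y) \<bullet> z = x \<bullet> z + y \<bullet> z" by (simp add: inner_L2_def)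
  have "cinner_L2 (scaleC_L2 (of_real r) x) y = of_real r * cinner_L2 x y"
    by transfer (simp add: mult.assoc)
  then show "r *\<^sub>R x \<bullet> y = r * (x \<bullet> y)"
    by (simp add: inner_L2_def scaleR_L2_def)
  show "0 \<le> x \<bullet> x" "x \<bullet> x = 0 \<longleftrightarrow> x = 0"
    using cinner_L2_self[of x] by (auto simp: inner_L2_def)
  show "norm x = sqrt (x \<bullet> x)" by (fact norm_L2_def)
qed

end

text \<open>Boundedness is implied by the last conjunct.\<close>

definition compact_operator ::
  "('a::euclidean_space L2 \<Rightarrow> 'b::euclidean_space L2) \<Rightarrow> bool" where
  "compact_operator T \<longleftrightarrow>
     (\<forall>\<psi> \<phi>. T (\<psi> + \<phi>) = T \<psi> + T \<phi>) \<and>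
     (\<forall>c \<psi>. T (scaleC_L2 c \<psi>) = scaleC_L2 c (T \<psi>)) \<and>
     (\<forall>B. bounded B \<longrightarrow> compact (closure (T ` B)))"


section \<open>Time-frequency analysis\<close>

lift_definition tf_shift :: "'a::euclidean_space \<times> 'a \<Rightarrow> 'a L2 \<Rightarrow> 'a L2"
  is "\<lambda>(x, \<omega>) \<psi> t. exp (2 * of_real pi * \<i> * of_real (\<omega> \<bullet> t)) * \<psi> (t - x)"
proof (clarsimp, intro conjI)
  fix x \<omega> :: 'a and f g :: "'a \<Rightarrow> complex"
  let ?S = "\<lambda>f t. exp (2 * of_real pi * \<i> * of_real (\<omega> \<bullet> t)) * f (t - x)"
  assume f: "square_integrable f" and g: "square_integrable g"
    and ae: "AE t in lborel. f t = g t"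
  have "(\<lambda>t. t - x) = (+) (- x)" by auto
  then have distr: "distr lborel borel (\<lambda>t. t - x) = lborel"
    using lborel_distr_plus[of "- x"] by metis
  have shift: "square_integrable (?S h)" if "square_integrable h" for h
  proof -
    have [measurable]: "h \<in> borel_measurable borel"
      using that by (simp add: square_integrable_def)
    have "integrable lborel (\<lambda>t. (cmod (h (t - x)))\<^sup>2)"
      using that
      by (subst integrable_distr_eq[where g="\<lambda>t. t - x" and N=borel
            and f="\<lambda>t. (cmod (h t))\<^sup>2" and M=lborel, symmetric])
         (auto simp: square_integrable_def distr)
    then show ?thesis
      by (simp add: square_integrable_def norm_mult)
  qed
  show "square_integrable (?S f)" "square_integrable (?S g)"
    using f g shift by auto
  have [measurable]: "f \<in> borel_measurable borel" "g \<in> borel_measurable borel"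
    using f g by (auto simp: square_integrable_def)
  have "AE t in distr lborel borel (\<lambda>t. t - x). f t = g t"
    unfolding distr by (fact ae)
  then have "AE t in lborel. f (t - x) = g (t - x)"
    by (subst (asm) AE_distr_iff) auto
  then show "AE t in lborel. f (t - x) = g (t - x)" .
qed

definition stft :: "'a::euclidean_space L2 \<Rightarrow> 'a L2 \<Rightarrow> 'a \<times> 'a \<Rightarrow> complex" where
  "stft \<phi> \<psi> z = cinner_L2 \<psi> (tf_shift z \<phi>)"

lemma integrable_gaussian:
  "integrable lborel (\<lambda>t::'a::euclidean_space. exp (- 2 * pi * (norm t)\<^sup>2))"
proof -
  interpret product_sigma_finite "\<lambda>_::'a. lborel :: real measure" ..
  have "integrable lborel (normal_density 0 (1 / (2 * sqrt pi)))"
    by (rule integrable_normal_density) simp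
  moreover have "normal_density 0 (1 / (2 * sqrt pi)) = (\<lambda>s. sqrt 2 * exp (- 2 * pi * s\<^sup>2))"
    by (rule ext) (simp add: normal_density_def power_divide power_mult_distrib real_sqrt_divide)
  ultimately have 1: "integrable lborel (\<lambda>s::real. exp (- 2 * pi * s\<^sup>2))"
    by simp
  have 2: "(\<Prod>b\<in>Basis. exp (- 2 * pi * (x b)\<^sup>2))
      = exp (- 2 * pi * (norm (\<Sum>b\<in>Basis. x b *\<^sub>R b :: 'a))\<^sup>2)" for x :: "'a \<Rightarrow> real"
  proof -
    have "(norm (\<Sum>b\<in>Basis. x b *\<^sub>R b :: 'a))\<^sup>2 = (\<Sum>b\<in>(Basis::'a set). (x b)\<^sup>2)"
      unfolding power2_norm_eq_inner
      by (subst euclidean_inner) (simp add: power2_eq_square)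
    then show ?thesis
      by (simp add: exp_sum sum_distrib_left)
  qed
  have "integrable (\<Pi>\<^sub>M b\<in>Basis::'a set. lborel) (\<lambda>x. \<Prod>b\<in>Basis. exp (- 2 * pi * (x b)\<^sup>2))"
    using 1 by (intro product_integrable_prod) auto
  then show ?thesis
    unfolding 2 by (subst lborel_eq) (subst integrable_distr_eq, auto)
qed

lemma square_integrable_gaussian:
  "square_integrable (\<lambda>t::'a::euclidean_space.
     of_real (2 powr (DIM('a) / 4) * exp (- pi * (norm t)\<^sup>2)))"
proof -
  have "integrable lborel (\<lambda>t::'a. (2 powr (DIM('a) / 4))\<^sup>2 * exp (- 2 * pi * (norm t)\<^sup>2))"
    using integrable_gaussian by simp
  moreover have "(exp (- pi * (norm t)\<^sup>2))\<^sup>2 = exp (- 2 * pi * (norm t)\<^sup>2)" for t :: 'a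
    by (simp flip: exp_double)
  ultimately show ?thesis
    by (simp add: square_integrable_def power_mult_distrib norm_mult)
qed

lift_definition gaussian :: "'a::euclidean_space L2"
  is "\<lambda>t. of_real (2 powr (DIM('a) / 4) * exp (- pi * (norm t)\<^sup>2))"
  using square_integrable_gaussian by blast


section \<open>Function spaces and convolution on phase space\<close>

text \<open>Elements of \<^term>\<open>Linfinity\<close> are representatives rather than classes; the integrals
  below do not distinguish almost everywhere equal symbols.\<close>

definition Linfinity :: "('a::euclidean_space \<Rightarrow> complex) set" where
  "Linfinity = {f \<in> borel_measurable lebesgue. \<exists>C. AE z in lebesgue. cmod (f z) \<le> C}"

definition C0 :: "('a::euclidean_space \<Rightarrow> complex) set" where
  "C0 = {g. continuous_on UNIV g \<and> (g \<longlongrightarrow> 0) at_infinity}"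

definition fun_convolution ::
  "('a::euclidean_space \<Rightarrow> complex) \<Rightarrow> ('a \<Rightarrow> complex) \<Rightarrow> 'a \<Rightarrow> complex" where
  "fun_convolution f g z = (LINT w|lebesgue. f w * g (z - w))"

text \<open>The description is proper: for bounded symbols the right-hand side is a bounded
  conjugate-linear functional of \<open>\<phi>\<close>, so the Riesz representation theorem provides
  the unique \<open>\<eta>\<close>.\<close>

definition localization_operator ::
  "('a::euclidean_space \<times> 'a \<Rightarrow> complex) \<Rightarrow> 'a L2 \<Rightarrow> 'a L2 \<Rightarrow> 'a L2 \<Rightarrow> 'a L2" where
  "localization_operator f \<psi>\<^sub>1 \<psi>\<^sub>2 \<psi> =
     (THE \<eta>. \<forall>\<phi>. cinner_L2 \<eta> \<phi> =
        (LINT z|lebesgue. f z * stft \<psi>\<^sub>1 \<psi> z * cnj (stft \<psi>\<^sub>2 \<phi> z)))"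

end

theory Submission
  imports Defs
begin

text \<open>Write \<open>\<phi>\<^sub>z\<close> for the coherent state \<open>\<pi>(z) \<phi>\<^sub>0\<close>, \<open>h\<close> for the product of the two Gaussian transforms in
  the statement, and \<open>A(f; \<psi>\<^sub>1, \<psi>\<^sub>2)\<close> for the localization operator. By covariance
  \<open>(f * h)(z)\<close> is the Berezin transform \<open>\<langle>A \<phi>\<^sub>z, \<phi>\<^sub>z\<rangle>\<close>. Coherent states tend weakly to \<open>0\<close> at
  infinity, so compactness of \<open>A\<close> makes it vanish there.

  For the converse put \<open>E\<^sub>s(z) = exp(-s |z|\<^sup>2)\<close>. The operators \<open>A(f * E\<^sub>\<pi>; \<psi>\<^sub>1, \<psi>\<^sub>2)\<close> and
  \<open>A(f * h; \<phi>\<^sub>0, \<phi>\<^sub>0)\<close> agree for every bounded \<open>f\<close>: by covariance and density this is a Gaussian integral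
  for coherent states. If \<open>f * h\<close> vanishes at infinity, the second operator is compact, and replacing
  \<open>f\<close> by \<open>f * E\<^sub>t\<close> one sees that \<open>A(f * E\<^sub>s; \<psi>\<^sub>1, \<psi>\<^sub>2)\<close> is compact for \<open>0 < s < \<pi>\<close>. The integrable
  \<open>k\<close> for which \<open>A(f * k; \<psi>\<^sub>1, \<psi>\<^sub>2)\<close> is compact form a closed subspace of \<open>L\<^sup>1\<close>; with the \<open>E\<^sub>s\<close> on an
  interval it contains their derivatives in \<open>s\<close> and, through Taylor expansion in \<open>s\<close>, all \<open>E\<^sub>s\<close>
  (Wiener's theorem for Gaussians). Finally the normalized \<open>A(f * E\<^sub>s; \<psi>\<^sub>1, \<psi>\<^sub>2)\<close> tend to
  \<open>A(f; \<psi>\<^sub>1, \<psi>\<^sub>2)\<close> in norm as \<open>s \<rightarrow> \<infinity>\<close>, because convolving \<open>f\<close> amounts to averaging over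
  time-frequency shifts of the windows, on which they act continuously.\<close>

section \<open>The Hilbert space structure\<close>

text \<open>The number \<open>pi\<close> in E_pi is forced:
  \<open>exp (- pi * (norm z)\<^sup>2)\<close> is the squared modulus of the Gaussian's own
  transform. The agreement of the two operators expresses that convolution of functions with
  rank-one operators, and of rank-one operators with each other, is associative and commutative:
  convolving the rank-one operator built from the windows twice with the Gaussian projection amounts
  to convolving it with E_pi. The obstacle is that smoothing only widens. E_t * E_pi is a multiple
  of E_s with s = t pi / (t + pi) < pi, so the hypothesis speaks directly of wide kernels only,
  whereas narrow ones are those that approximate the identity. Undoing a Gaussian smoothing is
  unbounded; analyticity in s replaces it and carries compactness past the barrier s = pi. Operators
  enter through their sesquilinear forms, which turns operator-valued integrals into absolutely
  convergent scalar ones and compactness into an estimate that survives limits.\<close>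

lemma cnj_borel [measurable]: "cnj \<in> borel_measurable borel"
  by (intro borel_measurable_continuous_onI continuous_intros)

lemma rep_L2_square_integrable [simp]: "square_integrable (rep_L2 u)"
  using Quotient3_rep_reflp[OF Quotient3_L2] by blast

lemma rep_L2_measurable [measurable]: "rep_L2 u \<in> borel_measurable borel"
  using rep_L2_square_integrable[of u] by (simp add: square_integrable_def)

lemma rep_L2_integrable_norm_sq: "integrable lborel (\<lambda>t. (cmod (rep_L2 u t))\<^sup>2)"
  using rep_L2_square_integrable[of u] by (simp add: square_integrable_def)

lemma abs_rep_L2 [simp]: "abs_L2 (rep_L2 u) = u"
  by (rule Quotient3_abs_rep[OF Quotient3_L2])

lemma rep_abs_L2_AE:
  assumes "square_integrable f"
  shows "AE t in lborel. rep_L2 (abs_L2 f) t = f t"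
  using Quotient3_rep_abs[OF Quotient3_L2, of f] assms by auto

lemma abs_L2_eqI:
  assumes "square_integrable f" "AE t in lborel. rep_L2 u t = f t"
  shows "u = abs_L2 f"
  using Quotient3_rel[OF Quotient3_L2, of "rep_L2 u" f] assms by simp

lemma cinner_L2_rep: "cinner_L2 u v = (LINT t|lborel. rep_L2 u t * cnj (rep_L2 v t))"
  by (simp add: cinner_L2_def)

lemma rep_L2_plus_AE: "AE t in lborel. rep_L2 (u + v) t = rep_L2 u t + rep_L2 v t"
  using rep_abs_L2_AE[OF square_integrable_add[of "rep_L2 u" "rep_L2 v"]] by (simp add: plus_L2_def)

lemma cinner_L2_add_left: "cinner_L2 (x + y) z = cinner_L2 x z + cinner_L2 y z"
  by transfer (simp add: ring_distribs integrable_square_integrable_mult_cnj)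

lemma cinner_L2_scaleC_left: "cinner_L2 (scaleC_L2 c x) y = c * cinner_L2 x y"
  by transfer (simp add: mult.assoc)

lemma cinner_L2_commute: "cinner_L2 x y = cnj (cinner_L2 y x)"
proof -
  have "(LINT t|lborel. f t * cnj (g t)) = cnj (LINT t|lborel. g t * cnj (f t))"
    for f g :: "'a \<Rightarrow> complex"
    using Bochner_Integration.integral_cnj[of lborel "\<lambda>t. g t * cnj (f t)"] by (simp add: mult.commute)
  then show ?thesis by transfer blast
qed

lemma cinner_L2_add_right: "cinner_L2 z (x + y) = cinner_L2 z x + cinner_L2 z y"
  using cinner_L2_add_left[of x y z] by (metis cinner_L2_commute complex_cnj_add)

lemma cinner_L2_scaleC_right: "cinner_L2 x (scaleC_L2 c y) = cnj c * cinner_L2 x y"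
  by (metis cinner_L2_commute cinner_L2_scaleC_left complex_cnj_mult)

lemma scaleC_L2_scaleC_L2: "scaleC_L2 a (scaleC_L2 b x) = scaleC_L2 (a * b) x"
  by transfer (auto simp: mult.assoc intro!: square_integrable_scale[of "\<lambda>t. _ * _ t"] square_integrable_scale)

lemma scaleC_L2_one [simp]: "scaleC_L2 1 x = x"
  by transfer auto

lemma scaleC_L2_add: "scaleC_L2 c (x + y) = scaleC_L2 c x + scaleC_L2 c y"
  by transfer (auto simp: ring_distribs intro!: square_integrable_add square_integrable_scale)

lemma cinner_L2_self_norm: "cinner_L2 u u = of_real ((norm u)\<^sup>2)"
proof -
  have "cinner_L2 u u = of_real (Re (cinner_L2 u u))"
    using cinner_L2_commute[of u u] by (simp add: complex_eq_iff)
  then show ?thesis by (simp add: power2_norm_eq_inner inner_L2_def)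
qed

lemma norm_L2_sq_rep: "(norm u)\<^sup>2 = (LINT t|lborel. (cmod (rep_L2 u t))\<^sup>2)"
proof -
  have "of_real ((norm u)\<^sup>2) = (LINT t|lborel. complex_of_real ((cmod (rep_L2 u t))\<^sup>2))"
    unfolding cinner_L2_self_norm[symmetric] cinner_L2_rep by (simp only: complex_norm_square)
  also have "\<dots> = of_real (LINT t|lborel. (cmod (rep_L2 u t))\<^sup>2)"
    by (rule integral_complex_of_real)
  finally show ?thesis by (simp only: of_real_eq_iff)
qed

lemma norm_scaleC_L2: "norm (scaleC_L2 c x) = cmod c * norm x"
proof -
  have "of_real ((norm (scaleC_L2 c x))\<^sup>2) = c * cnj c * of_real ((norm x)\<^sup>2)"
    unfolding cinner_L2_self_norm[symmetric] cinner_L2_scaleC_left cinner_L2_scaleC_right by simp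
  also have "\<dots> = of_real ((cmod c * norm x)\<^sup>2)"
    by (simp only: power_mult_distrib of_real_mult complex_norm_square[of c])
  finally have "(norm (scaleC_L2 c x))\<^sup>2 = (cmod c * norm x)\<^sup>2"
    by (simp only: of_real_eq_iff)
  then show ?thesis by (simp add: power2_eq_iff_nonneg)
qed

text \<open>The instance \<open>real_inner\<close> gives the inequality for real parts. Multiplying
  \<open>u\<close> by the unimodular \<open>c\<close> makes the complex inner product real and
  nonnegative without changing the norm of \<open>u\<close>.\<close>

lemma cinner_L2_Cauchy_Schwarz: "cmod (cinner_L2 u v) \<le> norm u * norm v"
proof (cases "cinner_L2 u v = 0")
  case False
  define c where "c = cnj (sgn (cinner_L2 u v))"
  have "cmod (cinner_L2 u v) = Re (c * cinner_L2 u v)"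
  proof -
    have "c * cinner_L2 u v = of_real (cmod (cinner_L2 u v))"
      using False complex_norm_square[of "cinner_L2 u v"]
      by (simp add: c_def sgn_div_norm power2_eq_square scaleR_conv_of_real field_simps)
    then show ?thesis by simp
  qed
  also have "\<dots> = scaleC_L2 c u \<bullet> v"
    by (simp add: inner_L2_def cinner_L2_scaleC_left)
  also have "\<dots> \<le> norm (scaleC_L2 c u) * norm v"
    by (rule norm_cauchy_schwarz)
  also have "\<dots> = norm u * norm v"
    using False by (simp add: norm_scaleC_L2 c_def norm_sgn)
  finally show ?thesis .
qed simp

interpretation scaleC_L2: bounded_bilinear scaleC_L2
proof
  fix a b :: complex and u v :: "'a L2" and r :: real
  show "scaleC_L2 (a + b) u = scaleC_L2 a u + scaleC_L2 b u"
    by transfer (auto simp: ring_distribs intro!: square_integrable_add square_integrable_scale)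
  show "scaleC_L2 (r *\<^sub>R a) u = r *\<^sub>R scaleC_L2 a u" "scaleC_L2 a (r *\<^sub>R u) = r *\<^sub>R scaleC_L2 a u"
    by (simp_all add: scaleR_L2_def scaleC_L2_scaleC_L2 scaleR_conv_of_real mult.commute)
  show "\<exists>K. \<forall>a (u :: 'a L2). norm (scaleC_L2 a u) \<le> norm a * norm u * K"
    by (intro exI[of _ 1]) (simp add: norm_scaleC_L2)
qed (rule scaleC_L2_add)

text \<open>Conjugate-linearity is in particular real linearity, so the real notion of bilinearity
  applies and supplies continuity and difference rules in both arguments.\<close>

interpretation cinner_L2: bounded_bilinear cinner_L2
proof
  show "\<exists>K. \<forall>a (b :: 'a L2). norm (cinner_L2 a b) \<le> norm a * norm b * K"
    by (intro exI[of _ 1]) (simp add: cinner_L2_Cauchy_Schwarz)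
qed (simp_all add: cinner_L2_add_left cinner_L2_add_right scaleR_L2_def cinner_L2_scaleC_left
      cinner_L2_scaleC_right scaleR_conv_of_real)

lemma cinner_L2_left_eqI:
  assumes "\<And>v. cinner_L2 x v = cinner_L2 y v"
  shows "x = y"
  using cinner_L2_self[of "x - y"] by (simp add: cinner_L2.diff_left assms)

section \<open>Completeness of the space of square-integrable classes\<close>

lemma suminf_term_le: "h n \<le> (\<Sum>n. h n :: ennreal)"
  using sum_le_suminf[of h "{n}"] by (simp add: summableI)

text \<open>Riesz-Fischer for a geometric rate: a weighted sum of the squared increments is
  integrable, so almost every pointwise sequence has increments dominated by a geometric series.
  Fatou's lemma turns the pointwise limit into a norm limit.\<close>

lemma L2_Cauchy_fast_convergent:
  fixes X :: "nat \<Rightarrow> 'a::euclidean_space L2"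
  assumes fast: "\<And>n m. n \<le> m \<Longrightarrow> norm (X m - X n) \<le> (1/2) ^ n"
  shows "convergent X"
proof -
  define f where "f n = rep_L2 (X n)" for n
  have [measurable]: "f n \<in> borel_measurable borel" for n unfolding f_def by simp
  have diff_AE: "AE t in lborel. rep_L2 (X m - X n) t = f m t - f n t" for m n
    using rep_L2_plus_AE[of "X m - X n" "X n"]
    by eventually_elim (simp add: f_def)
  have int_diff: "(\<integral>\<^sup>+t. ennreal ((cmod (f m t - f n t))\<^sup>2) \<partial>lborel) = ennreal ((norm (X m - X n))\<^sup>2)" for m n
  proof -
    have "(\<integral>\<^sup>+t. ennreal ((cmod (f m t - f n t))\<^sup>2) \<partial>lborel)
      = (\<integral>\<^sup>+t. ennreal ((cmod (rep_L2 (X m - X n) t))\<^sup>2) \<partial>lborel)"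
      using diff_AE[of m n] by (intro nn_integral_cong_AE) (auto elim: AE_mp)
    also have "\<dots> = ennreal ((norm (X m - X n))\<^sup>2)"
      unfolding norm_L2_sq_rep by (intro nn_integral_eq_integral rep_L2_integrable_norm_sq) simp
    finally show ?thesis .
  qed
  \<comment> \<open>The squared increments integrate to at most \<open>(1/4)^n\<close>, so the
    weight \<open>2^n\<close> leaves a convergent sum; finiteness of that sum at \<open>t\<close>
    bounds the increments there by a multiple of \<open>(1 / sqrt 2)^n\<close>.\<close>
  define d where "d n t = ennreal (2^n * (cmod (f (Suc n) t - f n t))\<^sup>2)" for n t
  have [measurable]: "d n \<in> borel_measurable borel" for n unfolding d_def by measurable
  have "(\<integral>\<^sup>+t. (\<Sum>n. d n t) \<partial>lborel) = (\<Sum>n. \<integral>\<^sup>+t. d n t \<partial>lborel)"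
    by (intro nn_integral_suminf) measurable
  also have "\<dots> = (\<Sum>n. ennreal (2^n) * ennreal ((norm (X (Suc n) - X n))\<^sup>2))"
    unfolding int_diff[symmetric] d_def by (subst nn_integral_cmult[symmetric]) (auto simp: ennreal_mult)
  also have "\<dots> \<le> (\<Sum>n. ennreal ((1/2)^n))"
  proof (intro suminf_le summableI)
    fix n
    have "2^n * (norm (X (Suc n) - X n))\<^sup>2 \<le> 2^n * ((1/2::real)^n)\<^sup>2"
      using fast[of n "Suc n"] by (intro mult_left_mono power_mono) auto
    also have "\<dots> = (1/2)^n"
      by (simp add: power2_eq_square flip: power_mult_distrib)
    finally show "ennreal (2^n) * ennreal ((norm (X (Suc n) - X n))\<^sup>2) \<le> ennreal ((1/2)^n)"
      by (simp add: ennreal_mult[symmetric] ennreal_leI del: ennreal_mult)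
  qed
  also have "\<dots> < \<infinity>"
    by (subst suminf_ennreal2) (auto intro!: summable_geometric)
  finally have "AE t in lborel. (\<Sum>n. d n t) \<noteq> \<infinity>"
    by (intro nn_integral_PInf_AE) auto
  then have conv: "AE t in lborel. convergent (\<lambda>n. f n t)"
  proof eventually_elim
    case (elim t)
    define S where "S = enn2real (\<Sum>n. d n t)"
    have S0: "0 \<le> S" by (simp add: S_def)
    have le: "cmod (f (Suc n) t - f n t) \<le> sqrt S * (1 / sqrt 2) ^ n" for n
    proof -
      have "d n t \<le> (\<Sum>n. d n t)"
        by (rule suminf_term_le)
      also have "\<dots> = ennreal S" using elim unfolding S_def by (simp only: ennreal_enn2real_if infinity_ennreal_def if_False)
      finally have "2^n * (cmod (f (Suc n) t - f n t))\<^sup>2 \<le> S" using S0 by (simp add: d_def)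
      then have "(cmod (f (Suc n) t - f n t))\<^sup>2 \<le> S * (1/2)^n" by (simp add: field_simps)
      also have "\<dots> = (sqrt S * (1 / sqrt 2) ^ n)\<^sup>2"
        using S0 by (simp add: power_mult_distrib power_mult[symmetric] mult.commute[of _ 2])
          (simp add: power_mult power_divide)
      finally show ?thesis by (rule power2_le_imp_le) (simp add: S0)
    qed
    have "summable (\<lambda>n. f (Suc n) t - f n t)"
      by (rule summable_comparison_test[where g="\<lambda>n. sqrt S * (1 / sqrt 2) ^ n"])
         (use le in \<open>auto intro!: summable_mult summable_geometric\<close>)
    then have "convergent (\<lambda>n. \<Sum>i<n. f (Suc i) t - f i t)"
      by (simp add: summable_iff_convergent)
    then have "convergent (\<lambda>n. f 0 t + (\<Sum>i<n. f (Suc i) t - f i t))"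
      by (intro convergent_add convergent_const)
    moreover have "f 0 t + (\<Sum>i<n. f (Suc i) t - f i t) = f n t" for n
      using sum_lessThan_telescope[of "\<lambda>n. f n t" n] by simp
    ultimately show ?case by simp
  qed
  \<comment> \<open>On the null set of divergence \<open>lim\<close> is some unspecified value;
    \<open>g\<close> is measurable nonetheless.\<close>
  define g where "g t = lim (\<lambda>n. f n t)" for t
  have [measurable]: "g \<in> borel_measurable borel"
    unfolding g_def by measurable
  have lim: "AE t in lborel. (\<lambda>n. f n t) \<longlonglongrightarrow> g t"
    using conv by eventually_elim (simp add: g_def convergent_LIMSEQ_iff)
  have bound: "(\<integral>\<^sup>+t. ennreal ((cmod (g t - f n t))\<^sup>2) \<partial>lborel) \<le> ennreal (((1/2)^n)\<^sup>2)" for n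
  proof -
    have "(\<integral>\<^sup>+t. ennreal ((cmod (g t - f n t))\<^sup>2) \<partial>lborel)
       = (\<integral>\<^sup>+t. liminf (\<lambda>m. ennreal ((cmod (f m t - f n t))\<^sup>2)) \<partial>lborel)"
    proof (rule nn_integral_cong_AE)
      show "AE t in lborel. ennreal ((cmod (g t - f n t))\<^sup>2) = liminf (\<lambda>m. ennreal ((cmod (f m t - f n t))\<^sup>2))"
        using lim
      proof eventually_elim
        case (elim t)
        have "(\<lambda>m. ennreal ((cmod (f m t - f n t))\<^sup>2)) \<longlonglongrightarrow> ennreal ((cmod (g t - f n t))\<^sup>2)"
          by (intro tendsto_ennrealI tendsto_intros elim)
        then show ?case by (rule lim_imp_Liminf[OF sequentially_bot, symmetric])
      qed
    qed
    also have "\<dots> \<le> liminf (\<lambda>m. \<integral>\<^sup>+t. ennreal ((cmod (f m t - f n t))\<^sup>2) \<partial>lborel)"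
      by (rule nn_integral_liminf) measurable
    also have "\<dots> \<le> ennreal (((1/2)^n)\<^sup>2)"
    proof (rule Liminf_le)
      show "\<forall>\<^sub>F m in sequentially. (\<integral>\<^sup>+t. ennreal ((cmod (f m t - f n t))\<^sup>2) \<partial>lborel) \<le> ennreal (((1/2)^n)\<^sup>2)"
        using eventually_ge_at_top[of n]
        by eventually_elim (use fast in \<open>auto simp: int_diff intro!: ennreal_leI power_mono\<close>)
    qed simp
    finally show ?thesis .
  qed
  have sq_diff: "square_integrable (\<lambda>t. g t - f n t)" for n
    unfolding square_integrable_def
  proof
    have "(\<integral>\<^sup>+t. ennreal (norm ((cmod (g t - f n t))\<^sup>2)) \<partial>lborel) < \<infinity>"
      using bound[of n] by (simp add: order.strict_trans1[OF _ ennreal_less_top])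
    then show "integrable lborel (\<lambda>t. (cmod (g t - f n t))\<^sup>2)"
      by (intro integrableI_bounded) auto
  qed measurable
  have sq_g: "square_integrable g"
    using square_integrable_add[OF sq_diff[of 0] rep_L2_square_integrable[of "X 0"]] by (simp add: f_def)
  have "norm (abs_L2 g - X n) \<le> (1/2)^n" for n
  proof -
    have "AE t in lborel. rep_L2 (abs_L2 g - X n) t = g t - f n t"
      using rep_L2_plus_AE[of "abs_L2 g - X n" "X n"] rep_abs_L2_AE[OF sq_g]
      by eventually_elim (simp add: f_def)
    then have "ennreal ((norm (abs_L2 g - X n))\<^sup>2) = (\<integral>\<^sup>+t. ennreal ((cmod (g t - f n t))\<^sup>2) \<partial>lborel)"
      unfolding norm_L2_sq_rep
      by (subst nn_integral_eq_integral[symmetric, OF rep_L2_integrable_norm_sq])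
         (auto intro!: nn_integral_cong_AE elim: AE_mp)
    also note bound[of n]
    finally have "(norm (abs_L2 g - X n))\<^sup>2 \<le> ((1/2)^n)\<^sup>2" by simp
    then show ?thesis by (rule power2_le_imp_le) simp
  qed
  then have "(\<lambda>n. norm (X n - abs_L2 g)) \<longlonglongrightarrow> 0"
    by (intro tendsto_sandwich[OF _ _ tendsto_const LIMSEQ_power_zero[of "1/2::real"]])
       (auto simp: norm_minus_commute)
  then have "X \<longlonglongrightarrow> abs_L2 g"
    using LIM_zero_cancel tendsto_norm_zero_iff by blast
  then show ?thesis by (auto simp: convergent_def)
qed

instance L2 :: (euclidean_space) complete_space
proof
  fix X :: "nat \<Rightarrow> 'a L2"
  assume X: "Cauchy X"
  have "\<exists>N. \<forall>m\<ge>N. \<forall>n\<ge>N. norm (X m - X n) < (1/2)^k" for k :: nat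
    using X unfolding Cauchy_iff by simp
  then obtain N where N: "\<And>k m n. m \<ge> N k \<Longrightarrow> n \<ge> N k \<Longrightarrow> norm (X m - X n) < (1/2)^k"
    by metis
  \<comment> \<open>The summand \<open>k\<close> makes \<open>r\<close> strictly increasing, the sum
    puts \<open>r k\<close> above the threshold \<open>N k\<close>.\<close>
  define r where "r k = k + (\<Sum>i\<le>k. N i)" for k
  have r_mono: "strict_mono r"
    by (rule strict_monoI_Suc) (simp add: r_def)
  have rN: "r k \<ge> N k" for k
    using member_le_sum[of k "{..k}" N] by (simp add: r_def)
  have "convergent (X \<circ> r)"
  proof (rule L2_Cauchy_fast_convergent)
    fix n m :: nat assume "n \<le> m"
    then have "r m \<ge> N n" using rN[of n] strict_mono_less_eq[OF r_mono, of n m] by simp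
    then show "norm ((X \<circ> r) m - (X \<circ> r) n) \<le> (1/2)^n"
      using N[of n "r m" "r n"] rN[of n] by simp
  qed
  then obtain L where "(X \<circ> r) \<longlonglongrightarrow> L" by (auto simp: convergent_def)
  then have "X \<longlonglongrightarrow> L"
    using Cauchy_converges_subseq[OF X r_mono] by blast
  then show "convergent X" by (auto simp: convergent_def)
qed

text \<open>The witness is \<open>x\<close> minus its nearest point in \<open>S\<close>. A
  minimizing sequence is Cauchy by the parallelogram law, because midpoints of elements of
  \<open>S\<close> stay in \<open>S\<close>.\<close>

lemma closed_subspace_orthogonal:
  fixes S :: "'a::{real_inner,complete_space} set"
  assumes "closed S" and S: "subspace S" and "x \<notin> S"
  obtains \<eta> where "\<eta> \<noteq> 0" "\<And>y. y \<in> S \<Longrightarrow> \<eta> \<bullet> y = 0"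
proof -
  define d where "d = (INF y\<in>S. norm (x - y))"
  have ne: "S \<noteq> {}" using subspace_0[OF S] by auto
  have bdd: "bdd_below ((\<lambda>y. norm (x - y)) ` S)" by (rule bdd_belowI[of _ 0]) auto
  have d: "d \<le> norm (x - y)" if "y \<in> S" for y
    unfolding d_def using that bdd by (intro cINF_lower) auto
  have d0: "0 \<le> d" unfolding d_def using ne by (intro cINF_greatest) auto
  \<comment> \<open>The tolerance is put on the squared distance, the quantity that occurs in the
    parallelogram law.\<close>
  have "\<exists>y\<in>S. norm (x - y) < sqrt (d\<^sup>2 + 1 / real (Suc n))" for n
  proof -
    have "d = sqrt (d\<^sup>2)" using d0 by simp
    also have "\<dots> < sqrt (d\<^sup>2 + 1 / real (Suc n))" by (intro real_sqrt_less_mono) simp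
    finally show ?thesis
      unfolding d_def by (rule cINF_less_iff[OF ne bdd, THEN iffD1])
  qed
  then obtain y where yS: "\<And>n. y n \<in> S" and y: "\<And>n. norm (x - y n) < sqrt (d\<^sup>2 + 1 / real (Suc n))"
    by metis
  have y2: "(norm (x - y n))\<^sup>2 \<le> d\<^sup>2 + 1 / real (Suc n)" for n
  proof -
    have "(norm (x - y n))\<^sup>2 \<le> (sqrt (d\<^sup>2 + 1 / real (Suc n)))\<^sup>2"
      by (rule power_mono) (use y[of n] in auto)
    also have "\<dots> = d\<^sup>2 + 1 / real (Suc n)"
      by (rule real_sqrt_pow2) (simp add: add_nonneg_nonneg)
    finally show ?thesis .
  qed
  have par: "(norm (a - b))\<^sup>2 \<le> 2 * (norm (x - a))\<^sup>2 + 2 * (norm (x - b))\<^sup>2 - 4 * d\<^sup>2"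
    if "a \<in> S" "b \<in> S" for a b
  proof -
    have "(1/2) *\<^sub>R (a + b) \<in> S" using that S by (simp add: subspace_add subspace_scale)
    from d[OF this] d0 have "d\<^sup>2 \<le> (norm (x - (1/2) *\<^sub>R (a + b)))\<^sup>2" by (intro power_mono) auto
    moreover have "(norm (a - b))\<^sup>2 = 2 * (norm (x - a))\<^sup>2 + 2 * (norm (x - b))\<^sup>2 - 4 * (norm (x - (1/2) *\<^sub>R (a + b)))\<^sup>2"
      unfolding power2_norm_eq_inner by (simp add: inner_simps inner_commute algebra_simps)
    ultimately show ?thesis by simp
  qed
  have "Cauchy y"
  proof (rule CauchyI)
    fix e :: real assume e: "e > 0"
    obtain N where N: "4 / e\<^sup>2 < real N" using reals_Archimedean2 by blast
    have "norm (y m - y n) < e" if "m \<ge> N" "n \<ge> N" for m n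
    proof -
      have N0: "0 < N" using N e by (cases N) (auto simp: field_simps zero_less_power not_less)
      have "(norm (y m - y n))\<^sup>2 \<le> 2 * (1 / real (Suc m)) + 2 * (1 / real (Suc n))"
        using par[OF yS[of m] yS[of n]] y2[of m] y2[of n] by linarith
      also have "\<dots> \<le> 2 / real N + 2 / real N"
        using that N0 by (intro add_mono) (auto intro!: divide_left_mono)
      also have "\<dots> < e\<^sup>2" using N N0 e by (simp add: field_simps)
      finally show ?thesis using e by (simp add: power_less_imp_less_base)
    qed
    then show "\<exists>M. \<forall>m\<ge>M. \<forall>n\<ge>M. norm (y m - y n) < e" by blast
  qed
  then obtain y0 where lim: "y \<longlonglongrightarrow> y0" by (auto simp: Cauchy_convergent_iff convergent_def)
  have y0S: "y0 \<in> S" using \<open>closed S\<close> yS lim by (auto simp: closed_sequential_limits)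
  have lim2: "(\<lambda>n. d\<^sup>2 + 1 / real (Suc n)) \<longlonglongrightarrow> d\<^sup>2 + 0"
    using LIMSEQ_inverse_real_of_nat by (intro tendsto_add tendsto_const) (simp add: inverse_eq_divide)
  have lim1: "(\<lambda>n. (norm (x - y n))\<^sup>2) \<longlonglongrightarrow> (norm (x - y0))\<^sup>2"
    by (intro tendsto_intros lim)
  have "(norm (x - y0))\<^sup>2 \<le> d\<^sup>2 + 0"
    by (rule LIMSEQ_le[OF lim1 lim2]) (use y2 in blast)
  then have min: "(norm (x - y0))\<^sup>2 \<le> (norm (x - z))\<^sup>2" if "z \<in> S" for z
    using power_mono[OF d[OF that] d0, of 2] by linarith
  have orth: "(x - y0) \<bullet> z = 0" if z: "z \<in> S" for z
  proof (cases "z = 0")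
    case False
    \<comment> \<open>The coefficient of the projection of \<open>x - y0\<close> onto
      \<open>z\<close>: moving from \<open>y0\<close> along \<open>z\<close> gains most here, and
      minimality of \<open>y0\<close> says that the gain is zero.\<close>
    define t where "t = ((x - y0) \<bullet> z) / (z \<bullet> z)"
    have zz: "z \<bullet> z > 0" using False by simp
    have "y0 + t *\<^sub>R z \<in> S" using y0S z S by (simp add: subspace_add subspace_scale)
    from min[OF this] have "(x - y0) \<bullet> (x - y0) \<le> ((x - y0) - t *\<^sub>R z) \<bullet> ((x - y0) - t *\<^sub>R z)"
      by (simp add: power2_norm_eq_inner algebra_simps)
    also have "\<dots> = (x - y0) \<bullet> (x - y0) - 2 * t * ((x - y0) \<bullet> z) + t * t * (z \<bullet> z)"
      by (simp add: inner_diff_left inner_diff_right inner_commute algebra_simps)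
    also have "\<dots> = (x - y0) \<bullet> (x - y0) - ((x - y0) \<bullet> z)\<^sup>2 / (z \<bullet> z)"
      using zz by (simp add: t_def field_simps power2_eq_square)
    finally have "((x - y0) \<bullet> z)\<^sup>2 / (z \<bullet> z) \<le> 0" by simp
    then show ?thesis using zz by (simp add: divide_le_0_iff)
  qed simp
  show ?thesis
    by (rule that[of "x - y0"]) (use orth y0S \<open>x \<notin> S\<close> in auto)
qed

text \<open>The kernel of a nonzero functional is closed of codimension one, so a vector orthogonal
  to it represents the functional after rescaling.\<close>

lemma Riesz_representation_real:
  fixes r :: "'a::{real_inner,complete_space} \<Rightarrow> real"
  assumes "bounded_linear r"
  obtains \<eta> where "\<And>x. r x = \<eta> \<bullet> x"
proof (cases "\<forall>x. r x = 0")
  case True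
  then show ?thesis using that[of 0] by simp
next
  case False
  interpret r: bounded_linear r by fact
  let ?S = "r -` {0}"
  have "closed ?S"
    by (intro closed_vimage closed_singleton) (simp_all add: r.continuous_on continuous_on_id)
  moreover have "subspace ?S"
    by (auto simp: subspace_def r.add r.scaleR r.zero)
  moreover obtain x where "x \<notin> ?S" using False by auto
  ultimately obtain \<eta> where \<eta>: "\<eta> \<noteq> 0" "\<And>y. y \<in> ?S \<Longrightarrow> \<eta> \<bullet> y = 0"
    using closed_subspace_orthogonal by blast
  have r\<eta>: "r \<eta> \<noteq> 0" using \<eta>(1) \<eta>(2)[of \<eta>] by auto
  show ?thesis
  proof (rule that)
    fix x
    have "\<eta> \<bullet> (x - (r x / r \<eta>) *\<^sub>R \<eta>) = 0"
      by (rule \<eta>(2)) (simp add: r.diff r.scaleR r\<eta>)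
    then have "\<eta> \<bullet> x = (r x / r \<eta>) * (\<eta> \<bullet> \<eta>)" by (simp add: inner_diff_right)
    then show "r x = ((r \<eta> / (\<eta> \<bullet> \<eta>)) *\<^sub>R \<eta>) \<bullet> x"
      using r\<eta> \<eta>(1) by (simp add: field_simps)
  qed
qed

section \<open>Integration on Euclidean spaces\<close>

lemma lborel_integral_shift:
  fixes f :: "'a::euclidean_space \<Rightarrow> 'b::{banach, second_countable_topology}"
  assumes [measurable]: "f \<in> borel_measurable borel"
  shows "(LINT t|lborel. f (t + a)) = (LINT t|lborel. f t)"
    and "integrable lborel (\<lambda>t. f (t + a)) = integrable lborel f"
  using integral_distr[of "\<lambda>t. a + t" lborel borel f] integrable_distr_eq[of "\<lambda>t. a + t" lborel borel f]
  by (simp_all add: lborel_distr_plus add.commute[of _ a])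

lemma lborel_nn_integral_shift:
  fixes f :: "'a::euclidean_space \<Rightarrow> ennreal"
  assumes [measurable]: "f \<in> borel_measurable borel"
  shows "(\<integral>\<^sup>+t. f (t + a) \<partial>lborel) = (\<integral>\<^sup>+t. f t \<partial>lborel)"
  using nn_integral_distr[of "\<lambda>t. a + t" lborel borel f]
  by (simp add: lborel_distr_plus add.commute[of _ a])

text \<open>The predicate may fail to be measurable, hence the detour: its exceptional set is
  enclosed in a Borel null set, and translation invariance is applied to that set.\<close>

lemma AE_lborel_shift:
  fixes P :: "'a::euclidean_space \<Rightarrow> bool"
  assumes "AE t in lborel. P t"
  shows "AE t in lborel. P (t - x)"
proof -
  obtain N where N: "N \<in> null_sets lborel" "{t \<in> space lborel. \<not> P t} \<subseteq> N"
    using AE_E3[OF assms] by (metis (no_types, lifting) Diff_iff mem_Collect_eq subsetI)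
  have [measurable]: "N \<in> sets borel" using N(1) by (simp add: null_sets_def)
  have "(\<lambda>t. t - x) = (+) (- x)" by auto
  then have "distr lborel borel (\<lambda>t. t - x) = lborel"
    using lborel_distr_plus[of "- x"] by simp
  then have "AE t in distr lborel borel (\<lambda>t. t - x). t \<notin> N" using AE_not_in[OF N(1)] by (simp only:)
  then have "AE t in lborel. t - x \<notin> N" by (subst (asm) AE_distr_iff) simp_all
  then show ?thesis by eventually_elim (use N(2) in auto)
qed

lemma lborel_distr_reflect: "distr lborel borel (\<lambda>t::'a::euclidean_space. a - t) = lborel"
  using lborel_affine[of "-1" a] by (simp add: density_1)

lemma lborel_integral_reflect:
  fixes f :: "'a::euclidean_space \<Rightarrow> 'b::{banach, second_countable_topology}"
  assumes [measurable]: "f \<in> borel_measurable borel"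
  shows "(LINT t|lborel. f (a - t)) = (LINT t|lborel. f t)"
    and "integrable lborel (\<lambda>t. f (a - t)) = integrable lborel f"
  using integral_distr[of "\<lambda>t. a - t" lborel borel f] integrable_distr_eq[of "\<lambda>t. a - t" lborel borel f]
  by (simp_all add: lborel_distr_reflect)

lemma lborel_nn_integral_reflect:
  fixes f :: "'a::euclidean_space \<Rightarrow> ennreal"
  assumes [measurable]: "f \<in> borel_measurable borel"
  shows "(\<integral>\<^sup>+t. f (a - t) \<partial>lborel) = (\<integral>\<^sup>+t. f t \<partial>lborel)"
  using nn_integral_distr[of "\<lambda>t. a - t" lborel borel f]
  by (simp add: lborel_distr_reflect)

lemma integral_dominated:
  fixes f :: "'a \<Rightarrow> 'b::{banach, second_countable_topology}" and g :: "'a \<Rightarrow> real"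
  assumes g: "integrable M g" and f: "f \<in> borel_measurable M" and le: "\<And>x. norm (f x) \<le> g x"
  shows "integrable M f" and "norm (LINT x|M. f x) \<le> (LINT x|M. g x)"
proof -
  show I: "integrable M f"
    by (rule Bochner_Integration.integrable_bound[OF g f]) (intro AE_I2 order_trans[OF le], simp)
  show "norm (LINT x|M. f x) \<le> (LINT x|M. g x)"
    by (rule order_trans[OF integral_norm_bound integral_mono[OF integrable_norm[OF I] g le]])
qed

section \<open>Time-frequency shifts\<close>

abbreviation phase :: "real \<Rightarrow> complex" where
  "phase r \<equiv> exp (2 * of_real pi * \<i> * of_real r)"

lemma norm_phase [simp]: "cmod (phase r) = 1"
  by (simp add: norm_exp_eq_Re)

lemma cnj_phase: "cnj (phase r) = phase (- r)"
  by (simp add: exp_cnj)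

lemma phase_mult_cnj [simp]: "phase r * cnj (phase r) = 1"
  using complex_norm_square[of "phase r"] by (simp only: norm_phase) simp

lemma phase_add: "phase (r + s) = phase r * phase s"
  by (simp add: ring_distribs exp_add)

lemma phase_inner_diff: "phase (\<omega> \<bullet> (t - s)) = phase (- (\<omega> \<bullet> s)) * phase (\<omega> \<bullet> t)"
  unfolding phase_add[symmetric] by (simp add: inner_diff_right)

lemma rep_tf_shift_AE:
  "AE t in lborel. rep_L2 (tf_shift (x, \<omega>) u) t = phase (\<omega> \<bullet> t) * rep_L2 u (t - x)"
proof -
  have "square_integrable (\<lambda>t. phase (\<omega> \<bullet> t) * rep_L2 u (t - x))"
  proof -
    have "(\<lambda>t. phase (\<omega> \<bullet> t) * rep_L2 u (t - x)) \<in> borel_measurable borel" by measurable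
    moreover have "integrable lborel (\<lambda>t. (cmod (rep_L2 u (t - x)))\<^sup>2)"
      using lborel_integral_shift(2)[of "\<lambda>t. (cmod (rep_L2 u t))\<^sup>2" "- x"] rep_L2_integrable_norm_sq[of u]
      by simp
    ultimately show ?thesis by (simp add: square_integrable_def norm_mult)
  qed
  from rep_abs_L2_AE[OF this] show ?thesis by (simp add: tf_shift_def)
qed

lemma cinner_tf_shift [simp]: "cinner_L2 (tf_shift z u) (tf_shift z v) = cinner_L2 u v"
proof (cases z)
  case (Pair x \<omega>)
  have "cinner_L2 (tf_shift (x, \<omega>) u) (tf_shift (x, \<omega>) v)
      = (LINT t|lborel. rep_L2 u (t - x) * cnj (rep_L2 v (t - x)))"
    unfolding cinner_L2_rep
  proof (rule integral_cong_AE)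
    show "AE t in lborel. rep_L2 (tf_shift (x, \<omega>) u) t * cnj (rep_L2 (tf_shift (x, \<omega>) v) t) =
      rep_L2 u (t - x) * cnj (rep_L2 v (t - x))"
      using rep_tf_shift_AE[of x \<omega> u] rep_tf_shift_AE[of x \<omega> v]
    proof eventually_elim
      case (elim t)
      have "phase (\<omega> \<bullet> t) * cnj (phase (\<omega> \<bullet> t)) * (rep_L2 u (t - x) * cnj (rep_L2 v (t - x))) =
        rep_L2 u (t - x) * cnj (rep_L2 v (t - x))" by (simp only: phase_mult_cnj mult_1)
      then show ?case unfolding elim complex_cnj_mult by (simp only: mult_ac)
    qed
  qed measurable
  also have "\<dots> = cinner_L2 u v"
    using lborel_integral_shift(1)[of "\<lambda>t. rep_L2 u t * cnj (rep_L2 v t)" "- x"] by (simp add: cinner_L2_rep)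
  finally show ?thesis using Pair by simp
qed

lemma norm_tf_shift [simp]: "norm (tf_shift z u) = norm u"
  using cinner_tf_shift[of z u u] unfolding cinner_L2_self_norm of_real_eq_iff
  by (simp add: power2_eq_iff_nonneg)

lemma tf_shift_add: "tf_shift z (u + v) = tf_shift z u + tf_shift z v"
proof (cases z)
  case (Pair x \<omega>)
  have "AE t in lborel. rep_L2 (u + v) (t - x) = rep_L2 u (t - x) + rep_L2 v (t - x)"
    by (rule AE_lborel_shift[OF rep_L2_plus_AE])
  then have "AE t in lborel. rep_L2 (tf_shift (x, \<omega>) (u + v)) t
    = rep_L2 (tf_shift (x, \<omega>) u) t + rep_L2 (tf_shift (x, \<omega>) v) t"
    using rep_tf_shift_AE[of x \<omega> u] rep_tf_shift_AE[of x \<omega> v] rep_tf_shift_AE[of x \<omega> "u + v"]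
    by eventually_elim (simp add: ring_distribs)
  then have "tf_shift (x, \<omega>) (u + v) = abs_L2 (\<lambda>t. rep_L2 (tf_shift (x, \<omega>) u) t + rep_L2 (tf_shift (x, \<omega>) v) t)"
    by (intro abs_L2_eqI square_integrable_add) simp_all
  also have "\<dots> = tf_shift (x, \<omega>) u + tf_shift (x, \<omega>) v"
    by (simp add: plus_L2_def)
  finally show ?thesis using Pair by simp
qed

text \<open>A consequence of isometry: in the expanded squared norm of the difference all inner
  products of shifted vectors reduce to unshifted ones and cancel.\<close>

lemma tf_shift_scaleC: "tf_shift z (scaleC_L2 c u) = scaleC_L2 c (tf_shift z u)"
proof -
  have "cinner_L2 (tf_shift z (scaleC_L2 c u) - scaleC_L2 c (tf_shift z u)) (tf_shift z (scaleC_L2 c u) - scaleC_L2 c (tf_shift z u)) = 0"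
    unfolding cinner_L2.diff_left cinner_L2.diff_right cinner_L2_scaleC_left cinner_L2_scaleC_right cinner_tf_shift
    by simp
  then have "norm (tf_shift z (scaleC_L2 c u) - scaleC_L2 c (tf_shift z u)) = 0"
    unfolding cinner_L2_self_norm by simp
  then show ?thesis by simp
qed

lemma tf_shift_diff: "tf_shift z (u - v) = tf_shift z u - tf_shift z v"
  using tf_shift_add[of z "u - v" v] by simp

text \<open>Moving the modulation by \<eta> past the translation by \<open>x\<close> costs the
  phase; the shifts form only a projective representation of phase space.\<close>

lemma tf_shift_tf_shift:
  "tf_shift (x, \<omega>) (tf_shift (y, \<eta>) u) = scaleC_L2 (phase (- (\<eta> \<bullet> x))) (tf_shift (x + y, \<omega> + \<eta>) u)"
proof -
  have "AE t in lborel. rep_L2 (tf_shift (y, \<eta>) u) (t - x) = phase (\<eta> \<bullet> (t - x)) * rep_L2 u ((t - x) - y)"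
    by (rule AE_lborel_shift[OF rep_tf_shift_AE])
  then have "AE t in lborel. rep_L2 (tf_shift (x, \<omega>) (tf_shift (y, \<eta>) u)) t
    = phase (- (\<eta> \<bullet> x)) * rep_L2 (tf_shift (x + y, \<omega> + \<eta>) u) t"
    using rep_tf_shift_AE[of x \<omega> "tf_shift (y, \<eta>) u"] rep_tf_shift_AE[of "x + y" "\<omega> + \<eta>" u]
  proof eventually_elim
    case (elim t)
    have "phase (\<omega> \<bullet> t) * phase (\<eta> \<bullet> (t - x)) = phase (- (\<eta> \<bullet> x)) * phase ((\<omega> + \<eta>) \<bullet> t)"
      unfolding exp_add[symmetric] by (rule arg_cong[where f=exp]) (simp add: inner_simps algebra_simps)
    then show ?case unfolding elim by (simp add: diff_diff_eq)
  qed
  then have "tf_shift (x, \<omega>) (tf_shift (y, \<eta>) u) = abs_L2 (\<lambda>t. phase (- (\<eta> \<bullet> x)) * rep_L2 (tf_shift (x + y, \<omega> + \<eta>) u) t)"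
    by (intro abs_L2_eqI square_integrable_scale) simp_all
  then show ?thesis by (simp add: scaleC_L2_def)
qed

text \<open>The phase will always meet its own conjugate, so recording its modulus is enough. It
  depends on \<open>z\<close> and \<open>w\<close> but not on \<open>u\<close>, which is what makes
  it cancel.\<close>

lemma tf_shift_plus_phase:
  obtains c where "cmod c = 1" "\<And>u. tf_shift (z + w) u = scaleC_L2 c (tf_shift z (tf_shift w u))"
proof
  show "cmod (phase (snd w \<bullet> fst z)) = 1" by simp
  show "tf_shift (z + w) u = scaleC_L2 (phase (snd w \<bullet> fst z)) (tf_shift z (tf_shift w u))" for u
    using tf_shift_tf_shift[of "fst z" "snd z" "fst w" "snd w" u]
    by (simp add: scaleC_L2_scaleC_L2 flip: exp_add plus_prod_def)
qed

lemma tf_shift_zero [simp]: "tf_shift 0 u = u"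
proof -
  have "u = abs_L2 (rep_L2 (tf_shift 0 u))"
  proof (rule abs_L2_eqI)
    show "AE t in lborel. rep_L2 u t = rep_L2 (tf_shift 0 u) t"
      using rep_tf_shift_AE[of 0 0 u] by eventually_elim (simp flip: zero_prod_def)
  qed simp
  then show ?thesis by simp
qed

section \<open>Gaussian integrals\<close>

text \<open>A rescaled characteristic function of the standard normal distribution: with
  \<open>c\<^sup>2 = 2 * a\<close> the density at \<open>c * x\<close> is a multiple of
  \<open>exp (- a * x\<^sup>2)\<close>.\<close>

lemma gaussian_fourier_real:
  fixes a q :: real
  assumes a: "a > 0"
  shows "integrable lborel (\<lambda>x::real. exp (- a * x\<^sup>2))"
    and "(LINT x|lborel. of_real (exp (- a * x\<^sup>2)) * exp (\<i> * of_real (q * x)))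
      = complex_of_real (sqrt (pi / a) * exp (- q\<^sup>2 / (4 * a)))"
proof -
  define c where "c = sqrt (2 * a)"
  have c: "c > 0" "c\<^sup>2 = 2 * a" using a by (simp_all add: c_def)
  have dens: "std_normal_density (0 + c * x) = 1 / sqrt (2 * pi) * exp (- a * x\<^sup>2)" for x
    by (simp add: std_normal_density_def power_mult_distrib c)
  have "integrable lborel (\<lambda>x. std_normal_density (0 + c * x))"
    using c by (intro lborel_integrable_real_affine integrable_normal_density) auto
  then show "integrable lborel (\<lambda>x::real. exp (- a * x\<^sup>2))"
    unfolding dens using integrable_mult_right[of "sqrt (2 * pi)" lborel "\<lambda>x. 1 / sqrt (2 * pi) * exp (- a * x\<^sup>2)"] by simp
  have "(LINT x|std_normal_distribution. iexp (q / c * x)) = exp (- ((q / c)\<^sup>2) / 2)"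
    using fun_cong[OF char_std_normal_distribution, of "q / c"] by (simp add: char_def)
  then have "(LINT x|lborel. std_normal_density x *\<^sub>R iexp (q / c * x)) = exp (- ((q / c)\<^sup>2) / 2)"
    by (subst (asm) integral_density) (auto simp: normal_density_nonneg)
  then have "\<bar>c\<bar> *\<^sub>R (LINT x|lborel. std_normal_density (0 + c * x) *\<^sub>R iexp (q / c * (0 + c * x))) = exp (- ((q / c)\<^sup>2) / 2)"
    using c by (subst (asm) lborel_integral_real_affine[of c _ 0]) auto
  moreover have "std_normal_density (0 + c * x) *\<^sub>R iexp (q / c * (0 + c * x))
     = of_real (1 / sqrt (2 * pi)) * (of_real (exp (- a * x\<^sup>2)) * exp (\<i> * of_real (q * x)))" for x
    unfolding dens using c by (simp add: scaleR_conv_of_real)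
  ultimately have "of_real (c / sqrt (2 * pi)) * (LINT x|lborel. of_real (exp (- a * x\<^sup>2)) * exp (\<i> * of_real (q * x)))
      = complex_of_real (exp (- ((q / c)\<^sup>2) / 2))"
    using c by (simp add: scaleR_conv_of_real exp_of_real)
  then have "of_real (sqrt (pi / a)) * (of_real (c / sqrt (2 * pi)) * (LINT x|lborel. of_real (exp (- a * x\<^sup>2)) * exp (\<i> * of_real (q * x))))
      = complex_of_real (sqrt (pi / a)) * complex_of_real (exp (- ((q / c)\<^sup>2) / 2))"
    by (rule arg_cong)
  moreover have "sqrt (pi / a) * (c / sqrt (2 * pi)) = 1"
  proof -
    have "c * sqrt (pi / a) = sqrt (2 * pi)"
      unfolding c_def real_sqrt_mult[symmetric] using a by simp
    then show ?thesis by (simp add: mult.commute)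
  qed
  moreover have "- ((q / c)\<^sup>2) / 2 = - q\<^sup>2 / (4 * a)"
    using c by (simp add: power_divide)
  ultimately show "(LINT x|lborel. of_real (exp (- a * x\<^sup>2)) * exp (\<i> * of_real (q * x)))
      = complex_of_real (sqrt (pi / a) * exp (- q\<^sup>2 / (4 * a)))"
    by (simp only: mult.assoc[symmetric] of_real_mult[symmetric] of_real_1 mult_1)
qed

lemma gaussian_fourier:
  fixes q :: "'a::euclidean_space" and a :: real
  assumes a: "a > 0"
  shows "integrable lborel (\<lambda>x::'a. exp (- a * (norm x)\<^sup>2))" (is ?I)
    and "(LINT x|lborel. of_real (exp (- a * (norm x)\<^sup>2)) * exp (\<i> * of_real (q \<bullet> x)))
      = complex_of_real (sqrt (pi / a) ^ DIM('a) * exp (- (norm q)\<^sup>2 / (4 * a)))" (is ?E)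
proof -
  interpret product_sigma_finite "\<lambda>_::'a. lborel :: real measure" ..
  define g where "g b x = complex_of_real (exp (- a * x\<^sup>2)) * exp (\<i> * of_real ((q \<bullet> b) * x))" for b x
  have int_g: "integrable lborel (g b)" for b
  proof (rule Bochner_Integration.integrable_bound[OF gaussian_fourier_real(1)[OF a]])
    show "g b \<in> borel_measurable lborel" unfolding g_def by measurable
    show "AE x in lborel. norm (g b x) \<le> norm (exp (- a * x\<^sup>2))" by (simp add: g_def norm_mult)
  qed
  have nrm: "(norm (\<Sum>b\<in>Basis. x b *\<^sub>R b :: 'a))\<^sup>2 = (\<Sum>b\<in>(Basis::'a set). (x b)\<^sup>2)" for x :: "'a \<Rightarrow> real"
    unfolding power2_norm_eq_inner by (subst euclidean_inner) (simp add: power2_eq_square)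
  have prod: "of_real (exp (- a * (norm (\<Sum>b\<in>Basis. x b *\<^sub>R b :: 'a))\<^sup>2)) * exp (\<i> * of_real (q \<bullet> (\<Sum>b\<in>Basis. x b *\<^sub>R b :: 'a)))
      = (\<Prod>b\<in>Basis. g b (x b))" for x :: "'a \<Rightarrow> real"
  proof -
    have "(\<Prod>b\<in>Basis. g b (x b)) = (\<Prod>b\<in>Basis. complex_of_real (exp (- a * (x b)\<^sup>2))) * (\<Prod>b\<in>Basis. exp (\<i> * of_real ((q \<bullet> b) * x b)))"
      by (simp add: g_def prod.distrib)
    also have "(\<Prod>b\<in>Basis. exp (\<i> * of_real ((q \<bullet> b) * x b))) = exp (\<i> * of_real (q \<bullet> (\<Sum>b\<in>Basis. x b *\<^sub>R b :: 'a)))"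
      by (simp add: exp_sum[symmetric] inner_sum_right sum_distrib_left mult.commute)
    also have "(\<Prod>b\<in>Basis. complex_of_real (exp (- a * (x b)\<^sup>2))) = of_real (exp (- a * (norm (\<Sum>b\<in>Basis. x b *\<^sub>R b :: 'a))\<^sup>2))"
      unfolding nrm of_real_prod[symmetric] by (simp add: exp_sum[symmetric] sum_distrib_left sum_negf)
    finally show ?thesis by simp
  qed
  have meas: "(\<lambda>x::'a. complex_of_real (exp (- a * (norm x)\<^sup>2)) * exp (\<i> * of_real (q \<bullet> x))) \<in> borel_measurable borel"
    by measurable
  have "integrable (\<Pi>\<^sub>M b\<in>Basis::'a set. lborel) (\<lambda>x. \<Prod>b\<in>Basis. g b (x b))"
    by (intro product_integrable_prod int_g) auto
  then have "integrable lborel (\<lambda>x::'a. complex_of_real (exp (- a * (norm x)\<^sup>2)) * exp (\<i> * of_real (q \<bullet> x)))"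
    unfolding prod[symmetric] using meas by (subst lborel_eq) (subst integrable_distr_eq, auto)
  then have "integrable lborel (\<lambda>x::'a. norm (complex_of_real (exp (- a * (norm x)\<^sup>2)) * exp (\<i> * of_real (q \<bullet> x))))"
    by (rule integrable_norm)
  then show ?I by (simp add: norm_mult)
  have "(LINT x|lborel. complex_of_real (exp (- a * (norm x)\<^sup>2)) * exp (\<i> * of_real (q \<bullet> x)))
     = (LINT x|(\<Pi>\<^sub>M b\<in>Basis::'a set. lborel). (\<Prod>b\<in>Basis. g b (x b)))"
    unfolding prod[symmetric] using meas by (subst lborel_eq) (subst integral_distr, auto)
  also have "\<dots> = (\<Prod>b\<in>Basis. (LINT x|lborel. g b x))"
    by (intro product_integral_prod int_g) auto
  also have "\<dots> = (\<Prod>b\<in>(Basis::'a set). complex_of_real (sqrt (pi / a) * exp (- (q \<bullet> b)\<^sup>2 / (4 * a))))"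
    unfolding g_def gaussian_fourier_real(2)[OF a] ..
  also have "\<dots> = of_real ((\<Prod>b\<in>(Basis::'a set). sqrt (pi / a)) * (\<Prod>b\<in>(Basis::'a set). exp (- (q \<bullet> b)\<^sup>2 / (4 * a))))"
    by (simp only: of_real_prod[symmetric] prod.distrib)
  also have "(\<Prod>b\<in>(Basis::'a set). exp (- (q \<bullet> b)\<^sup>2 / (4 * a))) = exp (- (norm q)\<^sup>2 / (4 * a))"
    unfolding power2_norm_eq_inner by (subst euclidean_inner)
      (simp add: exp_sum[symmetric] sum_negf sum_divide_distrib power2_eq_square)
  also have "(\<Prod>b\<in>(Basis::'a set). sqrt (pi / a)) = sqrt (pi / a) ^ DIM('a)"
    by simp
  finally show ?E .
qed

lemma gaussian_integral:
  assumes "a > 0"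
  shows "(LINT x|lborel. exp (- a * (norm (x::'a::euclidean_space))\<^sup>2)) = sqrt (pi / a) ^ DIM('a)"
proof -
  have "complex_of_real (LINT x|lborel. exp (- a * (norm (x::'a))\<^sup>2)) = of_real (sqrt (pi / a) ^ DIM('a))"
    using gaussian_fourier(2)[OF assms, of "0::'a"] by simp
  then show ?thesis by (simp only: of_real_eq_iff)
qed

text \<open>Completing the square for the real linear term only: the shift by
  \<open>p / (2 * a)\<close> absorbs it and leaves a Fourier integral with frequency
  \<open>q\<close>.\<close>

lemma gaussian_integral_complex:
  fixes p q :: "'a::euclidean_space"
  assumes a: "a > 0"
  shows "(LINT x|lborel. exp (of_real (- a * (norm x)\<^sup>2 + p \<bullet> x) + \<i> * of_real (q \<bullet> x)))
    = of_real (sqrt (pi / a) ^ DIM('a)) * exp (of_real (((norm p)\<^sup>2 - (norm q)\<^sup>2) / (4 * a)) + \<i> * of_real ((p \<bullet> q) / (2 * a)))"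
proof -
  let ?f = "\<lambda>x. exp (of_real (- a * (norm x)\<^sup>2 + p \<bullet> x) + \<i> * of_real (q \<bullet> x))"
  have shift: "?f (x + (1 / (2 * a)) *\<^sub>R p) = exp (of_real ((norm p)\<^sup>2 / (4 * a)) + \<i> * of_real ((p \<bullet> q) / (2 * a)))
     * (of_real (exp (- a * (norm x)\<^sup>2)) * exp (\<i> * of_real (q \<bullet> x)))" for x
  proof -
    have "- a * (norm (x + (1 / (2 * a)) *\<^sub>R p))\<^sup>2 + p \<bullet> (x + (1 / (2 * a)) *\<^sub>R p) = (norm p)\<^sup>2 / (4 * a) - a * (norm x)\<^sup>2"
      using a unfolding power2_norm_eq_inner
      by (simp add: inner_simps inner_commute[of x p] field_simps)
    moreover have "q \<bullet> (x + (1 / (2 * a)) *\<^sub>R p) = (p \<bullet> q) / (2 * a) + q \<bullet> x"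
      by (simp add: inner_simps inner_commute)
    ultimately have "?f (x + (1 / (2 * a)) *\<^sub>R p) =
      exp (of_real ((norm p)\<^sup>2 / (4 * a) - a * (norm x)\<^sup>2) + \<i> * of_real ((p \<bullet> q) / (2 * a) + q \<bullet> x))"
      by (simp only:)
    then show ?thesis
      unfolding exp_of_real[symmetric] exp_add[symmetric]
      by (elim trans) (rule arg_cong[where f=exp], simp add: ring_distribs)
  qed
  have "(LINT x|lborel. ?f x) = (LINT x|lborel. ?f (x + (1 / (2 * a)) *\<^sub>R p))"
    by (rule lborel_integral_shift(1)[symmetric]) measurable
  also have "\<dots> = exp (of_real ((norm p)\<^sup>2 / (4 * a)) + \<i> * of_real ((p \<bullet> q) / (2 * a)))
     * of_real (sqrt (pi / a) ^ DIM('a) * exp (- (norm q)\<^sup>2 / (4 * a)))"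
    unfolding shift integral_mult_right_zero gaussian_fourier(2)[OF a] ..
  also have "\<dots> = of_real (sqrt (pi / a) ^ DIM('a)) * exp (of_real (((norm p)\<^sup>2 - (norm q)\<^sup>2) / (4 * a)) + \<i> * of_real ((p \<bullet> q) / (2 * a)))"
    unfolding exp_of_real[symmetric] exp_add[symmetric] of_real_mult
    unfolding mult.commute[of "exp _" "_ * _"] mult.assoc exp_add[symmetric]
    by (rule arg_cong2[where f="(*)", OF refl], rule arg_cong[where f=exp]) (simp add: diff_divide_distrib)
  finally show ?thesis .
qed

text \<open>The shape to which all integrals over coherent states reduce. The quadratic coefficient
  \<open>2 * pi\<close> is the one of a product of two Gaussians
  \<open>exp (- pi * (norm x)\<^sup>2)\<close>, or of four with half that exponent.\<close>

definition gaussian_wave :: "'a::euclidean_space \<Rightarrow> 'a \<Rightarrow> 'a \<Rightarrow> complex" where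
  "gaussian_wave p q x = exp (of_real (- (2 * pi) * (norm x)\<^sup>2 + (pi *\<^sub>R p) \<bullet> x) + \<i> * of_real ((pi *\<^sub>R q) \<bullet> x))"

lemma gaussian_wave_measurable [measurable]: "gaussian_wave p q \<in> borel_measurable borel"
  unfolding gaussian_wave_def[abs_def] by measurable

lemma gaussian_wave_integral:
  fixes p q :: "'a::euclidean_space"
  shows "(LINT x|lborel. gaussian_wave p q x)
    = of_real (sqrt (1 / 2) ^ DIM('a)) * exp (of_real (pi / 8 * (p \<bullet> p - q \<bullet> q)) + \<i> * of_real (pi / 4 * (p \<bullet> q)))"
proof -
  have "((norm (pi *\<^sub>R p))\<^sup>2 - (norm (pi *\<^sub>R q))\<^sup>2) / (4 * (2 * pi)) = pi / 8 * (p \<bullet> p - q \<bullet> q)"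
    by (simp add: power_mult_distrib power2_norm_eq_inner[symmetric] field_simps power2_eq_square)
  moreover have "((pi *\<^sub>R p) \<bullet> (pi *\<^sub>R q)) / (2 * (2 * pi)) = pi / 4 * (p \<bullet> q)" by simp
  moreover have "sqrt (pi / (2 * pi)) = sqrt (1 / 2)" by simp
  moreover have "0 < 2 * pi" by simp
  ultimately show ?thesis
    using gaussian_integral_complex[of "2 * pi" "pi *\<^sub>R p" "pi *\<^sub>R q"] unfolding gaussian_wave_def by (simp only:)
qed

section \<open>Coherent states\<close>

abbreviation coherent :: "'a::euclidean_space \<times> 'a \<Rightarrow> 'a L2" where
  "coherent z \<equiv> tf_shift z gaussian"

lemma rep_gaussian_AE:
  "AE t in lborel. rep_L2 gaussian (t::'a::euclidean_space) = of_real (2 powr (DIM('a) / 4) * exp (- pi * (norm t)\<^sup>2))"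
  unfolding gaussian_def map_fun_def id_def by (rule rep_abs_L2_AE[OF square_integrable_gaussian])

lemma rep_coherent_AE:
  "AE t in lborel. rep_L2 (coherent (x, \<omega>)) (t::'a::euclidean_space)
     = phase (\<omega> \<bullet> t) * of_real (2 powr (DIM('a) / 4) * exp (- pi * (norm (t - x))\<^sup>2))"
proof -
  have "AE t in lborel. rep_L2 gaussian (t - x) = of_real (2 powr (DIM('a) / 4) * exp (- pi * (norm (t - x))\<^sup>2))"
    by (rule AE_lborel_shift[OF rep_gaussian_AE])
  with rep_tf_shift_AE[of x \<omega> gaussian] show ?thesis by eventually_elim simp
qed

lemma cinner_coherent:
  fixes x \<omega> y \<eta> :: "'a::euclidean_space"
  shows "cinner_L2 (coherent (x, \<omega>)) (coherent (y, \<eta>)) =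
    exp (of_real (- (pi / 2) * ((norm (x - y))\<^sup>2 + (norm (\<omega> - \<eta>))\<^sup>2)) + \<i> * of_real (pi * ((\<omega> - \<eta>) \<bullet> (x + y))))"
proof -
  let ?C = "2 powr (DIM('a) / 4) :: real" and ?e = "- pi * (x \<bullet> x + y \<bullet> y)"
  let ?p = "2 *\<^sub>R (x + y)" and ?q = "2 *\<^sub>R (\<omega> - \<eta>)"
  \<comment> \<open>The normalization of the two Gaussians is exactly undone by the prefactor of the
    integral.\<close>
  have CC: "?C * ?C * sqrt (1 / 2) ^ DIM('a) = 1"
  proof -
    have "?C * ?C = 2 powr (1 / 2 * DIM('a))" by (simp flip: powr_add)
    also have "\<dots> = (2 powr (1 / 2)) powr DIM('a)" by (simp only: powr_powr)
    also have "\<dots> = sqrt 2 ^ DIM('a)" by (simp add: powr_half_sqrt powr_realpow)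
    finally show ?thesis by (simp add: real_sqrt_divide field_simps)
  qed
  have "cinner_L2 (coherent (x, \<omega>)) (coherent (y, \<eta>)) = (LINT t|lborel. of_real (?C * ?C * exp ?e) * gaussian_wave ?p ?q t)"
    unfolding cinner_L2_rep
  proof (rule integral_cong_AE)
    show "AE t in lborel. rep_L2 (coherent (x, \<omega>)) t * cnj (rep_L2 (coherent (y, \<eta>)) t) = of_real (?C * ?C * exp ?e) * gaussian_wave ?p ?q t"
      using rep_coherent_AE[of x \<omega>] rep_coherent_AE[of y \<eta>]
    proof eventually_elim
      case (elim t)
      have r: "- pi * (norm (t - x))\<^sup>2 + - pi * (norm (t - y))\<^sup>2 = ?e + (- (2 * pi) * (norm t)\<^sup>2 + (pi *\<^sub>R ?p) \<bullet> t)"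
        unfolding power2_norm_eq_inner by (simp add: inner_commute algebra_simps)
      have "rep_L2 (coherent (x, \<omega>)) t * cnj (rep_L2 (coherent (y, \<eta>)) t)
         = of_real (?C * ?C) * (of_real (exp (- pi * (norm (t - x))\<^sup>2 + - pi * (norm (t - y))\<^sup>2)) * (phase (\<omega> \<bullet> t) * phase (- (\<eta> \<bullet> t))))"
        unfolding elim complex_cnj_mult cnj_phase exp_add by simp
      also have "phase (\<omega> \<bullet> t) * phase (- (\<eta> \<bullet> t)) = exp (\<i> * of_real ((pi *\<^sub>R ?q) \<bullet> t))"
        unfolding exp_add[symmetric] by (rule arg_cong[where f=exp]) (simp add: algebra_simps)
      finally show ?case
        unfolding gaussian_wave_def r exp_add of_real_mult[symmetric] mult.assoc[symmetric] exp_of_real .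
    qed
  qed measurable
  also have "\<dots> = of_real (?C * ?C * sqrt (1 / 2) ^ DIM('a)) *
     exp (of_real (?e + pi / 8 * (?p \<bullet> ?p - ?q \<bullet> ?q)) + \<i> * of_real (pi / 4 * (?p \<bullet> ?q)))"
  proof -
    have "of_real (a * exp e) * (of_real c * exp (of_real u + w)) = of_real (a * c) * exp (of_real (e + u) + w)"
      for a c e u :: real and w :: complex
      by (simp add: exp_add mult_ac flip: exp_of_real)
    then show ?thesis unfolding integral_mult_right_zero gaussian_wave_integral .
  qed
  also have "?e + pi / 8 * (?p \<bullet> ?p - ?q \<bullet> ?q) = - (pi / 2) * ((norm (x - y))\<^sup>2 + (norm (\<omega> - \<eta>))\<^sup>2)"
    unfolding power2_norm_eq_inner by (simp add: inner_commute algebra_simps)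
  also have "pi / 4 * (?p \<bullet> ?q) = pi * ((\<omega> - \<eta>) \<bullet> (x + y))"
    by (simp add: inner_commute)
  finally show ?thesis unfolding CC by simp
qed

lemma norm_gaussian [simp]: "norm gaussian = 1"
proof -
  have "complex_of_real ((norm (coherent (0::'a \<times> 'a)))\<^sup>2) = 1"
    unfolding cinner_L2_self_norm[symmetric] using cinner_coherent[of 0 0 0 "0::'a"] by (simp add: zero_prod_def)
  then have "(norm (gaussian :: 'a L2))\<^sup>2 = 1" by (simp only: of_real_eq_1_iff tf_shift_zero)
  then show ?thesis by (simp add: power2_eq_1_iff) (smt (verit) norm_ge_zero)
qed

lemma norm_cinner_coherent: "cmod (cinner_L2 (coherent z) (coherent w)) = exp (- (pi / 2) * (norm (z - w))\<^sup>2)"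
proof (cases z; cases w)
  fix x \<omega> y \<eta> :: 'a
  assume "z = (x, \<omega>)" "w = (y, \<eta>)"
  then show ?thesis
    by (simp only: cinner_coherent norm_exp_eq_Re) (simp add: norm_Pair)
qed

text \<open>Coherent states are unit vectors, so their squared distance is 2 minus twice the real
  part of their explicit inner product, which is continuous in the moving point.\<close>

lemma continuous_coherent: "continuous_on UNIV (coherent :: 'a::euclidean_space \<times> 'a \<Rightarrow> 'a L2)"
proof -
  have "isCont coherent z" for z :: "'a \<times> 'a"
  proof -
    obtain x \<omega> where z: "z = (x, \<omega>)" by (cases z)
    let ?h = "\<lambda>w :: 'a \<times> 'a. Re (exp (of_real (- (pi / 2) * ((norm (fst w - x))\<^sup>2 + (norm (snd w - \<omega>))\<^sup>2)) + \<i> * of_real (pi * ((snd w - \<omega>) \<bullet> (fst w + x)))))"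
    have "(norm (coherent w - coherent z))\<^sup>2 = 2 - 2 * ?h w" for w
    proof -
      have "(norm (coherent w - coherent z))\<^sup>2 = 2 - 2 * Re (cinner_L2 (coherent w) (coherent z))"
      proof -
        have "(norm (a - b))\<^sup>2 = (norm a)\<^sup>2 + (norm b)\<^sup>2 - 2 * (a \<bullet> b)" for a b :: "'a L2"
          by (simp add: power2_norm_eq_inner inner_simps inner_commute)
        then show ?thesis by (simp add: inner_L2_def)
      qed
      also have "cinner_L2 (coherent w) (coherent z) = exp (of_real (- (pi / 2) * ((norm (fst w - x))\<^sup>2 + (norm (snd w - \<omega>))\<^sup>2)) + \<i> * of_real (pi * ((snd w - \<omega>) \<bullet> (fst w + x))))"
        unfolding z by (cases w) (simp only: cinner_coherent fst_conv snd_conv)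
      finally show ?thesis .
    qed
    then have eq: "norm (coherent w - coherent z) = sqrt (2 - 2 * ?h w)" for w
      by (metis norm_ge_zero real_sqrt_unique)
    have "((\<lambda>w. sqrt (2 - 2 * ?h w)) \<longlongrightarrow> sqrt (2 - 2 * ?h z)) (at z)"
      by (intro tendsto_intros)
    moreover have "sqrt (2 - 2 * ?h z) = 0" by (simp add: z)
    ultimately have "((\<lambda>w. norm (coherent w - coherent z)) \<longlongrightarrow> 0) (at z)"
      by (simp only: eq)
    then show ?thesis unfolding isCont_def by (rule LIM_zero_cancel[OF tendsto_norm_zero_cancel])
  qed
  then show ?thesis by (simp add: continuous_on_eq_continuous_at)
qed

section \<open>Fourier uniqueness and density of the coherent states\<close>

text \<open>The majorant \<open>F x * G (y - T x)\<close> treats two situations at once: products of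
  integrable functions, with \<open>T\<close> zero, and convolution kernels, with \<open>T\<close>
  the identity.\<close>

lemma lborel_Fubini_dominated:
  fixes K :: "'a::euclidean_space \<Rightarrow> 'b::euclidean_space \<Rightarrow> complex"
    and F :: "'a \<Rightarrow> real" and G :: "'b \<Rightarrow> real" and T :: "'a \<Rightarrow> 'b"
  assumes K [measurable]: "(\<lambda>(x, y). K x y) \<in> borel_measurable (lborel \<Otimes>\<^sub>M lborel)"
    and T [measurable]: "T \<in> borel_measurable borel"
    and F: "integrable lborel F" and G: "integrable lborel G"
    and le: "\<And>x y. cmod (K x y) \<le> F x * G (y - T x)"
  shows "integrable (lborel \<Otimes>\<^sub>M lborel) (\<lambda>(x, y). K x y)" (is ?I)
    and "(LINT x|lborel. (LINT y|lborel. K x y)) = (LINT y|lborel. (LINT x|lborel. K x y))"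
proof -
  have [measurable]: "F \<in> borel_measurable borel" "G \<in> borel_measurable borel"
    using F G by auto
  have G_shift: "integrable lborel (\<lambda>y. G (y - T x))" "(LINT y|lborel. \<bar>G (y - T x)\<bar>) = (LINT y|lborel. \<bar>G y\<bar>)" for x
    using lborel_integral_shift(2)[of G "- T x"] lborel_integral_shift(1)[of "\<lambda>y. \<bar>G y\<bar>" "- T x"] G by simp_all
  have "integrable (lborel \<Otimes>\<^sub>M lborel) (\<lambda>p. F (fst p) * G (snd p - T (fst p)))"
  proof (rule lborel_pair.Fubini_integrable)
    show "integrable lborel (\<lambda>x. LINT y|lborel. norm (F (fst (x, y)) * G (snd (x, y) - T (fst (x, y)))))"
      using F by (simp add: abs_mult G_shift)
  qed (use G_shift in auto)
  then show I: ?I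
  proof (rule Bochner_Integration.integrable_bound)
    show "AE p in lborel \<Otimes>\<^sub>M lborel. norm (case p of (x, y) \<Rightarrow> K x y) \<le> norm (F (fst p) * G (snd p - T (fst p)))"
      using le by (intro AE_I2) (force simp: split_beta intro: order_trans[OF _ abs_ge_self])
  qed measurable
  show "(LINT x|lborel. (LINT y|lborel. K x y)) = (LINT y|lborel. (LINT x|lborel. K x y))"
    using lborel_pair.Fubini_integral[OF I] by simp
qed

lemma gaussian_phase_integral:
  fixes s :: "'a::euclidean_space"
  assumes b: "b > 0"
  shows "(LINT \<omega>|lborel. of_real (exp (- b * (norm \<omega>)\<^sup>2)) * phase (\<omega> \<bullet> s))
    = complex_of_real (sqrt (pi / b) ^ DIM('a) * exp (- (pi\<^sup>2 / b) * (norm s)\<^sup>2))"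
proof -
  have "\<i> * complex_of_real ((2 * pi) *\<^sub>R s \<bullet> \<omega>) = 2 * of_real pi * \<i> * of_real (\<omega> \<bullet> s)" for \<omega>
    by (simp add: inner_commute)
  moreover have "- (norm ((2 * pi) *\<^sub>R s))\<^sup>2 / (4 * b) = - (pi\<^sup>2 / b) * (norm s)\<^sup>2"
    by (simp add: power_mult_distrib)
  ultimately show ?thesis
    using gaussian_fourier(2)[OF b, of "(2 * pi) *\<^sub>R s"] by (simp only:)
qed

text \<open>A Gaussian centred at \<open>s\<close> is an absolutely convergent superposition of
  exponentials, and \<open>F\<close> integrates to zero against each of them.\<close>

lemma fourier_zero_gaussian_zero:
  fixes F :: "'a::euclidean_space \<Rightarrow> complex" and s :: 'a
  assumes F: "integrable lborel F"
    and zero: "\<And>\<omega>. (LINT t|lborel. F t * phase (\<omega> \<bullet> t)) = 0"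
    and a: "a > 0"
  shows "(LINT t|lborel. F t * of_real (exp (- a * (norm (s - t))\<^sup>2))) = 0"
proof -
  \<comment> \<open>The parameter whose Gaussian has a Fourier transform with parameter
    \<open>a\<close>.\<close>
  define b where "b = pi\<^sup>2 / a"
  have b: "b > 0" "pi\<^sup>2 / b = a" using a by (simp_all add: b_def)
  define C where "C = sqrt (pi / b) ^ DIM('a)"
  have C: "C \<noteq> 0" using b by (simp add: C_def)
  have [measurable]: "F \<in> borel_measurable borel" using F by auto
  let ?K = "\<lambda>t \<omega>. F t * (of_real (exp (- b * (norm \<omega>)\<^sup>2)) * phase (\<omega> \<bullet> (t - s)))"
  have "of_real C * (LINT t|lborel. F t * of_real (exp (- a * (norm (s - t))\<^sup>2)))
      = (LINT t|lborel. (LINT \<omega>|lborel. ?K t \<omega>))"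
    unfolding integral_mult_right_zero gaussian_phase_integral[OF b(1)] b(2) C_def[symmetric]
    by (subst integral_mult_right_zero[symmetric]) (simp add: norm_minus_commute mult_ac)
  also have "\<dots> = (LINT \<omega>|lborel. (LINT t|lborel. ?K t \<omega>))"
  proof (rule lborel_Fubini_dominated(2)[where T="\<lambda>_. 0" and F="\<lambda>t. cmod (F t)" and G="\<lambda>\<omega>. exp (- b * (norm \<omega>)\<^sup>2)"])
    show "integrable lborel (\<lambda>t. cmod (F t))" using F by simp
    show "integrable lborel (\<lambda>\<omega>::'a. exp (- b * (norm \<omega>)\<^sup>2))" by (rule gaussian_fourier(1)[OF b(1)])
  qed (simp_all add: norm_mult)
  also have "\<dots> = 0"
  proof -
    have "(LINT t|lborel. ?K t \<omega>) = 0" for \<omega>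
    proof -
    have "?K t \<omega> = (of_real (exp (- b * (norm \<omega>)\<^sup>2)) * phase (- (\<omega> \<bullet> s))) * (F t * phase (\<omega> \<bullet> t))" for t
      unfolding phase_inner_diff by (simp only: mult_ac)
    then show ?thesis
      by (simp only: integral_mult_right_zero zero mult_zero_right)
    qed
    then show ?thesis by simp
  qed
  finally show ?thesis using C by simp
qed

lemma lborel_integral_affine:
  fixes f :: "'a::euclidean_space \<Rightarrow> 'b::{banach, second_countable_topology}"
  assumes [measurable]: "f \<in> borel_measurable borel" and c: "c \<noteq> (0::real)"
  shows "(LINT s|lborel. f s) = \<bar>c\<bar> ^ DIM('a) *\<^sub>R (LINT y|lborel. f (t + c *\<^sub>R y))"
proof -
  have "(LINT s|lborel. f s) = (LINT s|density (distr lborel borel (\<lambda>x. t + c *\<^sub>R x)) (\<lambda>_. \<bar>c\<bar> ^ DIM('a)). f s)"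
    using lborel_affine[OF c, of t] by simp
  also have "\<dots> = (LINT s|distr lborel borel (\<lambda>x. t + c *\<^sub>R x). \<bar>c\<bar> ^ DIM('a) *\<^sub>R f s)"
    by (rule integral_density) auto
  also have "\<dots> = \<bar>c\<bar> ^ DIM('a) *\<^sub>R (LINT y|lborel. f (t + c *\<^sub>R y))"
    by (subst integral_distr) auto
  finally show ?thesis .
qed

lemma gaussian_dilation:
  fixes q :: "'a::euclidean_space \<Rightarrow> 'b::{banach, second_countable_topology}"
  assumes [measurable]: "q \<in> borel_measurable borel" and c: "c > 0"
  shows "(LINT w|lborel. exp (- (pi / c\<^sup>2) * (norm (w - t))\<^sup>2) *\<^sub>R q w)
    = c ^ DIM('a) *\<^sub>R (LINT y|lborel. exp (- pi * (norm y)\<^sup>2) *\<^sub>R q (t + c *\<^sub>R y))"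
  by (subst lborel_integral_affine[where c=c and t=t]) (use c in \<open>auto simp: power_mult_distrib\<close>)

text \<open>A bounded continuous \<open>g\<close> is the pointwise, uniformly bounded limit of its
  Gaussian averages, and Fubini moves the averaging kernel onto \<open>F\<close>.\<close>

lemma fourier_zero_bounded_continuous_zero:
  fixes F g :: "'a::euclidean_space \<Rightarrow> complex"
  assumes F: "integrable lborel F"
    and zero: "\<And>\<omega>. (LINT t|lborel. F t * phase (\<omega> \<bullet> t)) = 0"
    and g: "continuous_on UNIV g" and bd: "\<And>t. cmod (g t) \<le> B"
  shows "(LINT t|lborel. F t * g t) = 0"
proof -
  define e where "e y = exp (- pi * (norm (y::'a))\<^sup>2)" for y
  have e: "integrable lborel e" unfolding e_def by (rule gaussian_fourier(1)) simp
  have e1: "(LINT y|lborel. e y) = 1" unfolding e_def by (subst gaussian_integral) simp_all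
  have e0: "0 \<le> e y" for y by (simp add: e_def)
  have [measurable]: "F \<in> borel_measurable borel" "g \<in> borel_measurable borel" "e \<in> borel_measurable borel"
    using F borel_measurable_continuous_onI[OF g] e by auto
  have B0: "0 \<le> B" using bd[of 0] norm_ge_zero order_trans by blast
  \<comment> \<open>The Gaussian average of \<open>g\<close> at width \<open>1 / Suc n\<close>,
    written after dilation so that the weight \<open>e\<close> is the same for all \<open>n\<close>
    and can dominate.\<close>
  define h where "h n t = (LINT y|lborel. g (t + (1 / real (Suc n)) *\<^sub>R y) * of_real (e y))" for n t
  have h_bd: "cmod (h n t) \<le> B" for n t
  proof -
    have "cmod (h n t) \<le> (LINT y|lborel. B * e y)"
      unfolding h_def using bd e0
      by (intro integral_dominated(2) integrable_mult_right e) (auto simp: norm_mult intro!: mult_right_mono)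
    then show ?thesis by (simp add: e1)
  qed
  have h_lim: "(\<lambda>n. h n t) \<longlonglongrightarrow> g t" for t
  proof -
    have "(\<lambda>n. h n t) \<longlonglongrightarrow> (LINT y|lborel. g t * of_real (e y))"
      unfolding h_def
    proof (rule integral_dominated_convergence[where w="\<lambda>y. B * e y"])
      show "AE y in lborel. (\<lambda>n. g (t + (1 / real (Suc n)) *\<^sub>R y) * of_real (e y)) \<longlonglongrightarrow> g t * of_real (e y)"
      proof (rule AE_I2)
        fix y
        have "(\<lambda>n. t + (1 / real (Suc n)) *\<^sub>R y) \<longlonglongrightarrow> t + 0 *\<^sub>R y"
          using LIMSEQ_inverse_real_of_nat by (intro tendsto_intros) (simp add: inverse_eq_divide)
        then have "(\<lambda>n. g (t + (1 / real (Suc n)) *\<^sub>R y)) \<longlonglongrightarrow> g t"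
          using continuous_on_tendsto_compose[OF g] by fastforce
        then show "(\<lambda>n. g (t + (1 / real (Suc n)) *\<^sub>R y) * of_real (e y)) \<longlonglongrightarrow> g t * of_real (e y)"
          by (intro tendsto_intros)
      qed
    qed (use e bd e0 in \<open>auto simp: norm_mult intro!: mult_right_mono\<close>)
    also have "(LINT y|lborel. g t * complex_of_real (e y)) = g t"
      by (simp only: integral_mult_right_zero integral_complex_of_real e1 of_real_1 mult_1_right)
    finally show ?thesis .
  qed
  have h_zero: "(LINT t|lborel. F t * h n t) = 0" for n
  proof -
    define c where "c = 1 / real (Suc n)"
    have c: "c > 0" by (simp add: c_def)
    define a where "a = pi / c\<^sup>2"
    have a: "a > 0" using c by (simp add: a_def)
    let ?k = "\<lambda>x::'a. exp (- a * (norm x)\<^sup>2)"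
    have k: "integrable lborel ?k" by (rule gaussian_fourier(1)[OF a])
    have conv: "(LINT s|lborel. g s * of_real (?k (s - t))) = c ^ DIM('a) *\<^sub>R h n t" for t
    proof -
      have "h n t = (LINT y|lborel. g (t + c *\<^sub>R y) * of_real (e y))"
        by (simp only: h_def c_def)
      then show ?thesis
        using gaussian_dilation[OF _ c, of g t] by (simp add: e_def a_def scaleR_conv_of_real mult.commute)
    qed
    have "c ^ DIM('a) *\<^sub>R (LINT t|lborel. F t * h n t) = (LINT t|lborel. (LINT s|lborel. F t * (g s * of_real (?k (s - t)))))"
      unfolding integral_mult_right_zero conv by simp
    also have "\<dots> = (LINT s|lborel. (LINT t|lborel. F t * (g s * of_real (?k (s - t)))))"
    proof (rule lborel_Fubini_dominated(2)[where T="\<lambda>x. x" and F="\<lambda>t. B * cmod (F t)" and G="?k"])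
      show "integrable lborel (\<lambda>t. B * cmod (F t))" using F by simp
      show "cmod (F t * (g s * of_real (?k (s - t)))) \<le> B * cmod (F t) * ?k (s - t)" for t s
        using mult_left_mono[OF mult_right_mono[OF bd[of s], of "?k (s - t)"], of "cmod (F t)"]
        by (simp add: norm_mult mult_ac)
      show "integrable lborel ?k" by (rule k)
    qed simp_all
    also have "\<dots> = (LINT s|lborel. g s * (LINT t|lborel. F t * of_real (?k (s - t))))"
      unfolding integral_mult_right_zero[symmetric] by (simp only: mult_ac)
    also have "\<dots> = 0"
      by (simp only: fourier_zero_gaussian_zero[OF F zero a] mult_zero_right Bochner_Integration.integral_zero)
    finally show ?thesis using c by simp
  qed
  have "(\<lambda>n. LINT t|lborel. F t * h n t) \<longlonglongrightarrow> (LINT t|lborel. F t * g t)"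
  proof (rule integral_dominated_convergence[where w="\<lambda>t. cmod (F t) * B"])
    show "AE t in lborel. (\<lambda>n. F t * h n t) \<longlonglongrightarrow> F t * g t"
      by (intro AE_I2 tendsto_intros h_lim)
    show "AE t in lborel. norm (F t * h n t) \<le> cmod (F t) * B" for n
      using h_bd by (intro AE_I2) (auto simp: norm_mult intro!: mult_left_mono)
    show "(\<lambda>t. F t * h n t) \<in> borel_measurable lborel" for n
      unfolding h_def by measurable
  qed (use F in auto)
  then show ?thesis unfolding h_zero by (simp only: LIMSEQ_const_iff)
qed

text \<open>Testing \<open>F\<close> against the conjugate of its own sign yields the integral of
  its modulus. That test function is only bounded and measurable, so it is approximated almost
  everywhere by continuous ones.\<close>

lemma fourier_zero_imp_AE_zero:
  fixes F :: "'a::euclidean_space \<Rightarrow> complex"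
  assumes F: "integrable lborel F"
    and zero: "\<And>\<omega>. (LINT t|lborel. F t * phase (\<omega> \<bullet> t)) = 0"
  shows "AE t in lborel. F t = 0"
proof -
  have [measurable]: "F \<in> borel_measurable borel" using F by auto
  define k where "k t = cnj (sgn (F t))" for t
  have sgn: "(sgn :: complex \<Rightarrow> complex) \<in> borel_measurable borel"
    unfolding sgn_div_norm[abs_def] by measurable
  have k_meas [measurable]: "k \<in> borel_measurable borel"
    unfolding k_def using measurable_compose[OF _ sgn] by measurable
  have "k measurable_on UNIV"
    by (rule lebesgue_measurable_imp_measurable_on) (auto intro: measurable_completion)
  then obtain N g where N: "negligible N" and g: "\<And>n. continuous_on UNIV (g n)"
    and lim: "\<And>t. t \<notin> N \<Longrightarrow> (\<lambda>n. g n t) \<longlonglongrightarrow> k t"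
    unfolding measurable_on_def by auto
  \<comment> \<open>The retraction onto the closed unit disc bounds the continuous approximants
    uniformly and leaves the values of \<open>k\<close> fixed.\<close>
  define T where "T w = w / of_real (max 1 (cmod w))" for w :: complex
  have T_cont: "continuous_on UNIV T"
    unfolding T_def by (intro continuous_intros) (auto simp: max_def)
  have T_bd: "cmod (T w) \<le> 1" for w by (auto simp: T_def norm_divide divide_le_eq_1)
  have k_bd: "cmod (k t) \<le> 1" for t by (simp add: k_def norm_sgn)
  have T_k: "T (k t) = k t" for t using k_bd[of t] by (simp add: T_def max_def)
  have Tg: "continuous_on UNIV (\<lambda>t. T (g n t))" for n
    by (rule continuous_on_compose2[OF T_cont g]) auto
  have [measurable]: "(\<lambda>t. T (g n t)) \<in> borel_measurable borel" for n
    by (rule borel_measurable_continuous_onI[OF Tg])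
  have "(\<lambda>n. LINT t|lborel. F t * T (g n t)) \<longlonglongrightarrow> (LINT t|lborel. F t * k t)"
  proof (rule integral_dominated_convergence[where w="\<lambda>t. cmod (F t)"])
    have "AE t in lebesgue. t \<notin> N"
      using N by (simp add: negligible_iff_null_sets AE_not_in)
    then have "AE t in lborel. t \<notin> N"
      by (simp add: AE_completion_iff)
    then show "AE t in lborel. (\<lambda>n. F t * T (g n t)) \<longlonglongrightarrow> F t * k t"
    proof eventually_elim
      case (elim t)
      have "(\<lambda>n. T (g n t)) \<longlonglongrightarrow> T (k t)"
        by (rule continuous_on_tendsto_compose[OF T_cont lim[OF elim]]) auto
      then show ?case unfolding T_k by (intro tendsto_intros)
    qed
    show "AE t in lborel. norm (F t * T (g n t)) \<le> cmod (F t)" for n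
      using T_bd by (intro AE_I2) (simp add: norm_mult mult_left_le)
  qed (use F in auto)
  moreover have "(LINT t|lborel. F t * T (g n t)) = 0" for n
    by (rule fourier_zero_bounded_continuous_zero[OF F zero Tg T_bd])
  ultimately have "(LINT t|lborel. F t * k t) = 0"
    by (simp add: LIMSEQ_const_iff)
  moreover have "F t * k t = of_real (cmod (F t))" for t
  proof (cases "F t = 0")
    case False
    then show ?thesis
      using complex_norm_square[of "F t"]
      by (simp add: k_def sgn_div_norm scaleR_conv_of_real power2_eq_square field_simps)
  qed (simp add: k_def)
  ultimately have "(LINT t|lborel. cmod (F t)) = 0"
    by (simp only: integral_complex_of_real of_real_eq_0_iff)
  then show ?thesis
    using F by (subst (asm) integral_nonneg_eq_0_iff_AE) auto
qed

text \<open>Pure modulations suffice: their inner products with \<eta> are, up to a constant, the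
  Fourier integrals of \<eta> times the Gaussian, and the Gaussian vanishes nowhere.\<close>

lemma coherent_total:
  assumes orth: "\<And>z. cinner_L2 \<eta> (coherent z) = 0"
  shows "\<eta> = 0"
proof -
  let ?C = "2 powr (DIM('a) / 4) :: real"
  define F where "F t = rep_L2 \<eta> t * of_real (exp (- pi * (norm (t::'a))\<^sup>2))" for t
  have sq: "square_integrable (\<lambda>t::'a. complex_of_real (exp (- pi * (norm t)\<^sup>2)))"
    using square_integrable_scale[OF square_integrable_gaussian[where 'a='a], of "of_real (1 / ?C)"] by simp
  have F: "integrable lborel F"
    using integrable_square_integrable_mult_cnj[OF rep_L2_square_integrable[of \<eta>] sq] by (simp add: F_def[abs_def])
  have "(LINT t|lborel. F t * phase (\<omega> \<bullet> t)) = 0" for \<omega>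
  proof -
    have "cinner_L2 \<eta> (coherent (0, - \<omega>)) = (LINT t|lborel. of_real ?C * (F t * phase (\<omega> \<bullet> t)))"
      unfolding cinner_L2_rep
    proof (rule integral_cong_AE)
      show "AE t in lborel. rep_L2 \<eta> t * cnj (rep_L2 (coherent (0, - \<omega>)) t) = of_real ?C * (F t * phase (\<omega> \<bullet> t))"
        using rep_coherent_AE[of 0 "- \<omega>"]
      proof eventually_elim
        case (elim t)
        show ?case unfolding elim complex_cnj_mult cnj_phase F_def by simp
      qed
    qed (use F in measurable)
    then show ?thesis using orth[of "(0, - \<omega>)"] by simp
  qed
  then have "AE t in lborel. F t = 0" by (rule fourier_zero_imp_AE_zero[OF F])
  then have "AE t in lborel. rep_L2 \<eta> t = 0" by eventually_elim (simp add: F_def)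
  then have "(LINT t|lborel. (cmod (rep_L2 \<eta> t))\<^sup>2) = (LINT t::'a|lborel. 0)"
    by (intro integral_cong_AE) (auto elim: AE_mp)
  then show ?thesis using norm_L2_sq_rep[of \<eta>] by simp
qed

text \<open>An induction principle: a property stable under linear combinations and norm limits has
  to be checked on coherent states only. In the proof the multiple by \<i> recovers the complex
  inner product from the real one.\<close>

lemma coherent_dense:
  assumes S: "closed S" "\<And>x y. x \<in> S \<Longrightarrow> y \<in> S \<Longrightarrow> x + y \<in> S" "\<And>c x. x \<in> S \<Longrightarrow> scaleC_L2 c x \<in> S"
    and coh: "\<And>z. coherent z \<in> S"
  shows "x \<in> S"
proof (rule ccontr)
  assume "x \<notin> S"
  have "subspace S"
  proof (rule subspaceI)
    have "scaleC_L2 0 gaussian = (0 :: 'a L2)"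
      using norm_scaleC_L2[of 0 gaussian] by simp
    then show "0 \<in> S" using S(3)[OF coh[of 0], of 0] by simp
  qed (use S in \<open>auto simp: scaleR_L2_def\<close>)
  then obtain \<eta> where \<eta>: "\<eta> \<noteq> 0" "\<And>y. y \<in> S \<Longrightarrow> \<eta> \<bullet> y = 0"
    using closed_subspace_orthogonal[OF S(1) _ \<open>x \<notin> S\<close>] by blast
  have "cinner_L2 \<eta> (coherent z) = 0" for z
    using \<eta>(2)[OF coh[of z]] \<eta>(2)[OF S(3)[OF coh[of z], of \<i>]]
    by (simp add: inner_L2_def cinner_L2_scaleC_right complex_eq_iff)
  with \<eta>(1) coherent_total show False by blast
qed

text \<open>Shifts of coherent states are coherent states up to a continuous phase. Since shifts are
  isometries, a norm limit in \<open>u\<close> is uniform in \<open>z\<close> and preserves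
  continuity.\<close>

lemma continuous_tf_shift: "continuous_on UNIV (\<lambda>z. tf_shift z u)"
proof -
  let ?S = "{u. continuous_on UNIV (\<lambda>z. tf_shift z (u :: 'a L2))}"
  have "closed ?S"
    unfolding closed_sequential_limits
  proof (intro allI impI, elim conjE)
    fix x :: "nat \<Rightarrow> 'a L2" and l
    assume x: "\<forall>n. x n \<in> ?S" and lim: "x \<longlonglongrightarrow> l"
    have "uniform_limit UNIV (\<lambda>n z. tf_shift z (x n)) (\<lambda>z. tf_shift z l) sequentially"
    proof (rule uniform_limitI)
      fix e :: real assume "e > 0"
      then have "\<forall>\<^sub>F n in sequentially. dist (x n) l < e" using lim by (simp add: tendsto_iff)
      then show "\<forall>\<^sub>F n in sequentially. \<forall>z\<in>UNIV. dist (tf_shift z (x n)) (tf_shift z l) < e"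
        by eventually_elim (simp add: dist_norm flip: tf_shift_diff)
    qed
    then show "l \<in> ?S"
      using x by (auto intro: uniform_limit_theorem[OF always_eventually])
  qed
  then show ?thesis
  proof (intro coherent_dense[of ?S u, simplified])
    fix z :: "'a \<times> 'a"
    have "tf_shift w (coherent z) = scaleC_L2 (phase (- (snd z \<bullet> fst w))) (coherent (w + z))" for w
      using tf_shift_tf_shift[of "fst w" "snd w" "fst z" "snd z" gaussian] by (simp flip: plus_prod_def)
    then show "continuous_on UNIV (\<lambda>w. tf_shift w (coherent z))"
      by (simp only:) (intro scaleC_L2.continuous_on continuous_intros continuous_on_compose2[OF continuous_coherent], auto)
  qed (auto simp: tf_shift_add tf_shift_scaleC intro!: continuous_intros scaleC_L2.continuous_on)
qed

section \<open>Square integrability of the short-time Fourier transform\<close>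

text \<open>Without integrability the left side is zero, the default value of the integral.\<close>

lemma ennreal_norm_integral_le:
  fixes f :: "'a \<Rightarrow> complex"
  shows "ennreal (cmod (integral\<^sup>L M f)) \<le> (\<integral>\<^sup>+x. ennreal (cmod (f x)) \<partial>M)"
proof (cases "integrable M f")
  case True
  then show ?thesis by (rule integral_norm_bound_ennreal)
qed (simp add: not_integrable_integral_eq)

text \<open>Only this half of Plancherel's theorem is needed; the Gaussian factor makes all integrals
  absolutely convergent.\<close>

lemma Bessel_fourier_damped:
  fixes F :: "'a::euclidean_space \<Rightarrow> complex"
  defines "Fh \<equiv> \<lambda>\<omega>. (LINT t|lborel. F t * phase (- (\<omega> \<bullet> t)))"
  assumes F: "integrable lborel F" and b: "b > 0"
  shows "(\<integral>\<^sup>+\<omega>. ennreal (exp (- b * (norm \<omega>)\<^sup>2) * (cmod (Fh \<omega>))\<^sup>2) \<partial>lborel) \<le> (\<integral>\<^sup>+t. ennreal ((cmod (F t))\<^sup>2) \<partial>lborel)"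
proof -
  have [measurable]: "F \<in> borel_measurable borel" using F by auto
  define e where "e \<omega> = exp (- b * (norm (\<omega>::'a))\<^sup>2)" for \<omega>
  \<comment> \<open>The Fourier transform of the damping factor \<open>e\<close>, a probability
    density.\<close>
  define \<gamma> where "\<gamma> s = sqrt (pi / b) ^ DIM('a) * exp (- (pi\<^sup>2 / b) * (norm (s::'a))\<^sup>2)" for s
  define A where "A = (LINT t|lborel. cmod (F t))"
  have e: "integrable lborel e" unfolding e_def by (rule gaussian_fourier(1)[OF b])
  have e0: "0 \<le> e \<omega>" for \<omega> by (simp add: e_def)
  have \<gamma>0: "0 \<le> \<gamma> s" for s using b by (simp add: \<gamma>_def)
  have [measurable]: "e \<in> borel_measurable borel" "\<gamma> \<in> borel_measurable borel" unfolding e_def \<gamma>_def by measurable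
  have \<gamma>_int: "(\<integral>\<^sup>+s. ennreal (\<gamma> s) \<partial>lborel) = 1"
  proof -
    have p: "pi\<^sup>2 / b > 0" using b by simp
    have "sqrt (pi / b) * sqrt (pi / (pi\<^sup>2 / b)) = 1"
      unfolding real_sqrt_mult[symmetric] using b by (simp add: power2_eq_square)
    then have "(LINT s|lborel. \<gamma> s) = 1"
      unfolding \<gamma>_def integral_mult_right_zero gaussian_integral[OF p] power_mult_distrib[symmetric] by simp
    moreover have "integrable lborel \<gamma>"
      unfolding \<gamma>_def by (intro integrable_mult_right gaussian_fourier(1)[OF p])
    ultimately show ?thesis
      using \<gamma>0 by (subst nn_integral_eq_integral) auto
  qed
  have \<gamma>_shift: "(\<integral>\<^sup>+t. ennreal (\<gamma> (t - s)) \<partial>lborel) = 1" "(\<integral>\<^sup>+t. ennreal (\<gamma> (s - t)) \<partial>lborel) = 1" for s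
    using lborel_nn_integral_shift[of "\<lambda>t. ennreal (\<gamma> t)" "- s"] lborel_nn_integral_reflect[of "\<lambda>t. ennreal (\<gamma> t)" s] \<gamma>_int by simp_all
  have A0: "0 \<le> A" unfolding A_def by simp
  have Fh_bd: "cmod (Fh \<omega>) \<le> A" for \<omega>
  proof -
    have "cmod (Fh \<omega>) \<le> (LINT t|lborel. cmod (F t * phase (- (\<omega> \<bullet> t))))"
      unfolding Fh_def by (rule integral_norm_bound)
    then show ?thesis by (simp only: A_def norm_mult norm_phase mult_1_right)
  qed
  have [measurable]: "Fh \<in> borel_measurable borel" unfolding Fh_def by measurable
  \<comment> \<open>Transforming the damped conjugate of \<open>Fh\<close> back gives the conjugate
    of \<open>F\<close> smoothed by \<gamma>, so the damped integral of
    \<open>(cmod (Fh \<omega>))\<^sup>2\<close> becomes a quadratic form in \<open>F\<close> with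
    kernel \<gamma>.\<close>
  define J where "J s = (LINT \<omega>|lborel. of_real (e \<omega>) * (phase (- (\<omega> \<bullet> s)) * cnj (Fh \<omega>)))" for s
  have J: "J s = (LINT t|lborel. cnj (F t) * of_real (\<gamma> (t - s)))" for s
  proof -
    have cnj_Fh: "cnj (Fh \<omega>) = (LINT t|lborel. cnj (F t) * phase (\<omega> \<bullet> t))" for \<omega>
      unfolding Fh_def Bochner_Integration.integral_cnj[symmetric] complex_cnj_mult cnj_phase by simp
    have "J s = (LINT \<omega>|lborel. (LINT t|lborel. of_real (e \<omega>) * (phase (- (\<omega> \<bullet> s)) * (cnj (F t) * phase (\<omega> \<bullet> t)))))"
      unfolding J_def cnj_Fh integral_mult_right_zero ..
    also have "\<dots> = (LINT t|lborel. (LINT \<omega>|lborel. of_real (e \<omega>) * (phase (- (\<omega> \<bullet> s)) * (cnj (F t) * phase (\<omega> \<bullet> t)))))"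
    proof (rule lborel_Fubini_dominated(2)[where T="\<lambda>_. 0" and F=e and G="\<lambda>t. cmod (F t)"])
      show "cmod (of_real (e \<omega>) * (phase (- (\<omega> \<bullet> s)) * (cnj (F t) * phase (\<omega> \<bullet> t)))) \<le> e \<omega> * cmod (F (t - 0))" for \<omega> t
        unfolding norm_mult norm_phase using e0 by simp
    qed (use e F in simp_all)
    also have "\<dots> = (LINT t|lborel. cnj (F t) * of_real (\<gamma> (t - s)))"
    proof (rule Bochner_Integration.integral_cong)
      fix t
      have "of_real (e \<omega>) * (phase (- (\<omega> \<bullet> s)) * (cnj (F t) * phase (\<omega> \<bullet> t))) = cnj (F t) * (of_real (e \<omega>) * phase (\<omega> \<bullet> (t - s)))" for \<omega>
        unfolding phase_inner_diff by (simp only: mult_ac)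
      then show "(LINT \<omega>|lborel. of_real (e \<omega>) * (phase (- (\<omega> \<bullet> s)) * (cnj (F t) * phase (\<omega> \<bullet> t)))) = cnj (F t) * of_real (\<gamma> (t - s))"
        by (simp only: integral_mult_right_zero e_def gaussian_phase_integral[OF b] \<gamma>_def)
    qed simp
    finally show ?thesis .
  qed
  have J_le: "ennreal (cmod (J s)) \<le> (\<integral>\<^sup>+t. ennreal (cmod (F t) * \<gamma> (t - s)) \<partial>lborel)" for s
    unfolding J using ennreal_norm_integral_le[of lborel "\<lambda>t. cnj (F t) * of_real (\<gamma> (t - s))"] \<gamma>0
    by (simp add: norm_mult)
  define D where "D = (LINT \<omega>|lborel. e \<omega> * (cmod (Fh \<omega>))\<^sup>2)"
  have eF_int: "integrable lborel (\<lambda>\<omega>. e \<omega> * (cmod (Fh \<omega>))\<^sup>2)"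
  proof (rule integral_dominated(1))
    show "integrable lborel (\<lambda>\<omega>. e \<omega> * A\<^sup>2)" using e by simp
    show "norm (e \<omega> * (cmod (Fh \<omega>))\<^sup>2) \<le> e \<omega> * A\<^sup>2" for \<omega>
      using e0 Fh_bd by (simp add: abs_mult mult_left_mono power_mono)
  qed measurable
  have "complex_of_real (e \<omega> * (cmod (Fh \<omega>))\<^sup>2) = of_real (e \<omega>) * cnj (Fh \<omega>) * Fh \<omega>" for \<omega>
    unfolding of_real_mult complex_norm_square by (simp only: mult_ac)
  then have "complex_of_real D = (LINT \<omega>|lborel. of_real (e \<omega>) * cnj (Fh \<omega>) * Fh \<omega>)"
    unfolding D_def integral_complex_of_real[symmetric] by (simp only:)
  also have "\<dots> = (LINT \<omega>|lborel. (LINT s|lborel. of_real (e \<omega>) * cnj (Fh \<omega>) * (F s * phase (- (\<omega> \<bullet> s)))))"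
    unfolding Fh_def integral_mult_right_zero ..
  also have "\<dots> = (LINT s|lborel. (LINT \<omega>|lborel. of_real (e \<omega>) * cnj (Fh \<omega>) * (F s * phase (- (\<omega> \<bullet> s)))))"
  proof (rule lborel_Fubini_dominated(2)[where T="\<lambda>_. 0" and F="\<lambda>\<omega>. A * e \<omega>" and G="\<lambda>t. cmod (F t)"])
    show "cmod (of_real (e \<omega>) * cnj (Fh \<omega>) * (F s * phase (- (\<omega> \<bullet> s)))) \<le> A * e \<omega> * cmod (F (s - 0))" for \<omega> s
      unfolding norm_mult norm_phase using e0 mult_right_mono[OF Fh_bd[of \<omega>] mult_nonneg_nonneg[OF e0[of \<omega>] norm_ge_zero[of "F s"]]]
      by (simp add: mult_ac)
    show "integrable lborel (\<lambda>\<omega>. A * e \<omega>)" using e by simp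
  qed (use F in simp_all)
  also have "\<dots> = (LINT s|lborel. F s * J s)"
  proof -
    have "of_real (e \<omega>) * cnj (Fh \<omega>) * (F s * phase (- (\<omega> \<bullet> s))) = F s * (of_real (e \<omega>) * (phase (- (\<omega> \<bullet> s)) * cnj (Fh \<omega>)))" for \<omega> s
      by (simp only: mult_ac)
    then show ?thesis unfolding J_def integral_mult_right_zero[symmetric] by (simp only:)
  qed
  finally have eq: "complex_of_real D = (LINT s|lborel. F s * J s)" .
  have "0 \<le> D" unfolding D_def using e0 by (intro integral_nonneg_AE AE_I2) auto
  \<comment> \<open>Bounding \<open>cmod (F s) * cmod (F t)\<close> by the mean of the squares
    splits the quadratic form into two parts; in each, one variable meets only the kernel \<gamma>,
    which integrates to 1.\<close>
  define q where "q s = ennreal ((cmod (F s))\<^sup>2 / 2)" for s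
  define G where "G s = ennreal (\<gamma> s)" for s
  have [measurable]: "q \<in> borel_measurable borel" "G \<in> borel_measurable borel" unfolding q_def G_def by measurable
  have "(\<integral>\<^sup>+\<omega>. ennreal (e \<omega> * (cmod (Fh \<omega>))\<^sup>2) \<partial>lborel) = ennreal D"
    unfolding D_def using e0 by (intro nn_integral_eq_integral eF_int) auto
  also have "\<dots> = ennreal (cmod (LINT s|lborel. F s * J s))"
    unfolding eq[symmetric] norm_of_real using \<open>0 \<le> D\<close> by simp
  also have "\<dots> \<le> (\<integral>\<^sup>+s. ennreal (cmod (F s * J s)) \<partial>lborel)"
    by (rule ennreal_norm_integral_le)
  also have "\<dots> \<le> (\<integral>\<^sup>+s. (\<integral>\<^sup>+t. q s * G (t - s) + q t * G (t - s) \<partial>lborel) \<partial>lborel)"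
  proof (rule nn_integral_mono)
    fix s
    have "ennreal (cmod (F s * J s)) \<le> ennreal (cmod (F s)) * (\<integral>\<^sup>+t. ennreal (cmod (F t) * \<gamma> (t - s)) \<partial>lborel)"
      by (simp add: norm_mult ennreal_mult mult_left_mono J_le)
    also have "\<dots> = (\<integral>\<^sup>+t. ennreal (cmod (F s)) * ennreal (cmod (F t) * \<gamma> (t - s)) \<partial>lborel)"
      by (rule nn_integral_cmult[symmetric]) measurable
    also have "\<dots> \<le> (\<integral>\<^sup>+t. q s * G (t - s) + q t * G (t - s) \<partial>lborel)"
    proof (rule nn_integral_mono)
      fix t
      have "cmod (F s) * (cmod (F t) * \<gamma> (t - s)) \<le> ((cmod (F s))\<^sup>2 / 2 + (cmod (F t))\<^sup>2 / 2) * \<gamma> (t - s)"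
        unfolding mult.assoc[symmetric] using sum_squares_bound[of "cmod (F s)" "cmod (F t)"]
        by (intro mult_right_mono \<gamma>0) simp
      then show "ennreal (cmod (F s)) * ennreal (cmod (F t) * \<gamma> (t - s)) \<le> q s * G (t - s) + q t * G (t - s)"
        using \<gamma>0 by (simp add: q_def G_def ennreal_mult[symmetric] ennreal_plus[symmetric] ring_distribs del: ennreal_plus)
    qed
    finally show "ennreal (cmod (F s * J s)) \<le> \<dots>" .
  qed
  also have "\<dots> = (\<integral>\<^sup>+s. q s \<partial>lborel) + (\<integral>\<^sup>+s. (\<integral>\<^sup>+t. q t * G (t - s) \<partial>lborel) \<partial>lborel)"
    by (simp add: nn_integral_add nn_integral_cmult \<gamma>_shift[folded G_def])
  also have "(\<integral>\<^sup>+s. (\<integral>\<^sup>+t. q t * G (t - s) \<partial>lborel) \<partial>lborel) = (\<integral>\<^sup>+t. (\<integral>\<^sup>+s. q t * G (t - s) \<partial>lborel) \<partial>lborel)"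
    by (rule lborel_pair.Fubini') measurable
  also have "\<dots> = (\<integral>\<^sup>+t. q t \<partial>lborel)"
    by (simp add: nn_integral_cmult \<gamma>_shift[folded G_def])
  also have "(\<integral>\<^sup>+s. q s \<partial>lborel) + (\<integral>\<^sup>+t. q t \<partial>lborel) = (\<integral>\<^sup>+t. ennreal ((cmod (F t))\<^sup>2) \<partial>lborel)"
    by (subst nn_integral_add[symmetric]) (simp_all add: q_def ennreal_plus[symmetric] del: ennreal_plus)
  finally show ?thesis by (simp only: e_def)
qed

text \<open>The damping is removed by Fatou's lemma as its rate tends to 0.\<close>

lemma Bessel_fourier:
  fixes F :: "'a::euclidean_space \<Rightarrow> complex"
  assumes F: "integrable lborel F"
  shows "(\<integral>\<^sup>+\<omega>. ennreal ((cmod (LINT t|lborel. F t * phase (- (\<omega> \<bullet> t))))\<^sup>2) \<partial>lborel) \<le> (\<integral>\<^sup>+t. ennreal ((cmod (F t))\<^sup>2) \<partial>lborel)"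
proof -
  define Fh where "Fh \<omega> = (LINT t|lborel. F t * phase (- (\<omega> \<bullet> t)))" for \<omega>
  have [measurable]: "F \<in> borel_measurable borel" using F by auto
  have [measurable]: "Fh \<in> borel_measurable borel" unfolding Fh_def by measurable
  let ?g = "\<lambda>n \<omega>. ennreal (exp (- (1 / real (Suc n)) * (norm \<omega>)\<^sup>2) * (cmod (Fh \<omega>))\<^sup>2)"
  have "(\<integral>\<^sup>+\<omega>. ennreal ((cmod (Fh \<omega>))\<^sup>2) \<partial>lborel) = (\<integral>\<^sup>+\<omega>. liminf (\<lambda>n. ?g n \<omega>) \<partial>lborel)"
  proof (rule nn_integral_cong)
    fix \<omega> :: 'a
    have lim: "(\<lambda>n. - (1 / real (Suc n)) * (norm \<omega>)\<^sup>2) \<longlonglongrightarrow> - 0 * (norm \<omega>)\<^sup>2"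
      using LIMSEQ_inverse_real_of_nat by (intro tendsto_mult tendsto_minus tendsto_const) (simp add: inverse_eq_divide)
    have "(\<lambda>n. ?g n \<omega>) \<longlonglongrightarrow> ennreal (exp (- 0 * (norm \<omega>)\<^sup>2) * (cmod (Fh \<omega>))\<^sup>2)"
      by (intro tendsto_ennrealI tendsto_mult[OF tendsto_exp[OF lim]] tendsto_const)
    then show "ennreal ((cmod (Fh \<omega>))\<^sup>2) = liminf (\<lambda>n. ?g n \<omega>)"
      using lim_imp_Liminf[OF sequentially_bot] by fastforce
  qed
  also have "\<dots> \<le> liminf (\<lambda>n. \<integral>\<^sup>+\<omega>. ?g n \<omega> \<partial>lborel)"
    by (rule nn_integral_liminf) measurable
  also have "\<dots> \<le> (\<integral>\<^sup>+t. ennreal ((cmod (F t))\<^sup>2) \<partial>lborel)"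
    unfolding Fh_def by (intro Liminf_le always_eventually allI Bessel_fourier_damped[OF F]) simp_all
  finally show ?thesis by (simp only: Fh_def)
qed

text \<open>For fixed \<open>x\<close> the transform is a Fourier integral in \<omega>, which lets
  Bessel's inequality act on slices of phase space.\<close>

lemma stft_rep:
  "stft \<phi> \<psi> (x, \<omega>) = (LINT t|lborel. (rep_L2 \<psi> t * cnj (rep_L2 \<phi> (t - x))) * phase (- (\<omega> \<bullet> t)))"
  unfolding stft_def cinner_L2_rep
proof (rule integral_cong_AE)
  show "AE t in lborel. rep_L2 \<psi> t * cnj (rep_L2 (tf_shift (x, \<omega>) \<phi>) t) = (rep_L2 \<psi> t * cnj (rep_L2 \<phi> (t - x))) * phase (- (\<omega> \<bullet> t))"
    using rep_tf_shift_AE[of x \<omega> \<phi>]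
  proof eventually_elim
    case (elim t)
    show ?case unfolding elim complex_cnj_mult cnj_phase by (simp only: mult_ac)
  qed
qed measurable

lemma continuous_stft: "continuous_on UNIV (stft \<phi> \<psi>)"
  unfolding stft_def[abs_def] by (intro cinner_L2.continuous_on continuous_on_const continuous_tf_shift)

lemma stft_measurable [measurable]: "stft \<phi> \<psi> \<in> borel_measurable borel"
  by (rule borel_measurable_continuous_onI[OF continuous_stft])

text \<open>The inequality half of Moyal's identity: Bessel's inequality on each slice, then
  Tonelli.\<close>

lemma stft_nn_integral:
  "(\<integral>\<^sup>+z. ennreal ((cmod (stft \<phi> \<psi> z))\<^sup>2) \<partial>lborel) \<le> ennreal ((norm \<phi> * norm \<psi>)\<^sup>2)"
proof -
  have nn: "(\<integral>\<^sup>+t. ennreal ((cmod (rep_L2 u t))\<^sup>2) \<partial>lborel) = ennreal ((norm u)\<^sup>2)" for u :: "'a L2"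
    unfolding norm_L2_sq_rep by (intro nn_integral_eq_integral rep_L2_integrable_norm_sq) simp
  have "(\<integral>\<^sup>+z. ennreal ((cmod (stft \<phi> \<psi> z))\<^sup>2) \<partial>lborel) = (\<integral>\<^sup>+z. ennreal ((cmod (stft \<phi> \<psi> z))\<^sup>2) \<partial>(lborel \<Otimes>\<^sub>M lborel))"
    by (simp only: lborel_prod)
  also have "\<dots> = (\<integral>\<^sup>+x. (\<integral>\<^sup>+\<omega>. ennreal ((cmod (stft \<phi> \<psi> (x, \<omega>)))\<^sup>2) \<partial>lborel) \<partial>lborel)"
    by (rule lborel.nn_integral_fst[symmetric]) (simp add: lborel_prod)
  also have "\<dots> \<le> (\<integral>\<^sup>+x. (\<integral>\<^sup>+t. ennreal ((cmod (rep_L2 \<psi> t * cnj (rep_L2 \<phi> (t - x))))\<^sup>2) \<partial>lborel) \<partial>lborel)"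
  proof (rule nn_integral_mono)
    fix x :: 'a
    have "square_integrable (\<lambda>t. rep_L2 \<phi> (t - x))"
      using lborel_integral_shift(2)[of "\<lambda>t. (cmod (rep_L2 \<phi> t))\<^sup>2" "- x"] rep_L2_integrable_norm_sq[of \<phi>]
      by (simp add: square_integrable_def)
    then have "integrable lborel (\<lambda>t. rep_L2 \<psi> t * cnj (rep_L2 \<phi> (t - x)))"
      by (intro integrable_square_integrable_mult_cnj) simp_all
    then show "(\<integral>\<^sup>+\<omega>. ennreal ((cmod (stft \<phi> \<psi> (x, \<omega>)))\<^sup>2) \<partial>lborel) \<le> (\<integral>\<^sup>+t. ennreal ((cmod (rep_L2 \<psi> t * cnj (rep_L2 \<phi> (t - x))))\<^sup>2) \<partial>lborel)"
      unfolding stft_rep by (rule Bessel_fourier)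
  qed
  also have "\<dots> = (\<integral>\<^sup>+x. (\<integral>\<^sup>+t. ennreal ((cmod (rep_L2 \<psi> t))\<^sup>2) * ennreal ((cmod (rep_L2 \<phi> (t - x)))\<^sup>2) \<partial>lborel) \<partial>lborel)"
    by (simp add: norm_mult power_mult_distrib ennreal_mult)
  also have "\<dots> = (\<integral>\<^sup>+t. (\<integral>\<^sup>+x. ennreal ((cmod (rep_L2 \<psi> t))\<^sup>2) * ennreal ((cmod (rep_L2 \<phi> (t - x)))\<^sup>2) \<partial>lborel) \<partial>lborel)"
    by (rule lborel_pair.Fubini') measurable
  also have "\<dots> = (\<integral>\<^sup>+t. ennreal ((cmod (rep_L2 \<psi> t))\<^sup>2) * ennreal ((norm \<phi>)\<^sup>2) \<partial>lborel)"
  proof -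
    have "(\<integral>\<^sup>+x. ennreal ((cmod (rep_L2 \<phi> (t - x)))\<^sup>2) \<partial>lborel) = ennreal ((norm \<phi>)\<^sup>2)" for t
      using lborel_nn_integral_reflect[of "\<lambda>x. ennreal ((cmod (rep_L2 \<phi> x))\<^sup>2)" t] nn[of \<phi>] by simp
    then show ?thesis by (simp add: nn_integral_cmult)
  qed
  also have "\<dots> = ennreal ((norm \<psi>)\<^sup>2) * ennreal ((norm \<phi>)\<^sup>2)"
    by (subst nn_integral_multc) (simp_all add: nn)
  also have "\<dots> = ennreal ((norm \<phi> * norm \<psi>)\<^sup>2)"
    by (simp add: ennreal_mult[symmetric] power_mult_distrib mult.commute del: ennreal_mult)
  finally show ?thesis .
qed

lemma square_integrable_stft: "square_integrable (stft \<phi> \<psi>)"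
  unfolding square_integrable_def
proof
  show "integrable lborel (\<lambda>z. (cmod (stft \<phi> \<psi> z))\<^sup>2)"
    using order.strict_trans1[OF stft_nn_integral[of \<phi> \<psi>] ennreal_less_top] by (intro integrableI_bounded) auto
qed measurable

lemma stft_L2_norm: "(LINT z|lborel. (cmod (stft \<phi> \<psi> z))\<^sup>2) \<le> (norm \<phi> * norm \<psi>)\<^sup>2"
  using stft_nn_integral[of \<phi> \<psi>] square_integrable_stft[of \<phi> \<psi>]
  by (subst (asm) nn_integral_eq_integral) (auto simp: square_integrable_def)

text \<open>The Hilbert space inequality for the classes of the two moduli.\<close>

lemma integral_norm_mult_Cauchy_Schwarz:
  fixes f g :: "'a::euclidean_space \<Rightarrow> complex"
  assumes f: "square_integrable f" and g: "square_integrable g"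
  shows "integrable lborel (\<lambda>z. cmod (f z) * cmod (g z))"
    and "(LINT z|lborel. cmod (f z) * cmod (g z)) \<le> sqrt (LINT z|lborel. (cmod (f z))\<^sup>2) * sqrt (LINT z|lborel. (cmod (g z))\<^sup>2)"
proof -
  let ?f = "\<lambda>z. complex_of_real (cmod (f z))" and ?g = "\<lambda>z. complex_of_real (cmod (g z))"
  have sq: "square_integrable ?f" "square_integrable ?g"
    using f g by (auto simp: square_integrable_def)
  show int: "integrable lborel (\<lambda>z. cmod (f z) * cmod (g z))"
    using integrable_norm[OF integrable_square_integrable_mult_cnj[OF sq]] by (simp add: norm_mult)
  have nrm: "norm (abs_L2 h) = sqrt (LINT z|lborel. (cmod (h z))\<^sup>2)" if h: "square_integrable h" for h :: "'a \<Rightarrow> complex"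
  proof -
    have "(LINT z|lborel. (cmod (rep_L2 (abs_L2 h) z))\<^sup>2) = (LINT z|lborel. (cmod (h z))\<^sup>2)"
      using rep_abs_L2_AE[OF h] h by (intro integral_cong_AE) (auto simp: square_integrable_def elim: AE_mp)
    then show ?thesis using norm_L2_sq_rep[of "abs_L2 h"] by (metis norm_ge_zero real_sqrt_unique)
  qed
  have "cinner_L2 (abs_L2 ?f) (abs_L2 ?g) = (LINT z|lborel. complex_of_real (cmod (f z) * cmod (g z)))"
    unfolding cinner_L2_rep
  proof (rule integral_cong_AE)
    show "AE z in lborel. rep_L2 (abs_L2 ?f) z * cnj (rep_L2 (abs_L2 ?g) z) = complex_of_real (cmod (f z) * cmod (g z))"
      using rep_abs_L2_AE[OF sq(1)] rep_abs_L2_AE[OF sq(2)] by eventually_elim simp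
  qed (use f g in \<open>auto simp: square_integrable_def\<close>)
  also have "\<dots> = of_real (LINT z|lborel. cmod (f z) * cmod (g z))" by (rule integral_complex_of_real)
  finally have "\<bar>LINT z|lborel. cmod (f z) * cmod (g z)\<bar> \<le> norm (abs_L2 ?f) * norm (abs_L2 ?g)"
    using cinner_L2_Cauchy_Schwarz[of "abs_L2 ?f" "abs_L2 ?g"] by simp
  then show "(LINT z|lborel. cmod (f z) * cmod (g z)) \<le> sqrt (LINT z|lborel. (cmod (f z))\<^sup>2) * sqrt (LINT z|lborel. (cmod (g z))\<^sup>2)"
    unfolding nrm[OF sq(1)] nrm[OF sq(2)] by simp
qed

lemma stft_mult_stft:
  shows "integrable lborel (\<lambda>z. cmod (stft \<phi> u z) * cmod (stft \<psi> v z))"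
    and "(LINT z|lborel. cmod (stft \<phi> u z) * cmod (stft \<psi> v z)) \<le> (norm \<phi> * norm u) * (norm \<psi> * norm v)"
proof -
  show "integrable lborel (\<lambda>z. cmod (stft \<phi> u z) * cmod (stft \<psi> v z))"
    by (rule integral_norm_mult_Cauchy_Schwarz(1)[OF square_integrable_stft square_integrable_stft])
  have le: "sqrt (LINT z|lborel. (cmod (stft \<phi> u z))\<^sup>2) \<le> norm \<phi> * norm u" for \<phi> u :: "'a L2"
    using real_sqrt_le_mono[OF stft_L2_norm[of \<phi> u]] by simp
  show "(LINT z|lborel. cmod (stft \<phi> u z) * cmod (stft \<psi> v z)) \<le> (norm \<phi> * norm u) * (norm \<psi> * norm v)"
    by (rule order_trans[OF integral_norm_mult_Cauchy_Schwarz(2)[OF square_integrable_stft square_integrable_stft]])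
       (intro mult_mono le, auto)
qed

lemma stft_add: "stft \<phi> (u + v) z = stft \<phi> u z + stft \<phi> v z" "stft (\<phi> + \<psi>) u z = stft \<phi> u z + stft \<psi> u z"
  by (simp_all add: stft_def cinner_L2_add_left cinner_L2_add_right tf_shift_add)

lemma stft_scaleC: "stft \<phi> (scaleC_L2 c u) z = c * stft \<phi> u z" "stft (scaleC_L2 c \<phi>) u z = cnj c * stft \<phi> u z"
  by (simp_all add: stft_def cinner_L2_scaleC_left cinner_L2_scaleC_right tf_shift_scaleC)

lemma norm_stft_le: "cmod (stft \<phi> u z) \<le> norm \<phi> * norm u"
  using cinner_L2_Cauchy_Schwarz[of u "tf_shift z \<phi>"] by (simp add: stft_def mult.commute)

section \<open>Localization operators\<close>

text \<open>Bounds hold everywhere and measurability is Borel, so that symbols can be shifted,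
  convolved and estimated pointwise without exceptional sets.\<close>

definition bounded_symbol :: "real \<Rightarrow> ('a::euclidean_space \<Rightarrow> complex) \<Rightarrow> bool" where
  "bounded_symbol B g \<longleftrightarrow> g \<in> borel_measurable borel \<and> (\<forall>z. cmod (g z) \<le> B)"

definition localization_form ::
  "('a::euclidean_space \<times> 'a \<Rightarrow> complex) \<Rightarrow> 'a L2 \<Rightarrow> 'a L2 \<Rightarrow> 'a L2 \<Rightarrow> 'a L2 \<Rightarrow> complex" where
  "localization_form g \<psi> \<phi> u v = (LINT z|lborel. g z * stft \<psi> u z * cnj (stft \<phi> v z))"

lemma bounded_symbolD: "bounded_symbol B g \<Longrightarrow> cmod (g z) \<le> B"
  by (simp only: bounded_symbol_def)

lemma bounded_symbol_nonneg: "bounded_symbol B g \<Longrightarrow> 0 \<le> B"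
  unfolding bounded_symbol_def using norm_ge_zero order_trans by blast

text \<open>Cauchy-Schwarz on phase space, with the two transforms as factors and the symbol bounded
  by \<open>B\<close>.\<close>

lemma
  assumes g: "bounded_symbol B g"
  shows localization_form_integrable: "integrable lborel (\<lambda>z. g z * stft \<psi> u z * cnj (stft \<phi> v z))"
    and localization_form_bound: "cmod (localization_form g \<psi> \<phi> u v) \<le> B * ((norm \<psi> * norm u) * (norm \<phi> * norm v))"
proof -
  have [measurable]: "g \<in> borel_measurable borel" using g by (simp add: bounded_symbol_def)
  have le: "norm (g z * stft \<psi> u z * cnj (stft \<phi> v z)) \<le> B * (cmod (stft \<psi> u z) * cmod (stft \<phi> v z))" for z
    by (simp add: bounded_symbolD[OF g] norm_mult mult.assoc mult_right_mono)
  note dom = integral_dominated[OF integrable_mult_right[OF stft_mult_stft(1)] _ le]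
  show "integrable lborel (\<lambda>z. g z * stft \<psi> u z * cnj (stft \<phi> v z))"
    by (rule dom(1)) measurable
  have "cmod (localization_form g \<psi> \<phi> u v) \<le> (LINT z|lborel. B * (cmod (stft \<psi> u z) * cmod (stft \<phi> v z)))"
    unfolding localization_form_def by (rule dom(2)) measurable
  also have "\<dots> \<le> B * ((norm \<psi> * norm u) * (norm \<phi> * norm v))"
    using mult_left_mono[OF stft_mult_stft(2) bounded_symbol_nonneg[OF g]] by simp
  finally show "cmod (localization_form g \<psi> \<phi> u v) \<le> B * ((norm \<psi> * norm u) * (norm \<phi> * norm v))" .
qed

text \<open>The windows are treated on a par with \<open>u\<close> and \<open>v\<close>, since
  identities will be extended from coherent states in all four places.\<close>

lemma localization_form_linear:
  assumes g: "bounded_symbol B g"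
  shows "localization_form g \<psi> \<phi> (u + u') v = localization_form g \<psi> \<phi> u v + localization_form g \<psi> \<phi> u' v"
    and "localization_form g \<psi> \<phi> u (v + v') = localization_form g \<psi> \<phi> u v + localization_form g \<psi> \<phi> u v'"
    and "localization_form g (\<psi> + \<psi>') \<phi> u v = localization_form g \<psi> \<phi> u v + localization_form g \<psi>' \<phi> u v"
    and "localization_form g \<psi> (\<phi> + \<phi>') u v = localization_form g \<psi> \<phi> u v + localization_form g \<psi> \<phi>' u v"
  unfolding localization_form_def stft_add complex_cnj_add ring_distribs
  by (rule Bochner_Integration.integral_add localization_form_integrable[OF g])+

lemma localization_form_scaleC:
  "localization_form g \<psi> \<phi> (scaleC_L2 c u) v = c * localization_form g \<psi> \<phi> u v"
  "localization_form g \<psi> \<phi> u (scaleC_L2 c v) = cnj c * localization_form g \<psi> \<phi> u v"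
  "localization_form g (scaleC_L2 c \<psi>) \<phi> u v = cnj c * localization_form g \<psi> \<phi> u v"
  "localization_form g \<psi> (scaleC_L2 c \<phi>) u v = c * localization_form g \<psi> \<phi> u v"
  unfolding localization_form_def stft_scaleC complex_cnj_mult complex_cnj_cnj
  by (subst integral_mult_right_zero[symmetric], simp only: mult_ac)+

lemma localization_form_symbol_add:
  assumes "bounded_symbol B g" "bounded_symbol B' g'"
  shows "localization_form (\<lambda>z. g z + g' z) \<psi> \<phi> u v = localization_form g \<psi> \<phi> u v + localization_form g' \<psi> \<phi> u v"
  unfolding localization_form_def ring_distribs
  by (rule Bochner_Integration.integral_add localization_form_integrable assms)+

lemma localization_form_symbol_scale:
  "localization_form (\<lambda>z. c * g z) \<psi> \<phi> u v = c * localization_form g \<psi> \<phi> u v"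
  unfolding localization_form_def by (subst integral_mult_right_zero[symmetric]) (simp only: mult_ac)

text \<open>The passage to a Borel symbol is stated through integrals because both the operator and
  the convolution depend on \<open>f\<close> only in this way.\<close>

lemma Linfinity_bounded_symbol:
  fixes f :: "'a::euclidean_space \<Rightarrow> complex"
  assumes "f \<in> Linfinity"
  obtains B g where "bounded_symbol B g"
    "\<And>h :: 'a \<Rightarrow> complex. h \<in> borel_measurable borel \<Longrightarrow> (LINT z|lebesgue. f z * h z) = (LINT z|lborel. g z * h z)"
proof -
  obtain B where f: "f \<in> borel_measurable lebesgue" and B: "AE z in lebesgue. cmod (f z) \<le> B"
    using assms by (auto simp: Linfinity_def)
  obtain r where r [measurable]: "r \<in> borel_measurable lborel" and rf: "AE z in lborel. Re (f z) = r z"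
    using completion_ex_borel_measurable_real[of "\<lambda>z. Re (f z)" lborel] f by (auto intro: borel_measurable_Re)
  obtain i where i [measurable]: "i \<in> borel_measurable lborel" and "if": "AE z in lborel. Im (f z) = i z"
    using completion_ex_borel_measurable_real[of "\<lambda>z. Im (f z)" lborel] f by (auto intro: borel_measurable_Im)
  \<comment> \<open>Resetting the values beyond the essential bound to 0 alters a null set only; the
    absolute value keeps 0 within the bound whatever the sign of \<open>B\<close>.\<close>
  define g where "g z = (if cmod (Complex (r z) (i z)) \<le> \<bar>B\<bar> then Complex (r z) (i z) else 0)" for z
  have Complex_eq: "Complex (r z) (i z) = of_real (r z) + \<i> * of_real (i z)" for z by (simp add: complex_eq_iff)
  have g [measurable]: "g \<in> borel_measurable borel"
    using r i unfolding g_def Complex_eq by measurable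
  have ae: "AE z in lebesgue. f z = g z"
    using AE_completion[OF rf] AE_completion[OF "if"] B
  proof eventually_elim
    case (elim z)
    then have "f z = Complex (r z) (i z)" by (simp add: complex_eq_iff)
    with elim show ?case by (simp add: g_def)
  qed
  show ?thesis
  proof (rule that)
    show "bounded_symbol \<bar>B\<bar> g" using g by (simp add: bounded_symbol_def g_def)
    fix h :: "'a \<Rightarrow> complex" assume [measurable]: "h \<in> borel_measurable borel"
    have hl: "h \<in> borel_measurable lebesgue" "g \<in> borel_measurable lebesgue" by (auto intro!: measurable_completion)
    have "(LINT z|lebesgue. f z * h z) = (LINT z|lebesgue. g z * h z)"
      using ae f hl by (intro integral_cong_AE borel_measurable_times) (auto elim: AE_mp)
    also have "\<dots> = (LINT z|lborel. g z * h z)"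
      by (rule integral_completion) measurable
    finally show "(LINT z|lebesgue. f z * h z) = (LINT z|lborel. g z * h z)" .
  qed
qed

text \<open>The real theorem represents the real part; evaluating at \<open>scaleC_L2 \<i> u\<close>
  gives the imaginary part with the same vector.\<close>

lemma Riesz_representation_L2:
  fixes Q :: "'a::euclidean_space L2 \<Rightarrow> complex"
  assumes add: "\<And>u v. Q (u + v) = Q u + Q v" and scale: "\<And>c u. Q (scaleC_L2 c u) = cnj c * Q u"
    and bd: "\<And>u. cmod (Q u) \<le> K * norm u"
  obtains \<eta> where "\<And>u. cinner_L2 \<eta> u = Q u"
proof -
  have "bounded_linear (\<lambda>u. Re (Q u))"
  proof (rule bounded_linear_intro)
    show "norm (Re (Q u)) \<le> norm u * K" for u
      using order_trans[OF abs_Re_le_cmod bd[of u]] by (simp add: mult.commute)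
  qed (simp_all add: add scaleR_L2_def scale)
  then obtain \<eta> where \<eta>: "\<And>u. Re (Q u) = \<eta> \<bullet> u"
    using Riesz_representation_real by blast
  show ?thesis
  proof (rule that)
    fix u
    show "cinner_L2 \<eta> u = Q u"
      using \<eta>[of u] \<eta>[of "scaleC_L2 \<i> u"] by (simp add: complex_eq_iff inner_L2_def scale cinner_L2_scaleC_right)
  qed
qed

text \<open>The description operator is legitimate here: Riesz yields a vector with these inner
  products, and inner products determine a vector.\<close>

lemma cinner_localization_operator:
  assumes g: "bounded_symbol B g"
    and fg: "\<And>h. h \<in> borel_measurable borel \<Longrightarrow> (LINT z|lebesgue. f z * h z) = (LINT z|lborel. g z * h z)"
  shows "cinner_L2 (localization_operator f \<psi> \<phi> u) v = localization_form g \<psi> \<phi> u v"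
proof -
  have eq: "(LINT z|lebesgue. f z * stft \<psi> u z * cnj (stft \<phi> v z)) = localization_form g \<psi> \<phi> u v" for v
    unfolding localization_form_def mult.assoc by (rule fg) measurable
  have "cmod (localization_form g \<psi> \<phi> u v) \<le> B * ((norm \<psi> * norm u) * norm \<phi>) * norm v" for v
    using localization_form_bound[OF g] by (simp add: mult.assoc)
  then obtain \<eta> where \<eta>: "\<And>v. cinner_L2 \<eta> v = localization_form g \<psi> \<phi> u v"
    using Riesz_representation_L2[of "localization_form g \<psi> \<phi> u", OF localization_form_linear(2)[OF g] localization_form_scaleC(2)]
    by blast
  have "\<forall>v. cinner_L2 (localization_operator f \<psi> \<phi> u) v = localization_form g \<psi> \<phi> u v"
    unfolding localization_operator_def eq
  proof (rule theI)
    show "\<forall>v. cinner_L2 \<eta> v = localization_form g \<psi> \<phi> u v" using \<eta> by blast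
    show "\<zeta> = \<eta>" if "\<forall>v. cinner_L2 \<zeta> v = localization_form g \<psi> \<phi> u v" for \<zeta>
      using that \<eta> by (intro cinner_L2_left_eqI) simp
  qed
  then show ?thesis by blast
qed

section \<open>Compactness through finitely many functionals\<close>

text \<open>This is equivalent to compactness of the associated operator, but visibly stable under
  linear combinations and norm limits.\<close>

abbreviation functionals :: "'a::euclidean_space L2 set \<Rightarrow> 'a L2 \<Rightarrow> real" where
  "functionals F u \<equiv> \<Sum>y\<in>F. cmod (cinner_L2 u y)"

definition compact_form :: "('a::euclidean_space L2 \<Rightarrow> 'b::euclidean_space L2 \<Rightarrow> complex) \<Rightarrow> bool" where
  "compact_form Q \<longleftrightarrow> (\<forall>e>0. \<exists>F C. finite F \<and>
     (\<forall>u v. cmod (Q u v) \<le> (e * norm u + C * functionals F u) * norm v))"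

lemma compact_formI_approx:
  assumes "\<And>e. e > 0 \<Longrightarrow> \<exists>Q'. compact_form Q' \<and> (\<forall>u v. cmod (Q u v - Q' u v) \<le> e * norm u * norm v)"
  shows "compact_form Q"
  unfolding compact_form_def
proof (intro allI impI)
  fix e :: real assume "e > 0"
  then have e2: "e / 2 > 0" by simp
  from assms[OF e2] obtain Q' where Q': "compact_form Q'" "\<And>u v. cmod (Q u v - Q' u v) \<le> e / 2 * norm u * norm v"
    by blast
  from Q'(1) e2 obtain F C where F: "finite F" "\<And>u v. cmod (Q' u v) \<le> (e / 2 * norm u + C * functionals F u) * norm v"
    unfolding compact_form_def by blast
  have "cmod (Q u v) \<le> (e * norm u + C * functionals F u) * norm v" for u v
  proof -
    have "cmod (Q u v) \<le> cmod (Q u v - Q' u v) + cmod (Q' u v)"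
      using norm_triangle_ineq[of "Q u v - Q' u v" "Q' u v"] by simp
    also have "\<dots> \<le> e / 2 * norm u * norm v + (e / 2 * norm u + C * functionals F u) * norm v"
      by (intro add_mono Q' F)
    also have "\<dots> = (e * norm u + C * functionals F u) * norm v"
      by (simp add: algebra_simps)
    finally show ?thesis .
  qed
  with F(1) show "\<exists>F C. finite F \<and> (\<forall>u v. cmod (Q u v) \<le> (e * norm u + C * functionals F u) * norm v)"
    by blast
qed

lemma compact_form_limit:
  assumes Q: "\<And>n. compact_form (Q n)" and a: "a \<longlonglongrightarrow> 0"
    and le: "\<And>n u v. cmod (K u v - Q n u v) \<le> a n * (norm u * norm v)"
  shows "compact_form K"
proof (rule compact_formI_approx)
  fix e :: real assume "e > 0"
  then have "\<forall>\<^sub>F n in sequentially. a n < e" by (rule order_tendstoD(2)[OF a])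
  then obtain n where "a n < e" using eventually_happens'[OF sequentially_bot] by blast
  then have "cmod (K u v - Q n u v) \<le> e * norm u * norm v" for u v
    unfolding mult.assoc by (intro order_trans[OF le] mult_right_mono) auto
  then show "\<exists>Q'. compact_form Q' \<and> (\<forall>u v. cmod (K u v - Q' u v) \<le> e * norm u * norm v)"
    using Q by blast
qed

lemma compact_form_zero: "compact_form (\<lambda>u v. 0)"
  unfolding compact_form_def by (intro allI impI exI[of _ "{}"] exI[of _ 0]) simp

lemma compact_form_add:
  assumes "compact_form Q" "compact_form Q'"
  shows "compact_form (\<lambda>u v. Q u v + Q' u v)"
  unfolding compact_form_def
proof (intro allI impI)
  fix e :: real assume "e > 0"
  then have e2: "e / 2 > 0" by simp
  from assms(1) e2 obtain F C where F: "finite F" "\<And>u v. cmod (Q u v) \<le> (e / 2 * norm u + C * functionals F u) * norm v"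
    unfolding compact_form_def by blast
  from assms(2) e2 obtain F' C' where F': "finite F'" "\<And>u v. cmod (Q' u v) \<le> (e / 2 * norm u + C' * functionals F' u) * norm v"
    unfolding compact_form_def by blast
  \<comment> \<open>\<open>C\<close> and \<open>C'\<close> may be negative; a nonnegative constant
    lets both estimates grow with the set of functionals.\<close>
  define D where "D = max \<bar>C\<bar> \<bar>C'\<bar>"
  have "cmod (Q u v + Q' u v) \<le> (e * norm u + 2 * D * functionals (F \<union> F') u) * norm v" for u v
  proof -
    have S: "C * functionals F u \<le> D * functionals (F \<union> F') u"
      "C' * functionals F' u \<le> D * functionals (F \<union> F') u"
      using F(1) F'(1) by (auto simp: D_def intro!: mult_mono sum_mono2 sum_nonneg)
    have "cmod (Q u v + Q' u v) \<le> (e / 2 * norm u + C * functionals F u) * norm v + (e / 2 * norm u + C' * functionals F' u) * norm v"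
      by (rule order_trans[OF norm_triangle_ineq add_mono[OF F(2) F'(2)]])
    also have "\<dots> = (e * norm u + (C * functionals F u + C' * functionals F' u)) * norm v"
      by (simp add: algebra_simps)
    also have "\<dots> \<le> (e * norm u + 2 * D * functionals (F \<union> F') u) * norm v"
      using S by (intro mult_right_mono) auto
    finally show ?thesis .
  qed
  with F(1) F'(1) show "\<exists>F C. finite F \<and> (\<forall>u v. cmod (Q u v + Q' u v) \<le> (e * norm u + C * functionals F u) * norm v)"
    by (intro exI[of _ "F \<union> F'"] exI[of _ "2 * D"]) simp
qed

lemma compact_form_scale:
  assumes "compact_form Q"
  shows "compact_form (\<lambda>u v. c * Q u v)"
  unfolding compact_form_def
proof (intro allI impI)
  fix e :: real assume "e > 0"
  \<comment> \<open>The added 1 takes care of \<open>c = 0\<close>.\<close>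
  then have e2: "e / (cmod c + 1) > 0" by (simp add: add_nonneg_pos)
  from assms e2 obtain F C where F: "finite F" "\<And>u v. cmod (Q u v) \<le> (e / (cmod c + 1) * norm u + C * functionals F u) * norm v"
    unfolding compact_form_def by blast
  have "cmod (c * Q u v) \<le> (e * norm u + (cmod c * C) * functionals F u) * norm v" for u v
  proof -
    have "cmod (c * Q u v) \<le> cmod c * ((e / (cmod c + 1) * norm u + C * functionals F u) * norm v)"
      unfolding norm_mult by (intro mult_left_mono F) simp
    also have "\<dots> = ((cmod c / (cmod c + 1)) * e * norm u + (cmod c * C) * functionals F u) * norm v"
      by (simp add: algebra_simps)
    also have "\<dots> \<le> (1 * e * norm u + (cmod c * C) * functionals F u) * norm v"
      using \<open>e > 0\<close> by (intro mult_right_mono add_mono mult_right_mono order_refl)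
        (auto simp: divide_le_eq_1 add_nonneg_pos)
    finally show ?thesis by simp
  qed
  with F(1) show "\<exists>F C. finite F \<and> (\<forall>u v. cmod (c * Q u v) \<le> (e * norm u + C * functionals F u) * norm v)"
    by blast
qed

text \<open>Each functional maps \<open>B\<close> to a bounded, hence totally bounded, set of
  complex numbers; the induction refines the resulting cells. Net points are taken in
  \<open>B\<close> itself so that the differences \<open>u - n\<close> stay bounded.\<close>

lemma finite_net_of_functionals:
  fixes B :: "'a::euclidean_space L2 set"
  assumes "finite F" and "bounded B" and d: "d > 0"
  shows "\<exists>N. finite N \<and> N \<subseteq> B \<and> (\<forall>u\<in>B. \<exists>n\<in>N. \<forall>y\<in>F. cmod (cinner_L2 (u - n) y) \<le> d)"
  using assms(1,2)
proof (induction F arbitrary: B rule: finite_induct)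
  case empty
  show ?case
  proof (cases "B = {}")
    case False
    then obtain b where "b \<in> B" by blast
    then show ?thesis by (intro exI[of _ "{b}"]) auto
  qed auto
next
  case (insert y F)
  have "bounded ((\<lambda>u. cinner_L2 u y) ` B)"
    by (rule bounded_linear_image[OF insert.prems cinner_L2.bounded_linear_left])
  then have "compact (closure ((\<lambda>u. cinner_L2 u y) ` B))" by (simp add: compact_closure)
  then obtain K where K: "finite K" "closure ((\<lambda>u. cinner_L2 u y) ` B) \<subseteq> (\<Union>k\<in>K. ball k (d / 2))"
    using d unfolding compact_eq_totally_bounded by (meson half_gt_zero)
  define P where "P k = {u \<in> B. dist k (cinner_L2 u y) < d / 2}" for k
  have "\<exists>N. finite N \<and> N \<subseteq> P k \<and> (\<forall>u\<in>P k. \<exists>n\<in>N. \<forall>y\<in>F. cmod (cinner_L2 (u - n) y) \<le> d)" for k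
    using insert.prems by (intro insert.IH) (auto simp: P_def intro: bounded_subset)
  then obtain N where N: "\<And>k. finite (N k)" "\<And>k. N k \<subseteq> P k"
    "\<And>k u. u \<in> P k \<Longrightarrow> \<exists>n\<in>N k. \<forall>y\<in>F. cmod (cinner_L2 (u - n) y) \<le> d"
    by metis
  have "\<exists>n\<in>\<Union>(N ` K). \<forall>y\<in>insert y F. cmod (cinner_L2 (u - n) y) \<le> d" if u: "u \<in> B" for u
  proof -
    have "cinner_L2 u y \<in> (\<Union>k\<in>K. ball k (d / 2))"
      using K(2) closure_subset[of "(\<lambda>u. cinner_L2 u y) ` B"] u by blast
    then obtain k where k: "k \<in> K" "u \<in> P k" using u by (auto simp: P_def)
    then obtain n where n: "n \<in> N k" "\<forall>y\<in>F. cmod (cinner_L2 (u - n) y) \<le> d" using N(3) by blast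
    then have "dist k (cinner_L2 n y) < d / 2" "dist k (cinner_L2 u y) < d / 2"
      using N(2) k(2) by (auto simp: P_def)
    then have "dist (cinner_L2 u y) (cinner_L2 n y) \<le> d"
      using dist_triangle2[of "cinner_L2 u y" "cinner_L2 n y" k] by (simp add: dist_commute)
    then show ?thesis using k(1) n by (auto simp: dist_norm cinner_L2.diff_left)
  qed
  moreover have "\<Union>(N ` K) \<subseteq> B" using N(2) by (auto simp: P_def)
  ultimately show ?case using K(1) N(1) by (intro exI[of _ "\<Union>(N ` K)"]) auto
qed

text \<open>Testing with \<open>v = T u\<close> turns the estimate of the form into one of
  \<open>norm (T u)\<close>. Points of \<open>B\<close> on which finitely many functionals nearly
  agree then have nearby images.\<close>

lemma compact_form_imp_compact_operator:
  fixes T :: "'a::euclidean_space L2 \<Rightarrow> 'b::euclidean_space L2"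
  assumes add: "\<And>u v. T (u + v) = T u + T v" and scale: "\<And>c u. T (scaleC_L2 c u) = scaleC_L2 c (T u)"
    and Q: "compact_form (\<lambda>u v. cinner_L2 (T u) v)"
  shows "compact_operator T"
  unfolding compact_operator_def
proof (intro conjI allI impI add scale)
  fix B :: "'a L2 set" assume B: "bounded B"
  then obtain R where R: "R > 0" "\<And>u. u \<in> B \<Longrightarrow> norm u \<le> R" unfolding bounded_pos by auto
  have T_diff: "T (u - v) = T u - T v" for u v using add[of "u - v" v] by simp
  have net: "\<exists>N. finite N \<and> T ` B \<subseteq> (\<Union>x\<in>N. ball x e)" if "e > 0" for e
  proof -
    \<comment> \<open>Two elements of \<open>B\<close> are at most \<open>2 * R\<close> apart, so
      this coefficient contributes \<open>e / 4\<close>; the mesh \<open>d\<close> below is chosen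
      so that the functionals contribute another \<open>e / 4\<close>.\<close>
    have "e / (8 * R) > 0" using that R by simp
    then obtain F C where F: "finite F" "\<And>u v. cmod (cinner_L2 (T u) v) \<le> (e / (8 * R) * norm u + C * functionals F u) * norm v"
      using Q unfolding compact_form_def by blast
    have T_le: "norm (T u) \<le> e / (8 * R) * norm u + \<bar>C\<bar> * functionals F u" for u
    proof (cases "norm (T u) = 0")
      case False
      have "norm (T u) * norm (T u) \<le> (e / (8 * R) * norm u + C * functionals F u) * norm (T u)"
        using F(2)[of u "T u"] unfolding cinner_L2_self_norm norm_of_real by (simp add: power2_eq_square)
      then have "norm (T u) \<le> e / (8 * R) * norm u + C * functionals F u" using False by simp
      also have "\<dots> \<le> e / (8 * R) * norm u + \<bar>C\<bar> * functionals F u"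
        by (intro add_left_mono mult_right_mono sum_nonneg) auto
      finally show ?thesis .
    qed (use that R in \<open>simp add: sum_nonneg\<close>)
    define d where "d = e / (4 * (\<bar>C\<bar> * card F + 1))"
    have d: "d > 0" using that by (simp add: d_def add_nonneg_pos)
    obtain N where N: "finite N" "N \<subseteq> B" "\<And>u. u \<in> B \<Longrightarrow> \<exists>n\<in>N. \<forall>y\<in>F. cmod (cinner_L2 (u - n) y) \<le> d"
      using finite_net_of_functionals[OF F(1) B d] by blast
    have "T ` B \<subseteq> (\<Union>x\<in>T ` N. ball x e)"
    proof clarify
      fix u assume u: "u \<in> B"
      obtain n where n: "n \<in> N" "\<And>y. y \<in> F \<Longrightarrow> cmod (cinner_L2 (u - n) y) \<le> d" using N(3)[OF u] by blast
      have "norm (u - n) \<le> 2 * R"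
        using norm_triangle_ineq4[of u n] R(2)[OF u] R(2)[of n] n(1) N(2) by auto
      then have 1: "e / (8 * R) * norm (u - n) \<le> e / 4"
        using mult_left_mono[of "norm (u - n)" "2 * R" "e / (8 * R)"] that R(1) by simp
      have "\<bar>C\<bar> * functionals F (u - n) \<le> \<bar>C\<bar> * (\<Sum>y\<in>F. d)"
        using n(2) by (intro mult_left_mono sum_mono) auto
      also have "\<dots> \<le> (\<bar>C\<bar> * card F + 1) * d" using d by (simp add: algebra_simps)
      also have "\<dots> = e / 4" unfolding d_def by (simp add: field_simps add_nonneg_eq_0_iff)
      finally have "norm (T (u - n)) \<le> e / 4 + e / 4" using T_le[of "u - n"] 1 by linarith
      then have "dist (T n) (T u) < e" using that by (simp add: T_diff dist_norm norm_minus_commute)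
      then show "T u \<in> (\<Union>x\<in>T ` N. ball x e)" using n(1) by auto
    qed
    then show ?thesis using N(1) by blast
  qed
  show "compact (closure (T ` B))"
    unfolding compact_eq_totally_bounded
  proof (intro conjI allI impI)
    show "Topological_Spaces.complete (closure (T ` B))" by (simp add: complete_eq_closed)
    fix e :: real assume e: "e > 0"
    then obtain N where N: "finite N" "T ` B \<subseteq> (\<Union>x\<in>N. ball x (e / 2))" using net[of "e / 2"] by auto
    have "closure (T ` B) \<subseteq> (\<Union>x\<in>N. cball x (e / 2))"
      using N by (intro closure_minimal closed_UN) (force simp: subset_iff intro: less_imp_le)+
    also have "\<dots> \<subseteq> (\<Union>x\<in>N. ball x e)" using e by (force simp: subset_iff)
    finally show "\<exists>N. finite N \<and> closure (T ` B) \<subseteq> (\<Union>x\<in>N. ball x e)" using N(1) by blast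
  qed
qed

section \<open>Covariance and the Berezin transform\<close>

abbreviation conv :: "('a::euclidean_space \<Rightarrow> complex) \<Rightarrow> ('a \<Rightarrow> complex) \<Rightarrow> 'a \<Rightarrow> complex" where
  "conv f h z \<equiv> (LINT w|lborel. f w * h (z - w))"

text \<open>The \<open>h\<close> of the overview, with its windows in the order of
  \<open>localization_form\<close>.\<close>

definition berezin_window :: "'a::euclidean_space L2 \<Rightarrow> 'a L2 \<Rightarrow> 'a \<times> 'a \<Rightarrow> complex" where
  "berezin_window \<psi> \<phi> z = stft gaussian \<phi> z * cnj (stft gaussian \<psi> z)"

lemma cmod_1_mult_cnj: "cmod c = 1 \<Longrightarrow> c * cnj c = 1"
  using complex_norm_square[of c] by simp

text \<open>A shift of the argument is carried by the windows; the two factors pick up opposite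
  phases.\<close>

lemma stft_product_shift_window:
  "stft \<psi> u (z + w) * cnj (stft \<phi> v (z + w)) = stft (tf_shift w \<psi>) u z * cnj (stft (tf_shift w \<phi>) v z)"
proof -
  obtain c where c: "cmod c = 1" "\<And>u. tf_shift (z + w) u = scaleC_L2 c (tf_shift z (tf_shift w u))"
    using tf_shift_plus_phase[of z w] by blast
  have "stft \<psi> u (z + w) * cnj (stft \<phi> v (z + w))
    = (c * cnj c) * (stft (tf_shift w \<psi>) u z * cnj (stft (tf_shift w \<phi>) v z))"
    by (simp add: stft_def c(2) cinner_L2_scaleC_right)
  then show ?thesis by (simp add: cmod_1_mult_cnj[OF c(1)])
qed

text \<open>The same shift carried by \<open>u\<close> and \<open>v\<close> instead: covariance of
  the localization form. Two phases occur, one from composing shifts and one from inverting a shift,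
  and both cancel.\<close>

lemma stft_product_shift:
  "stft \<psi> u (z + w) * cnj (stft \<phi> v (z + w)) = stft \<psi> (tf_shift (- w) u) z * cnj (stft \<phi> (tf_shift (- w) v) z)"
proof -
  obtain c where c: "cmod c = 1" "\<And>u. tf_shift (w + z) u = scaleC_L2 c (tf_shift w (tf_shift z u))"
    using tf_shift_plus_phase[of w z] by blast
  obtain b where b: "cmod b = 1" "\<And>u. tf_shift (w + (- w)) u = scaleC_L2 b (tf_shift w (tf_shift (- w) u))"
    using tf_shift_plus_phase[of w "- w"] by blast
  have inv: "u = scaleC_L2 b (tf_shift w (tf_shift (- w) u))" for u
    using b(2)[of u] by simp
  have s: "stft \<theta> u (z + w) = (b * cnj c) * stft \<theta> (tf_shift (- w) u) z" for \<theta> u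
  proof -
    have "stft \<theta> u (z + w) = cinner_L2 (scaleC_L2 b (tf_shift w (tf_shift (- w) u))) (scaleC_L2 c (tf_shift w (tf_shift z \<theta>)))"
      unfolding inv[symmetric] c(2)[symmetric] stft_def by (simp add: add.commute)
    then show ?thesis by (simp add: cinner_L2_scaleC_left cinner_L2_scaleC_right stft_def)
  qed
  have "stft \<psi> u (z + w) * cnj (stft \<phi> v (z + w))
     = (b * cnj b) * (c * cnj c) * (stft \<psi> (tf_shift (- w) u) z * cnj (stft \<phi> (tf_shift (- w) v) z))"
    unfolding s by simp
  then show ?thesis by (simp only: cmod_1_mult_cnj b(1) c(1) mult_1)
qed

text \<open>Up to a phase common to both windows, the transform of a coherent state at
  \<open>w\<close> is the conjugate of the Gaussian transform of the window at \<open>z - w\<close>;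
  the integrands therefore agree pointwise.\<close>

lemma berezin_transform:
  "localization_form g \<psi> \<phi> (coherent z) (coherent z) = conv g (berezin_window \<psi> \<phi>) z"
  unfolding localization_form_def
proof (rule Bochner_Integration.integral_cong)
  fix w
  obtain c where c: "cmod c = 1" "\<And>u. tf_shift (w + (z - w)) u = scaleC_L2 c (tf_shift w (tf_shift (z - w) u))"
    using tf_shift_plus_phase[of w "z - w"] by blast
  have s: "stft \<theta> (coherent z) w = c * cnj (stft gaussian \<theta> (z - w))" for \<theta>
  proof -
    have "stft \<theta> (coherent z) w = cinner_L2 (scaleC_L2 c (tf_shift w (coherent (z - w)))) (tf_shift w \<theta>)"
      unfolding c(2)[symmetric] by (simp add: stft_def)
    also have "\<dots> = c * cinner_L2 (coherent (z - w)) \<theta>"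
      by (simp add: cinner_L2_scaleC_left)
    finally show ?thesis unfolding stft_def by (simp only: cinner_L2_commute[of "coherent (z - w)"])
  qed
  have "g w * stft \<psi> (coherent z) w * cnj (stft \<phi> (coherent z) w) = (c * cnj c) * (g w * berezin_window \<psi> \<phi> (z - w))"
    unfolding s berezin_window_def by simp
  then show "g w * stft \<psi> (coherent z) w * cnj (stft \<phi> (coherent z) w) = g w * berezin_window \<psi> \<phi> (z - w)"
    by (simp only: cmod_1_mult_cnj c(1) mult_1)
qed simp

lemma berezin_window_integrable: "integrable lborel (berezin_window \<psi> \<phi>)"
  unfolding berezin_window_def[abs_def]
  by (intro integrable_square_integrable_mult_cnj square_integrable_stft)

lemma berezin_window_bounded: "bounded_symbol (norm \<phi> * norm \<psi>) (berezin_window \<psi> \<phi>)"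
  unfolding bounded_symbol_def
proof (intro conjI allI)
  show "berezin_window \<psi> \<phi> \<in> borel_measurable borel"
    unfolding berezin_window_def[abs_def] by measurable
  show "cmod (berezin_window \<psi> \<phi> z) \<le> norm \<phi> * norm \<psi>" for z
    unfolding berezin_window_def norm_mult complex_mod_cnj
    using norm_stft_le[of gaussian \<phi> z] norm_stft_le[of gaussian \<psi> z] by (intro mult_mono) auto
qed

lemma conv_reflect:
  fixes f h :: "'a::euclidean_space \<Rightarrow> complex"
  assumes [measurable]: "f \<in> borel_measurable borel" "h \<in> borel_measurable borel"
  shows "conv f h z = (LINT w|lborel. f (z - w) * h w)"
  using lborel_integral_reflect(1)[of "\<lambda>w. f (z - w) * h w" z] by simp

lemma
  fixes f h :: "'a::euclidean_space \<Rightarrow> complex"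
  assumes f: "bounded_symbol B f" and h: "integrable lborel h"
  shows integrable_conv_kernel: "integrable lborel (\<lambda>w. f w * h (z - w))"
    and bounded_symbol_conv: "bounded_symbol (B * (LINT w|lborel. cmod (h w))) (conv f h)"
proof -
  have [measurable]: "f \<in> borel_measurable borel" "h \<in> borel_measurable borel"
    using f h by (auto simp: bounded_symbol_def)
  have B: "integrable lborel (\<lambda>w. B * cmod (h (z - w)))" for z
    using lborel_integral_reflect(2)[of h z] h by simp
  have le: "cmod (f w * h (z - w)) \<le> B * cmod (h (z - w))" for z w
    by (simp add: bounded_symbolD[OF f] norm_mult mult_right_mono)
  show "integrable lborel (\<lambda>w. f w * h (z - w))"
    by (rule integral_dominated(1)[OF B _ le]) measurable
  have "cmod (conv f h z) \<le> B * (LINT w|lborel. cmod (h w))" for z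
  proof -
    have "cmod (conv f h z) \<le> (LINT w|lborel. B * cmod (h (z - w)))"
      by (rule integral_dominated(2)[OF B _ le]) measurable
    also have "\<dots> = B * (LINT w|lborel. cmod (h w))"
      using lborel_integral_reflect(1)[of "\<lambda>w. cmod (h w)" z] by simp
    finally show ?thesis .
  qed
  moreover have "conv f h \<in> borel_measurable borel" by measurable
  ultimately show "bounded_symbol (B * (LINT w|lborel. cmod (h w))) (conv f h)"
    unfolding bounded_symbol_def by blast
qed

text \<open>Fubini and a translation in \<open>z\<close>. Joint integrability is a hypothesis
  because either factor of the convolution may be the bounded one.\<close>

lemma localization_form_conv_kernel:
  assumes meas: "f \<in> borel_measurable borel" "h \<in> borel_measurable borel"
    and int: "integrable (lborel \<Otimes>\<^sub>M lborel) (\<lambda>(z, w). (stft \<psi> u z * cnj (stft \<phi> v z)) * (f w * h (z - w)))"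
  shows "localization_form (conv f h) \<psi> \<phi> u v
    = (LINT w|lborel. f w * (LINT z|lborel. h z * (stft \<psi> u (z + w) * cnj (stft \<phi> v (z + w)))))"
proof -
  note [measurable] = meas
  define P where "P z = stft \<psi> u z * cnj (stft \<phi> v z)" for z
  have [measurable]: "P \<in> borel_measurable borel" unfolding P_def by measurable
  have "localization_form (conv f h) \<psi> \<phi> u v = (LINT z|lborel. (LINT w|lborel. P z * (f w * h (z - w))))"
    unfolding integral_mult_right_zero localization_form_def P_def by (simp only: mult_ac)
  also have "\<dots> = (LINT w|lborel. (LINT z|lborel. P z * (f w * h (z - w))))"
    by (rule lborel_pair.Fubini_integral[OF int[folded P_def], symmetric])
  also have "\<dots> = (LINT w|lborel. f w * (LINT z|lborel. h z * P (z + w)))"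
  proof (rule Bochner_Integration.integral_cong)
    fix w
    have "(LINT z|lborel. P z * (f w * h (z - w))) = (LINT z|lborel. P (z + w) * (f w * h ((z + w) - w)))"
      by (rule lborel_integral_shift(1)[symmetric]) measurable
    then show "(LINT z|lborel. P z * (f w * h (z - w))) = f w * (LINT z|lborel. h z * P (z + w))"
      unfolding integral_mult_right_zero[symmetric] add_diff_cancel_right' by (simp only: mult_ac)
  qed simp
  finally show ?thesis unfolding P_def .
qed

text \<open>The form with symbol \<open>conv f h\<close> is an average of shifted copies of the form
  with symbol \<open>h\<close>, so an identity between forms passes to all smoothed symbols at
  once.\<close>

lemma localization_form_conv:
  assumes f: "bounded_symbol B f" and h: "integrable lborel h"
  shows "localization_form (conv f h) \<psi> \<phi> u v
    = (LINT w|lborel. f w * localization_form h \<psi> \<phi> (tf_shift (- w) u) (tf_shift (- w) v))"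
proof -
  have [measurable]: "f \<in> borel_measurable borel" "h \<in> borel_measurable borel"
    using f h by (auto simp: bounded_symbol_def)
  have "integrable (lborel \<Otimes>\<^sub>M lborel) (\<lambda>(z, w). (stft \<psi> u z * cnj (stft \<phi> v z)) * (f w * h (z - w)))"
  proof (rule lborel_Fubini_dominated(1)[where T="\<lambda>z. z" and G="\<lambda>y. B * cmod (h (- y))", OF _ _ stft_mult_stft(1)])
    show "integrable lborel (\<lambda>y. B * cmod (h (- y)))"
      using lborel_integral_reflect(2)[of h 0] h by simp
    show "cmod ((stft \<psi> u z * cnj (stft \<phi> v z)) * (f w * h (z - w))) \<le> (cmod (stft \<psi> u z) * cmod (stft \<phi> v z)) * (B * cmod (h (- (w - z))))" for z w
      by (simp add: bounded_symbolD[OF f] norm_mult mult_left_mono mult_right_mono)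
  qed measurable
  from localization_form_conv_kernel[OF _ _ this] show ?thesis
    by (simp add: stft_product_shift localization_form_def mult.assoc)
qed

section \<open>The identity for four Gaussian transforms\<close>

lemma gaussian_linear_integrable:
  fixes p :: "'a::euclidean_space"
  assumes a: "a > 0"
  shows "integrable lborel (\<lambda>x. exp (- a * (norm x)\<^sup>2 + p \<bullet> x))"
proof -
  have "exp (- a * (norm (x + (1 / (2 * a)) *\<^sub>R p))\<^sup>2 + p \<bullet> (x + (1 / (2 * a)) *\<^sub>R p)) = exp ((norm p)\<^sup>2 / (4 * a)) * exp (- a * (norm x)\<^sup>2)" for x
  proof -
    have "- a * (norm (x + (1 / (2 * a)) *\<^sub>R p))\<^sup>2 + p \<bullet> (x + (1 / (2 * a)) *\<^sub>R p) = (norm p)\<^sup>2 / (4 * a) + - a * (norm x)\<^sup>2"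
      using a unfolding power2_norm_eq_inner by (simp add: inner_simps inner_commute[of x p] field_simps)
    then show ?thesis by (simp only: exp_add)
  qed
  moreover have "integrable lborel (\<lambda>x::'a. exp ((norm p)\<^sup>2 / (4 * a)) * exp (- a * (norm x)\<^sup>2))"
    by (intro integrable_mult_right gaussian_fourier(1)[OF a])
  ultimately have "integrable lborel (\<lambda>x. exp (- a * (norm (x + (1 / (2 * a)) *\<^sub>R p))\<^sup>2 + p \<bullet> (x + (1 / (2 * a)) *\<^sub>R p)))"
    by (simp only:)
  then show ?thesis
    using lborel_integral_shift(2)[of "\<lambda>x. exp (- a * (norm x)\<^sup>2 + p \<bullet> x)" "(1 / (2 * a)) *\<^sub>R p"] by simp
qed

lemma phase_space_gaussian_integral:
  fixes p q r s :: "'a::euclidean_space"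
  shows "(LINT z|lborel. gaussian_wave p q (fst z) * gaussian_wave r s (snd z))
    = of_real ((sqrt (1 / 2) ^ DIM('a))\<^sup>2) * exp (of_real (pi / 8 * (p \<bullet> p - q \<bullet> q + r \<bullet> r - s \<bullet> s)) + \<i> * of_real (pi / 4 * (p \<bullet> q + r \<bullet> s)))"
proof -
  let ?G = gaussian_wave
  have int: "integrable (lborel \<Otimes>\<^sub>M lborel) (\<lambda>(x, y). ?G p q x * ?G r s y)"
  proof (rule lborel_Fubini_dominated(1)[where T="\<lambda>_. 0" and F="\<lambda>x. exp (- (2 * pi) * (norm x)\<^sup>2 + (pi *\<^sub>R p) \<bullet> x)" and G="\<lambda>x. exp (- (2 * pi) * (norm x)\<^sup>2 + (pi *\<^sub>R r) \<bullet> x)"])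
    show "integrable lborel (\<lambda>x. exp (- (2 * pi) * (norm x)\<^sup>2 + (pi *\<^sub>R p) \<bullet> x))" for p :: 'a
      by (rule gaussian_linear_integrable) simp
    then show "integrable lborel (\<lambda>x. exp (- (2 * pi) * (norm x)\<^sup>2 + (pi *\<^sub>R r) \<bullet> x))" .
    show "cmod (?G p q x * ?G r s y) \<le> exp (- (2 * pi) * (norm x)\<^sup>2 + (pi *\<^sub>R p) \<bullet> x) * exp (- (2 * pi) * (norm (y - 0))\<^sup>2 + (pi *\<^sub>R r) \<bullet> (y - 0))" for x y
      by (simp add: gaussian_wave_def norm_mult norm_exp_eq_Re)
  qed measurable
  have "(LINT z|lborel. ?G p q (fst z) * ?G r s (snd z)) = (LINT z|(lborel \<Otimes>\<^sub>M lborel). (case z of (x, y) \<Rightarrow> ?G p q x * ?G r s y))"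
    by (simp only: lborel_prod split_beta)
  also have "\<dots> = (LINT x|lborel. (LINT y|lborel. ?G p q x * ?G r s y))"
    using lborel_pair.integral_fst'[OF int] by simp
  also have "\<dots> = (LINT x|lborel. ?G p q x) * (LINT y|lborel. ?G r s y)"
    by (simp only: integral_mult_right_zero integral_mult_left_zero)
  also have "\<dots> = of_real ((sqrt (1 / 2) ^ DIM('a))\<^sup>2) *
     exp (of_real (pi / 8 * (p \<bullet> p - q \<bullet> q) + pi / 8 * (r \<bullet> r - s \<bullet> s)) + \<i> * of_real (pi / 4 * (p \<bullet> q) + pi / 4 * (r \<bullet> s)))"
    unfolding gaussian_wave_integral power2_eq_square of_real_mult of_real_add ring_distribs exp_add by (simp only: mult_ac)
  finally show ?thesis by (simp only: distrib_left[symmetric] add_diff_eq)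
qed

lemma stft_coherent:
  "stft (coherent (y, \<eta>)) (coherent (a, \<alpha>)) (x, \<omega>) =
    exp (of_real (- (pi / 2) * ((norm (a - (x + y)))\<^sup>2 + (norm (\<alpha> - (\<omega> + \<eta>)))\<^sup>2))
      + \<i> * of_real (pi * ((\<alpha> - (\<omega> + \<eta>)) \<bullet> (a + (x + y))) + 2 * pi * (\<eta> \<bullet> x)))"
proof -
  have "stft (coherent (y, \<eta>)) (coherent (a, \<alpha>)) (x, \<omega>) = phase (\<eta> \<bullet> x) * cinner_L2 (coherent (a, \<alpha>)) (coherent (x + y, \<omega> + \<eta>))"
    by (simp add: stft_def tf_shift_tf_shift cinner_L2_scaleC_right exp_cnj)
  then show ?thesis
    unfolding cinner_coherent exp_add[symmetric]
    by (simp only:) (rule arg_cong[where f=exp], simp add: complex_eq_iff)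
qed

text \<open>Both sides are phase space integrals of Gaussian waves with different linear terms.
  After integration the exponents coincide as polynomials in the eight components of the four
  points.\<close>

lemma stft_four_coherent:
  fixes a b c e :: "'a::euclidean_space \<times> 'a"
  shows "localization_form (berezin_window (coherent c) (coherent b)) gaussian gaussian (coherent a) (coherent e)
    = localization_form (\<lambda>z. of_real (exp (- pi * (norm z)\<^sup>2))) (coherent c) (coherent b) (coherent a) (coherent e)"
proof -
  obtain a1 a2 where a: "a = (a1, a2)" by (cases a)
  obtain b1 b2 where b: "b = (b1, b2)" by (cases b)
  obtain c1 c2 where c: "c = (c1, c2)" by (cases c)
  obtain e1 e2 where e: "e = (e1, e2)" by (cases e)
  define K where "K = complex_of_real ((sqrt (1 / 2) ^ DIM('a))\<^sup>2)"
  have cnj_exp: "cnj (exp (of_real R + \<i> * of_real S)) = exp (of_real R + \<i> * of_real (- S))" for R S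
    by (simp add: exp_cnj)
  have mult_exp: "exp (of_real R + \<i> * of_real S) * exp (of_real R' + \<i> * of_real S') = exp (of_real (R + R') + \<i> * of_real (S + S'))" for R R' S S'
    unfolding exp_add[symmetric] by (rule arg_cong[where f=exp]) (simp add: complex_eq_iff)
  have "tf_shift (0, 0) gaussian = (gaussian :: 'a L2)" by (simp flip: zero_prod_def)
  note stft_gaussian = stft_coherent[of "0 :: 'a" 0, unfolded this]
  \<comment> \<open>These are the linear coefficients of the left integrand, the primed ones those
    of the right; \<open>k\<close>, \<open>l\<close> and \<open>k'\<close>, \<open>l'\<close>
    collect what is independent of \<open>z\<close> in modulus and phase.\<close>
  let ?p = "a1 + b1 + c1 + e1" and ?q = "a2 + b2 - c2 - e2" and ?r = "a2 + b2 + c2 + e2" and ?s = "c1 + e1 - a1 - b1"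
  let ?p' = "a1 - c1 + e1 - b1" and ?q' = "a2 + c2 - b2 - e2" and ?r' = "a2 - c2 + e2 - b2" and ?s' = "e1 + b1 - a1 - c1"
  define k where "k = - (pi / 2) * (a1 \<bullet> a1 + a2 \<bullet> a2 + b1 \<bullet> b1 + b2 \<bullet> b2 + c1 \<bullet> c1 + c2 \<bullet> c2 + e1 \<bullet> e1 + e2 \<bullet> e2)"
  define l where "l = pi * (b2 \<bullet> b1 - c2 \<bullet> c1 + a2 \<bullet> a1 - e2 \<bullet> e1)"
  define k' where "k' = - (pi / 2) * ((a1 - c1) \<bullet> (a1 - c1) + (a2 - c2) \<bullet> (a2 - c2) + (e1 - b1) \<bullet> (e1 - b1) + (e2 - b2) \<bullet> (e2 - b2))"
  define l' where "l' = pi * ((a2 - c2) \<bullet> (a1 + c1) - (e2 - b2) \<bullet> (e1 + b1))"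
  have "localization_form (berezin_window (coherent c) (coherent b)) gaussian gaussian (coherent a) (coherent e)
     = (LINT z|lborel. exp (of_real k + \<i> * of_real l) * (gaussian_wave ?p ?q (fst z) * gaussian_wave ?r ?s (snd z)))"
    unfolding localization_form_def
  proof (rule Bochner_Integration.integral_cong)
    fix z :: "'a \<times> 'a"
    obtain x w where z: "z = (x, w)" by (cases z)
    show "berezin_window (coherent c) (coherent b) z * stft gaussian (coherent a) z * cnj (stft gaussian (coherent e) z)
      = exp (of_real k + \<i> * of_real l) * (gaussian_wave ?p ?q (fst z) * gaussian_wave ?r ?s (snd z))"
      unfolding berezin_window_def a b c e z stft_gaussian cnj_exp mult_exp gaussian_wave_def fst_conv snd_conv
      by (rule arg_cong2[where f="\<lambda>R S. exp (complex_of_real R + \<i> * complex_of_real S)"]; unfold k_def l_def power2_norm_eq_inner; simp add: inner_commute algebra_simps)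
  qed simp
  also have "\<dots> = exp (of_real k + \<i> * of_real l) * (K * exp (of_real (pi / 8 * (?p \<bullet> ?p - ?q \<bullet> ?q + ?r \<bullet> ?r - ?s \<bullet> ?s)) + \<i> * of_real (pi / 4 * (?p \<bullet> ?q + ?r \<bullet> ?s))))"
    unfolding integral_mult_right_zero phase_space_gaussian_integral K_def ..
  also have "\<dots> = K * exp (of_real (k + pi / 8 * (?p \<bullet> ?p - ?q \<bullet> ?q + ?r \<bullet> ?r - ?s \<bullet> ?s)) + \<i> * of_real (l + pi / 4 * (?p \<bullet> ?q + ?r \<bullet> ?s)))"
    unfolding mult_exp[symmetric] by (simp only: mult_ac)
  also have "k + pi / 8 * (?p \<bullet> ?p - ?q \<bullet> ?q + ?r \<bullet> ?r - ?s \<bullet> ?s) = k' + pi / 8 * (?p' \<bullet> ?p' - ?q' \<bullet> ?q' + ?r' \<bullet> ?r' - ?s' \<bullet> ?s')"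
    unfolding k_def k'_def by (simp add: inner_commute algebra_simps)
  also have "l + pi / 4 * (?p \<bullet> ?q + ?r \<bullet> ?s) = l' + pi / 4 * (?p' \<bullet> ?q' + ?r' \<bullet> ?s')"
    unfolding l_def l'_def by (simp add: inner_commute algebra_simps)
  also have "K * exp (of_real (k' + pi / 8 * (?p' \<bullet> ?p' - ?q' \<bullet> ?q' + ?r' \<bullet> ?r' - ?s' \<bullet> ?s')) + \<i> * of_real (l' + pi / 4 * (?p' \<bullet> ?q' + ?r' \<bullet> ?s')))
    = exp (of_real k' + \<i> * of_real l') * (K * exp (of_real (pi / 8 * (?p' \<bullet> ?p' - ?q' \<bullet> ?q' + ?r' \<bullet> ?r' - ?s' \<bullet> ?s')) + \<i> * of_real (pi / 4 * (?p' \<bullet> ?q' + ?r' \<bullet> ?s'))))"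
    unfolding mult_exp[symmetric] by (simp only: mult_ac)
  also have "\<dots> = (LINT z|lborel. exp (of_real k' + \<i> * of_real l') * (gaussian_wave ?p' ?q' (fst z) * gaussian_wave ?r' ?s' (snd z)))"
    unfolding integral_mult_right_zero phase_space_gaussian_integral K_def ..
  also have "\<dots> = localization_form (\<lambda>z. of_real (exp (- pi * (norm z)\<^sup>2))) (coherent c) (coherent b) (coherent a) (coherent e)"
    unfolding localization_form_def
  proof (rule Bochner_Integration.integral_cong)
    fix z :: "'a \<times> 'a"
    obtain x w where z: "z = (x, w)" by (cases z)
    have ez: "complex_of_real (exp (- pi * (norm z)\<^sup>2)) = exp (of_real (- pi * (x \<bullet> x + w \<bullet> w)) + \<i> * of_real 0)"
      unfolding z power2_norm_eq_inner exp_of_real[symmetric] by simp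
    show "exp (of_real k' + \<i> * of_real l') * (gaussian_wave ?p' ?q' (fst z) * gaussian_wave ?r' ?s' (snd z))
      = of_real (exp (- pi * (norm z)\<^sup>2)) * stft (coherent c) (coherent a) z * cnj (stft (coherent b) (coherent e) z)"
      unfolding ez unfolding a b c e z stft_coherent cnj_exp mult_exp gaussian_wave_def fst_conv snd_conv
      by (rule arg_cong2[where f="\<lambda>R S. exp (complex_of_real R + \<i> * complex_of_real S)"]; unfold k'_def l'_def power2_norm_eq_inner; simp add: inner_commute algebra_simps)
  qed simp
  finally show ?thesis .
qed

text \<open>Homogeneity is asked only as preservation of zeros, so that linear and conjugate-linear
  dependence are covered alike.\<close>

lemma bounded_additive_zero:
  fixes D :: "'a::euclidean_space L2 \<Rightarrow> complex"
  assumes add: "\<And>u v. D (u + v) = D u + D v" and scale: "\<And>c u. D u = 0 \<Longrightarrow> D (scaleC_L2 c u) = 0"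
    and bd: "\<And>u. cmod (D u) \<le> K * norm u" and zero: "\<And>z. D (coherent z) = 0"
  shows "D u = 0"
proof -
  have diff: "D (u - v) = D u - D v" for u v using add[of "u - v" v] by simp
  have "K-lipschitz_on UNIV D"
  proof (rule lipschitz_onI)
    show "dist (D u) (D v) \<le> K * dist u v" for u v
      using bd[of "u - v"] by (simp add: dist_norm diff)
    show "0 \<le> K"
      using order_trans[OF norm_ge_zero bd[of gaussian]] by simp
  qed
  then have "closed {u. D u = 0}"
    by (intro closed_Collect_eq lipschitz_on_continuous_on continuous_on_const)
  then have "u \<in> {u. D u = 0}"
    by (rule coherent_dense) (auto simp: add scale zero)
  then show ?thesis by simp
qed

lemma berezin_window_add: "berezin_window (\<theta> + \<theta>') \<xi> z = berezin_window \<theta> \<xi> z + berezin_window \<theta>' \<xi> z"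
  "berezin_window \<theta> (\<xi> + \<xi>') z = berezin_window \<theta> \<xi> z + berezin_window \<theta> \<xi>' z"
  by (simp_all add: berezin_window_def stft_add ring_distribs)

lemma berezin_window_scaleC: "berezin_window (scaleC_L2 c \<theta>) \<xi> z = cnj c * berezin_window \<theta> \<xi> z"
  "berezin_window \<theta> (scaleC_L2 c \<xi>) z = c * berezin_window \<theta> \<xi> z"
  by (simp_all add: berezin_window_def stft_scaleC)

text \<open>The difference \<open>D\<close> of the two sides is additive and bounded in each vector
  separately. It is extended from coherent states to all vectors one place at a time:
  \<open>v\<close>, \<open>u\<close>, \<phi>, \<psi>.\<close>

lemma stft_four:
  "localization_form (berezin_window \<psi> \<phi>) gaussian gaussian u v
    = localization_form (\<lambda>z. of_real (exp (- pi * (norm z)\<^sup>2))) \<psi> \<phi> u v"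
proof -
  define E where "E z = complex_of_real (exp (- pi * (norm (z :: 'a \<times> 'a))\<^sup>2))" for z
  have E: "bounded_symbol 1 E" unfolding E_def bounded_symbol_def by (auto simp: norm_mult)
  define D where "D \<psi> \<phi> u v = localization_form (berezin_window \<psi> \<phi>) gaussian gaussian u v - localization_form E \<psi> \<phi> u v" for \<psi> \<phi> u v
  have bd: "cmod (D \<psi> \<phi> u v) \<le> 2 * (norm \<psi> * norm \<phi> * norm u * norm v)" for \<psi> \<phi> u v
  proof -
    have "cmod (D \<psi> \<phi> u v) \<le> cmod (localization_form (berezin_window \<psi> \<phi>) gaussian gaussian u v) + cmod (localization_form E \<psi> \<phi> u v)"
      unfolding D_def by (rule norm_triangle_ineq4)
    also have "\<dots> \<le> norm \<phi> * norm \<psi> * (norm (gaussian :: 'a L2) * norm u * (norm (gaussian :: 'a L2) * norm v)) + 1 * (norm \<psi> * norm u * (norm \<phi> * norm v))"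
      by (intro add_mono localization_form_bound berezin_window_bounded E)
    finally show ?thesis by (simp add: mult_ac)
  qed
  note lin = localization_form_linear[OF E] localization_form_linear[OF berezin_window_bounded]
    localization_form_scaleC localization_form_symbol_add[OF berezin_window_bounded berezin_window_bounded]
    localization_form_symbol_scale berezin_window_add berezin_window_scaleC
  have 1: "D (coherent c) (coherent b) (coherent a) (coherent e) = 0" for a b c e
    unfolding D_def E_def using stft_four_coherent[of c b a e] by simp
  have bw: "berezin_window (\<theta> + \<theta>') \<xi> = (\<lambda>z. berezin_window \<theta> \<xi> z + berezin_window \<theta>' \<xi> z)"
    "berezin_window \<theta> (\<xi> + \<xi>') = (\<lambda>z. berezin_window \<theta> \<xi> z + berezin_window \<theta> \<xi>' z)"
    "berezin_window (scaleC_L2 k \<theta>) \<xi> = (\<lambda>z. cnj k * berezin_window \<theta> \<xi> z)"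
    "berezin_window \<theta> (scaleC_L2 k \<xi>) = (\<lambda>z. k * berezin_window \<theta> \<xi> z)" for \<theta> \<theta>' \<xi> \<xi>' :: "'a L2" and k
    by (simp_all add: fun_eq_iff berezin_window_add berezin_window_scaleC)
  have 2: "D (coherent c) (coherent b) (coherent a) v = 0" for a b c v
    by (rule bounded_additive_zero[of "D (coherent c) (coherent b) (coherent a)" "2 * (norm (coherent c) * norm (coherent b) * norm (coherent a))"])
       (use bd[of "coherent c" "coherent b" "coherent a"] 1 in \<open>auto simp: D_def lin ring_distribs mult_ac right_diff_distrib[symmetric]\<close>)
  have 3: "D (coherent c) (coherent b) u v = 0" for b c u v
    by (rule bounded_additive_zero[of "\<lambda>u. D (coherent c) (coherent b) u v" "2 * (norm (coherent c) * norm (coherent b) * norm v)"])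
       (use bd[of "coherent c" "coherent b" _ v] 2 in \<open>auto simp: D_def lin ring_distribs mult_ac right_diff_distrib[symmetric]\<close>)
  have 4: "D (coherent c) \<phi> u v = 0" for c \<phi> u v
    by (rule bounded_additive_zero[of "\<lambda>\<phi>. D (coherent c) \<phi> u v" "2 * (norm (coherent c) * norm u * norm v)"])
       (use bd[of "coherent c" _ u v] 3 in \<open>auto simp: D_def bw lin ring_distribs mult_ac right_diff_distrib[symmetric]\<close>)
  have 5: "D \<psi> \<phi> u v = 0"
    by (rule bounded_additive_zero[of "\<lambda>\<psi>. D \<psi> \<phi> u v" "2 * (norm \<phi> * norm u * norm v)"])
       (use bd[of _ \<phi> u v] 4 in \<open>auto simp: D_def bw lin ring_distribs mult_ac right_diff_distrib[symmetric]\<close>)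
  then show ?thesis unfolding D_def E_def by simp
qed

text \<open>By covariance both sides average, with the same weight \<open>f\<close>, forms that
  \<open>stft_four\<close> identifies.\<close>

lemma localization_form_conv_gaussian:
  assumes f: "bounded_symbol B f"
  shows "localization_form (conv f (\<lambda>z. of_real (exp (- pi * (norm z)\<^sup>2)))) \<psi> \<phi> u v
    = localization_form (conv f (berezin_window \<psi> \<phi>)) gaussian gaussian u v"
proof -
  have "integrable lborel (\<lambda>z :: 'a \<times> 'a. complex_of_real (exp (- pi * (norm z)\<^sup>2)))"
    by (intro integrable_of_real gaussian_fourier(1)) simp
  from localization_form_conv[OF f this] localization_form_conv[OF f berezin_window_integrable]
  show ?thesis by (simp only: stft_four)
qed

section \<open>Compactness from and to vanishing at infinity\<close>

text \<open>The coherent states over a ball form a norm-compact set. A finite net of them supplies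
  the functionals that control the Gaussian transform of \<open>u\<close> on the whole
  support.\<close>

lemma compact_form_compactly_supported:
  fixes g :: "'a::euclidean_space \<times> 'a \<Rightarrow> complex"
  assumes g: "bounded_symbol B g" and supp: "\<And>z. norm z > R \<Longrightarrow> g z = 0"
  shows "compact_form (localization_form g gaussian gaussian)"
  unfolding compact_form_def
proof (intro allI impI)
  fix e :: real assume e: "e > 0"
  let ?K = "cball (0 :: 'a \<times> 'a) R"
  define V where "V = measure lborel ?K"
  have B: "0 \<le> B" "\<And>z. cmod (g z) \<le> B" using g bounded_symbol_nonneg[OF g] by (auto simp: bounded_symbol_def)
  have V: "0 \<le> V" by (simp add: V_def)
  \<comment> \<open>Integration over the ball multiplies the mesh by at most \<open>B * V\<close>,
    and \<open>B * V * d \<le> e\<close>.\<close>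
  define d where "d = e / (B * V + 1)"
  have BV: "0 \<le> B * V" using B V by simp
  have d: "d > 0" using e BV by (simp add: d_def add_nonneg_pos)
  have "compact (coherent ` ?K)"
    by (intro compact_continuous_image continuous_on_subset[OF continuous_coherent]) auto
  then obtain F where F: "finite F" "coherent ` ?K \<subseteq> (\<Union>y\<in>F. ball y d)"
    using d unfolding compact_eq_totally_bounded by blast
  have bound: "cmod (localization_form g gaussian gaussian u v) \<le> (e * norm u + B * V * functionals F u) * norm v" for u v
  proof -
    define S where "S = d * norm u + functionals F u"
    have S0: "0 \<le> S" using d by (simp add: S_def sum_nonneg)
    have stft_le: "cmod (stft gaussian u z) \<le> S" if "z \<in> ?K" for z
    proof -
      have "coherent z \<in> (\<Union>y\<in>F. ball y d)" using F(2) that by blast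
      then obtain y where y: "y \<in> F" "dist y (coherent z) < d" by auto
      have "cmod (stft gaussian u z) \<le> cmod (cinner_L2 u (coherent z - y)) + cmod (cinner_L2 u y)"
        using norm_triangle_ineq[of "cinner_L2 u (coherent z - y)" "cinner_L2 u y"]
        by (simp add: stft_def cinner_L2.diff_right)
      also have "cmod (cinner_L2 u (coherent z - y)) \<le> norm u * d"
        using y(2) by (intro order_trans[OF cinner_L2_Cauchy_Schwarz] mult_left_mono)
          (auto simp: dist_norm norm_minus_commute)
      also have "cmod (cinner_L2 u y) \<le> functionals F u"
        using F(1) y(1) by (intro member_le_sum) auto
      finally show ?thesis by (simp add: S_def mult.commute)
    qed
    have int: "integrable lborel (\<lambda>z. indicator ?K z * (B * S * norm v))"
      by (intro integrable_mult_left integrable_real_indicator emeasure_bounded_finite) auto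
    have "cmod (localization_form g gaussian gaussian u v) \<le> (LINT z|lborel. indicator ?K z * (B * S * norm v))"
      unfolding localization_form_def
    proof (rule Bochner_Integration.integral_norm_bound_integral[OF localization_form_integrable[OF g] int])
      fix z
      show "cmod (g z * stft gaussian u z * cnj (stft gaussian v z)) \<le> indicator ?K z * (B * S * norm v)"
      proof (cases "z \<in> ?K")
        case True
        have "cmod (stft gaussian v z) \<le> norm v" using norm_stft_le[of gaussian v z] by simp
        then have "cmod (g z * stft gaussian u z * cnj (stft gaussian v z)) \<le> B * S * norm v"
          unfolding norm_mult complex_mod_cnj
          by (intro mult_mono B(2) stft_le[OF True] mult_nonneg_nonneg B(1) S0 norm_ge_zero)
        then show ?thesis using True by simp
      qed (use supp[of z] in \<open>simp add: dist_norm\<close>)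
    qed
    also have "\<dots> = V * (B * S * norm v)"
      by (simp add: V_def)
    also have "\<dots> = (B * V * d * norm u + B * V * functionals F u) * norm v"
      by (simp add: S_def algebra_simps)
    also have "\<dots> \<le> (e * norm u + B * V * functionals F u) * norm v"
    proof -
      have "B * V * d \<le> (B * V + 1) * d" using d by simp
      also have "\<dots> = e" using BV by (simp add: d_def)
      finally show ?thesis by (intro mult_right_mono add_mono order_refl norm_ge_zero)
    qed
    finally show ?thesis .
  qed
  with F(1) show "\<exists>F C. finite F \<and> (\<forall>u v. cmod (localization_form g gaussian gaussian u v) \<le> (e * norm u + C * functionals F u) * norm v)"
    by blast
qed

text \<open>Cutting the symbol off at a large radius leaves a remainder bounded by \<open>e\<close>,
  whose form has norm at most \<open>e\<close>.\<close>

lemma compact_form_vanishing: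
  fixes g :: "'a::euclidean_space \<times> 'a \<Rightarrow> complex"
  assumes g: "bounded_symbol B g" and lim: "(g \<longlongrightarrow> 0) at_infinity"
  shows "compact_form (localization_form g gaussian gaussian)"
proof (rule compact_formI_approx)
  fix e :: real assume e: "e > 0"
  then have "\<forall>\<^sub>F z in at_infinity. dist (g z) 0 < e" by (rule tendstoD[OF lim])
  then obtain R where R: "\<And>z. norm z \<ge> R \<Longrightarrow> cmod (g z) < e"
    unfolding eventually_at_infinity dist_norm diff_0_right by blast
  define g1 where "g1 z = (if norm z \<le> R then g z else 0)" for z
  define g2 where "g2 z = (if norm z \<le> R then 0 else g z)" for z
  have [measurable]: "g \<in> borel_measurable borel" using g by (simp add: bounded_symbol_def)
  have g1: "bounded_symbol B g1"
    using g bounded_symbol_nonneg[OF g] unfolding bounded_symbol_def g1_def by auto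
  have g2: "bounded_symbol e g2"
    using R e unfolding bounded_symbol_def g2_def by (auto simp: less_imp_le not_le)
  have "compact_form (localization_form g1 gaussian gaussian)"
    by (rule compact_form_compactly_supported[OF g1, of R]) (simp add: g1_def)
  moreover have "cmod (localization_form g gaussian gaussian u v - localization_form g1 gaussian gaussian u v) \<le> e * norm u * norm v" for u v
  proof -
    have "g = (\<lambda>z. g1 z + g2 z)" by (auto simp: g1_def g2_def)
    then have "localization_form g gaussian gaussian u v - localization_form g1 gaussian gaussian u v = localization_form g2 gaussian gaussian u v"
      using localization_form_symbol_add[OF g1 g2, of gaussian gaussian u v] by simp
    then show ?thesis using localization_form_bound[OF g2, of gaussian gaussian u v] by simp
  qed
  ultimately show "\<exists>Q'. compact_form Q' \<and> (\<forall>u v. cmod (localization_form g gaussian gaussian u v - Q' u v) \<le> e * norm u * norm v)"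
    by blast
qed

text \<open>Overlaps of coherent states decay like a Gaussian in the distance; as all have norm 1,
  the convergence survives norm limits in \<open>u\<close>.\<close>

lemma coherent_weakly_null: "((\<lambda>z. cinner_L2 u (coherent z)) \<longlongrightarrow> 0) at_infinity"
proof -
  let ?S = "{u :: 'a L2. ((\<lambda>z. cinner_L2 u (coherent z)) \<longlongrightarrow> 0) at_infinity}"
  have "closed ?S"
    unfolding closed_sequential_limits
  proof (intro allI impI, elim conjE)
    fix x :: "nat \<Rightarrow> 'a L2" and l
    assume x: "\<forall>n. x n \<in> ?S" and lim: "x \<longlonglongrightarrow> l"
    have "((\<lambda>z. cinner_L2 l (coherent z)) \<longlongrightarrow> 0) at_infinity"
    proof (rule tendstoI)
      fix e :: real assume e: "e > 0"
      then have "\<forall>\<^sub>F n in sequentially. dist (x n) l < e / 2" using lim by (intro tendstoD) auto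
      then obtain n where n: "norm (l - x n) < e / 2"
        by (auto simp: eventually_sequentially dist_norm norm_minus_commute)
      have "((\<lambda>z. cinner_L2 (x n) (coherent z)) \<longlongrightarrow> 0) at_infinity" using x by blast
      then have "\<forall>\<^sub>F z in at_infinity. dist (cinner_L2 (x n) (coherent z)) 0 < e / 2" using e by (intro tendstoD) auto
      then show "\<forall>\<^sub>F z in at_infinity. dist (cinner_L2 l (coherent z)) 0 < e"
      proof eventually_elim
        case (elim z)
        have "cmod (cinner_L2 l (coherent z)) \<le> cmod (cinner_L2 (l - x n) (coherent z)) + cmod (cinner_L2 (x n) (coherent z))"
          using norm_triangle_ineq[of "cinner_L2 (l - x n) (coherent z)" "cinner_L2 (x n) (coherent z)"]
          by (simp add: cinner_L2.diff_left)
        also have "cmod (cinner_L2 (l - x n) (coherent z)) \<le> norm (l - x n)"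
          using cinner_L2_Cauchy_Schwarz[of "l - x n" "coherent z"] by simp
        finally show ?case using elim n by simp
      qed
    qed
    then show "l \<in> ?S" by simp
  qed
  then have "u \<in> ?S"
  proof (rule coherent_dense)
    fix a :: "'a \<times> 'a"
    have "((\<lambda>z. cinner_L2 (coherent a) (coherent z)) \<longlongrightarrow> 0) at_infinity"
      unfolding tendsto_iff eventually_at_infinity
    proof (intro allI impI)
      fix e :: real assume e: "e > 0"
      \<comment> \<open>This radius forces \<open>norm (a - z)\<close> above 1 and above
        \<open>1 / e\<close>, hence its square above \<open>1 / e\<close>; then
        \<open>exp y \<ge> 1 + y\<close> yields the decay.\<close>
      have "dist (cinner_L2 (coherent a) (coherent z)) 0 < e" if z: "norm z \<ge> norm a + 1 / e + 1" for z
      proof -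
        define y where "y = pi / 2 * (norm (a - z))\<^sup>2"
        have r: "norm (a - z) \<ge> 1 / e + 1" using norm_triangle_ineq2[of z a] z by (simp add: norm_minus_commute)
        then have "1 * norm (a - z) \<le> norm (a - z) * norm (a - z)"
          using e by (intro mult_right_mono) (auto intro: order_trans[of _ "1 / e + 1"])
        then have "1 / e < (norm (a - z))\<^sup>2" using r by (simp add: power2_eq_square)
        also have "\<dots> \<le> y" unfolding y_def using pi_ge_two mult_right_mono[of 1 "pi / 2" "(norm (a - z))\<^sup>2"] by simp
        finally have "1 / e < exp y" using exp_ge_add_one_self[of y] by linarith
        then have "exp (- y) < e" using e by (simp add: exp_minus field_simps)
        then show ?thesis by (simp add: norm_cinner_coherent y_def)
      qed
      then show "\<exists>b. \<forall>z. b \<le> norm z \<longrightarrow> dist (cinner_L2 (coherent a) (coherent z)) 0 < e" by blast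
    qed
    then show "coherent a \<in> ?S" by simp
  next
    fix x y assume "x \<in> ?S" "y \<in> ?S"
    then show "x + y \<in> ?S" using tendsto_add[of _ 0 at_infinity _ 0] by (auto simp: cinner_L2_add_left)
  next
    fix c x assume "x \<in> ?S"
    then show "scaleC_L2 c x \<in> ?S" using tendsto_mult_right_zero by (auto simp: cinner_L2_scaleC_left)
  qed
  then show ?thesis by simp
qed

text \<open>The images of all coherent states lie within \<open>e / 2\<close> of finitely many
  vectors, and against each of these the coherent states tend to 0.\<close>

lemma compact_operator_imp_Berezin_vanishing:
  assumes T: "compact_operator T"
  shows "((\<lambda>z. cinner_L2 (T (coherent z)) (coherent z)) \<longlongrightarrow> 0) at_infinity"
proof (rule tendstoI)
  fix e :: real assume e: "e > 0"
  have "compact (closure (T ` cball 0 1))" using T unfolding compact_operator_def by blast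
  then obtain N where N: "finite N" "closure (T ` cball 0 1) \<subseteq> (\<Union>y\<in>N. ball y (e / 2))"
    using e unfolding compact_eq_totally_bounded by (meson half_gt_zero)
  have "\<forall>\<^sub>F z in at_infinity. dist (cinner_L2 y (coherent z)) 0 < e / 2" for y
    using tendstoD[OF coherent_weakly_null[of y], of "e / 2"] e by simp
  then have "\<forall>\<^sub>F z in at_infinity. \<forall>y\<in>N. dist (cinner_L2 y (coherent z)) 0 < e / 2"
    by (intro eventually_ball_finite N(1)) blast
  then show "\<forall>\<^sub>F z in at_infinity. dist (cinner_L2 (T (coherent z)) (coherent z)) 0 < e"
  proof eventually_elim
    case (elim z)
    have "T (coherent z) \<in> closure (T ` cball 0 1)" by (rule closure_subset[THEN subsetD]) simp
    then obtain y where y: "y \<in> N" "dist y (T (coherent z)) < e / 2" using N(2) by auto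
    have "cmod (cinner_L2 (T (coherent z)) (coherent z)) \<le> cmod (cinner_L2 (T (coherent z) - y) (coherent z)) + cmod (cinner_L2 y (coherent z))"
      using norm_triangle_ineq[of "cinner_L2 (T (coherent z) - y) (coherent z)" "cinner_L2 y (coherent z)"]
      by (simp add: cinner_L2.diff_left)
    also have "cmod (cinner_L2 (T (coherent z) - y) (coherent z)) \<le> norm (T (coherent z) - y)"
      using cinner_L2_Cauchy_Schwarz[of "T (coherent z) - y" "coherent z"] by simp
    also have "norm (T (coherent z) - y) < e / 2" using y(2) by (simp add: dist_norm norm_minus_commute)
    also have "cmod (cinner_L2 y (coherent z)) < e / 2" using bspec[OF elim y(1)] by simp
    finally show ?case by simp
  qed
qed

lemma bounded_bilinear_localization_form:
  assumes g: "bounded_symbol B g"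
  shows "bounded_bilinear (localization_form g \<psi> \<phi>)"
proof
  show "\<exists>K. \<forall>u v. norm (localization_form g \<psi> \<phi> u v) \<le> norm u * norm v * K"
    using localization_form_bound[OF g, of \<psi> \<phi>]
    by (intro exI[of _ "B * (norm \<psi> * norm \<phi>)"]) (simp add: mult_ac)
qed (simp_all add: localization_form_linear[OF g] scaleR_L2_def localization_form_scaleC scaleR_conv_of_real)

text \<open>Read as a Berezin transform, the convolution inherits its continuity from the coherent
  states.\<close>

lemma continuous_conv_berezin_window:
  assumes g: "bounded_symbol B g"
  shows "continuous_on UNIV (conv g (berezin_window \<psi> \<phi>))"
  unfolding berezin_transform[symmetric]
  by (rule bounded_bilinear.continuous_on[OF bounded_bilinear_localization_form[OF g] continuous_coherent continuous_coherent])

section \<open>The Gaussian family\<close>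

lemma conv_assoc:
  fixes f k h :: "'a::euclidean_space \<Rightarrow> complex"
  assumes f: "bounded_symbol B f" and k: "integrable lborel k" and h: "integrable lborel h"
  shows "conv (conv f k) h z = conv f (conv k h) z"
proof -
  have [measurable]: "f \<in> borel_measurable borel" "k \<in> borel_measurable borel" "h \<in> borel_measurable borel"
    using f k h by (auto simp: bounded_symbol_def)
  have B: "0 \<le> B" "\<And>z. cmod (f z) \<le> B" using f bounded_symbol_nonneg[OF f] by (auto simp: bounded_symbol_def)
  have "conv (conv f k) h z = (LINT y|lborel. (LINT w|lborel. f w * k (y - w) * h (z - y)))"
    unfolding integral_mult_left_zero ..
  also have "\<dots> = (LINT w|lborel. (LINT y|lborel. f w * k (y - w) * h (z - y)))"
  proof (rule lborel_Fubini_dominated(2)[where T="\<lambda>y. y" and F="\<lambda>y. cmod (h (z - y))" and G="\<lambda>w. B * cmod (k (- w))"])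
    show "integrable lborel (\<lambda>y. cmod (h (z - y)))"
      using lborel_integral_reflect(2)[of h z] h by simp
    show "integrable lborel (\<lambda>w. B * cmod (k (- w)))"
      using lborel_integral_reflect(2)[of k 0] k by simp
    show "cmod (f w * k (y - w) * h (z - y)) \<le> cmod (h (z - y)) * (B * cmod (k (- (w - y))))" for y w
      unfolding norm_mult minus_diff_eq mult.commute[of "cmod (h (z - y))"]
      by (intro mult_right_mono B norm_ge_zero)
  qed simp_all
  also have "\<dots> = conv f (conv k h) z"
  proof (rule Bochner_Integration.integral_cong)
    fix w
    have "(LINT y|lborel. f w * k (y - w) * h (z - y)) = (LINT y|lborel. f w * k ((y + w) - w) * h (z - (y + w)))"
      by (rule lborel_integral_shift(1)[symmetric]) measurable
    also have "\<dots> = (LINT y|lborel. f w * (k y * h ((z - w) - y)))"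
      by (simp add: mult.assoc diff_diff_eq add.commute)
    finally show "(LINT y|lborel. f w * k (y - w) * h (z - y)) = f w * conv k h (z - w)" by simp
  qed simp
  finally show ?thesis .
qed

lemma conv_commute:
  fixes k h :: "'a::euclidean_space \<Rightarrow> complex"
  assumes "k \<in> borel_measurable borel" "h \<in> borel_measurable borel"
  shows "conv k h z = conv h k z"
  unfolding conv_reflect[OF assms] by (simp only: mult.commute)

text \<open>Along points escaping to infinity the translates of \<open>g\<close> tend to 0 under the
  integral. The argument by contradiction provides the sequence on which dominated convergence
  works.\<close>

lemma conv_vanishing:
  fixes g h :: "'a::euclidean_space \<Rightarrow> complex"
  assumes g: "bounded_symbol B g" and lim: "(g \<longlongrightarrow> 0) at_infinity" and h: "integrable lborel h"
  shows "(conv g h \<longlongrightarrow> 0) at_infinity"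
proof (rule ccontr)
  assume "\<not> (conv g h \<longlongrightarrow> 0) at_infinity"
  then obtain e where e: "e > 0" "\<And>b. \<exists>z. b \<le> norm z \<and> e \<le> cmod (conv g h z)"
    unfolding tendsto_iff eventually_at_infinity by (auto simp: not_less)
  have "\<exists>z. real n \<le> norm z \<and> e \<le> cmod (conv g h z)" for n using e(2) by blast
  then obtain Z where Z: "\<And>n. real n \<le> norm (Z n)" "\<And>n. e \<le> cmod (conv g h (Z n))" by metis
  have [measurable]: "g \<in> borel_measurable borel" "h \<in> borel_measurable borel"
    using g h by (auto simp: bounded_symbol_def)
  have "(\<lambda>n. LINT w|lborel. g (Z n - w) * h w) \<longlonglongrightarrow> (LINT w::'a|lborel. 0)"
  proof (rule integral_dominated_convergence[where w="\<lambda>w. B * cmod (h w)"])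
    show "AE w in lborel. (\<lambda>n. g (Z n - w) * h w) \<longlonglongrightarrow> 0"
    proof (rule AE_I2)
      fix w
      have "filterlim (\<lambda>n. norm (Z n - w)) at_top sequentially"
      proof (rule filterlim_at_top_mono[OF filterlim_tendsto_add_at_top[OF tendsto_const filterlim_real_sequentially]])
        show "\<forall>\<^sub>F n in sequentially. - norm w + real n \<le> norm (Z n - w)"
          using norm_triangle_ineq2[of "Z _" w] Z(1) by (intro always_eventually allI) (smt (verit))
      qed
      then have "filterlim (\<lambda>n. Z n - w) at_infinity sequentially"
        by (simp add: filterlim_norm_at_top_imp_at_infinity)
      then have "(\<lambda>n. g (Z n - w)) \<longlonglongrightarrow> 0" by (rule filterlim_compose[OF lim])
      then show "(\<lambda>n. g (Z n - w) * h w) \<longlonglongrightarrow> 0" by (rule tendsto_mult_left_zero)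
    qed
    show "AE w in lborel. norm (g (Z n - w) * h w) \<le> B * cmod (h w)" for n
      using g by (intro AE_I2) (auto simp: bounded_symbol_def norm_mult intro!: mult_right_mono)
  qed (use h in auto)
  then have "(\<lambda>n. conv g h (Z n)) \<longlonglongrightarrow> 0"
    by (simp add: conv_reflect)
  then have "\<forall>\<^sub>F n in sequentially. dist (conv g h (Z n)) 0 < e" using e(1) by (rule tendstoD)
  then show False using Z(2) by (auto simp: eventually_sequentially not_less[symmetric])
qed

text \<open>The E_s of the overview, unnormalized so that each derivative in \<open>s\<close> merely
  multiplies by \<open>- (norm z)\<^sup>2\<close>.\<close>

definition gauss :: "real \<Rightarrow> 'a::euclidean_space \<Rightarrow> complex" where
  "gauss s z = of_real (exp (- s * (norm z)\<^sup>2))"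

lemma gauss_integrable: "s > 0 \<Longrightarrow> integrable lborel (gauss s)"
  unfolding gauss_def[abs_def] by (intro integrable_of_real gaussian_fourier(1))

lemma gauss_measurable [measurable]: "gauss s \<in> borel_measurable borel"
  unfolding gauss_def[abs_def] by measurable

text \<open>The reciprocals of the parameters add, as variances do.\<close>

lemma conv_gauss_gauss:
  assumes "s > 0" "t > 0"
  shows "conv (gauss s) (gauss t) z
    = of_real (sqrt (pi / (s + t)) ^ DIM('a)) * gauss (s * t / (s + t)) (z :: 'a::euclidean_space)"
proof -
  have st: "s + t > 0" using assms by simp
  let ?g = "\<lambda>w. exp (of_real (- (s + t) * (norm w)\<^sup>2 + ((2 * t) *\<^sub>R z) \<bullet> w) + \<i> * of_real (0 \<bullet> w))"
  have "gauss s w * gauss t (z - w) = of_real (exp (- t * (norm z)\<^sup>2)) * ?g w" for w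
  proof -
    have "- s * (norm w)\<^sup>2 + - t * (norm (z - w))\<^sup>2 = - t * (norm z)\<^sup>2 + (- (s + t) * (norm w)\<^sup>2 + ((2 * t) *\<^sub>R z) \<bullet> w)"
      unfolding power2_norm_eq_inner by (simp add: inner_commute algebra_simps)
    then have "exp (- s * (norm w)\<^sup>2) * exp (- t * (norm (z - w))\<^sup>2) = exp (- t * (norm z)\<^sup>2) * exp (- (s + t) * (norm w)\<^sup>2 + ((2 * t) *\<^sub>R z) \<bullet> w)"
      by (simp only: exp_add[symmetric])
    then show ?thesis
      unfolding gauss_def by (simp only: of_real_mult[symmetric] inner_zero_left of_real_0 mult_zero_right add_0_right exp_of_real)
  qed
  then have "conv (gauss s) (gauss t) z = of_real (exp (- t * (norm z)\<^sup>2)) * (of_real (sqrt (pi / (s + t)) ^ DIM('a)) *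
      exp (of_real (((norm ((2 * t) *\<^sub>R z))\<^sup>2 - (norm (0::'a))\<^sup>2) / (4 * (s + t))) + \<i> * of_real (((2 * t) *\<^sub>R z \<bullet> 0) / (2 * (s + t)))))"
    by (simp only: integral_mult_right_zero gaussian_integral_complex[OF st])
  also have "\<dots> = of_real (sqrt (pi / (s + t)) ^ DIM('a)) * of_real (exp (- t * (norm z)\<^sup>2) * exp ((norm ((2 * t) *\<^sub>R z))\<^sup>2 / (4 * (s + t))))"
    by (simp only: norm_zero zero_power2 diff_zero inner_zero_right div_0 of_real_0 mult_zero_right add_0_right
        exp_of_real of_real_mult mult_ac)
  also have "exp (- t * (norm z)\<^sup>2) * exp ((norm ((2 * t) *\<^sub>R z))\<^sup>2 / (4 * (s + t))) = exp (- (s * t / (s + t)) * (norm z)\<^sup>2)"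
    unfolding exp_add[symmetric] using st by (simp add: power_mult_distrib field_simps power2_eq_square)
  finally show ?thesis by (simp only: gauss_def)
qed

text \<open>The subspace of L1 on which the Tauberian argument runs. Integrability is part of it, so
  that \<open>conv f h\<close> for bounded \<open>f\<close> never is the default value of a
  divergent integral.\<close>

definition compact_multiplier ::
  "('a::euclidean_space \<times> 'a \<Rightarrow> complex) \<Rightarrow> 'a L2 \<Rightarrow> 'a L2 \<Rightarrow> ('a \<times> 'a \<Rightarrow> complex) \<Rightarrow> bool" where
  "compact_multiplier f \<psi> \<phi> h \<longleftrightarrow>
     integrable lborel h \<and> compact_form (localization_form (conv f h) \<psi> \<phi>)"

lemma compact_multiplier_scale:
  assumes "compact_multiplier f \<psi> \<phi> h"
  shows "compact_multiplier f \<psi> \<phi> (\<lambda>z. c * h z)"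
proof -
  have "conv f (\<lambda>z. c * h z) = (\<lambda>z. c * conv f h z)"
    by (subst integral_mult_right_zero[symmetric]) (simp only: mult_ac)
  then show ?thesis
    using assms compact_form_scale[of "localization_form (conv f h) \<psi> \<phi>" c]
    by (simp add: compact_multiplier_def localization_form_symbol_scale[abs_def])
qed

lemma compact_multiplier_add:
  assumes f: "bounded_symbol B f"
    and h: "compact_multiplier f \<psi> \<phi> h" and k: "compact_multiplier f \<psi> \<phi> k"
  shows "compact_multiplier f \<psi> \<phi> (\<lambda>z. h z + k z)"
proof -
  have int: "integrable lborel h" "integrable lborel k" using h k by (auto simp: compact_multiplier_def)
  have cv: "conv f (\<lambda>z. h z + k z) = (\<lambda>z. conv f h z + conv f k z)"
    using integrable_conv_kernel[OF f int(1)] integrable_conv_kernel[OF f int(2)]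
    by (simp add: ring_distribs)
  have "localization_form (conv f (\<lambda>z. h z + k z)) \<psi> \<phi>
     = (\<lambda>u v. localization_form (conv f h) \<psi> \<phi> u v + localization_form (conv f k) \<psi> \<phi> u v)"
    unfolding cv by (intro ext) (rule localization_form_symbol_add[OF bounded_symbol_conv[OF f int(1)] bounded_symbol_conv[OF f int(2)]])
  moreover have "compact_form (\<lambda>u v. localization_form (conv f h) \<psi> \<phi> u v + localization_form (conv f k) \<psi> \<phi> u v)"
    by (rule compact_form_add) (use h k in \<open>simp_all add: compact_multiplier_def\<close>)
  ultimately show ?thesis
    using int by (simp add: compact_multiplier_def)
qed

lemma compact_multiplier_diff:
  assumes f: "bounded_symbol B f"
    and h: "compact_multiplier f \<psi> \<phi> h" and k: "compact_multiplier f \<psi> \<phi> k"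
  shows "compact_multiplier f \<psi> \<phi> (\<lambda>z. h z - k z)"
  using compact_multiplier_add[OF f h compact_multiplier_scale[OF k, of "-1"]] by simp

lemma compact_multiplier_zero: "compact_multiplier f \<psi> \<phi> (\<lambda>z. 0)"
  using compact_form_zero by (simp add: compact_multiplier_def localization_form_def[abs_def])

lemma compact_multiplier_sum:
  assumes f: "bounded_symbol B f" and h: "\<And>k. k < n \<Longrightarrow> compact_multiplier f \<psi> \<phi> (h k)"
  shows "compact_multiplier f \<psi> \<phi> (\<lambda>z. \<Sum>k<n::nat. h k z)"
  using h by (induction n) (simp_all add: compact_multiplier_zero compact_multiplier_add[OF f])

text \<open>Closedness in L1, in the form in which it is applied: dominated pointwise limits. The
  difference of two forms is bounded by \<open>B\<close> times the L1 distance of the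
  kernels.\<close>

lemma compact_multiplier_limit:
  assumes f: "bounded_symbol B f" and h: "\<And>n. compact_multiplier f \<psi> \<phi> (h n)"
    and w: "integrable lborel w" "\<And>n z. cmod (h n z) \<le> w z"
    and lim: "\<And>z. (\<lambda>n. h n z) \<longlonglongrightarrow> k z"
  shows "compact_multiplier f \<psi> \<phi> k"
proof -
  have h_int: "integrable lborel (h n)" for n using h by (simp add: compact_multiplier_def)
  then have [measurable]: "h n \<in> borel_measurable borel" for n by auto
  have [measurable]: "k \<in> borel_measurable borel"
    by (rule borel_measurable_LIMSEQ_metric[OF _ lim]) simp
  have [measurable]: "w \<in> borel_measurable borel" using w(1) by auto
  have k_le: "cmod (k z) \<le> w z" for z
    by (rule LIMSEQ_le_const2[OF tendsto_norm[OF lim]]) (use w(2) in auto)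
  have k: "integrable lborel k"
    by (rule integral_dominated(1)[OF w(1) _ k_le]) measurable
  have "(\<lambda>n. LINT z|lborel. cmod (k z - h n z)) \<longlonglongrightarrow> (LINT z::'a \<times> 'a|lborel. 0)"
  proof (rule integral_dominated_convergence[where w="\<lambda>z. 2 * w z"])
    show "AE z in lborel. (\<lambda>n. cmod (k z - h n z)) \<longlonglongrightarrow> 0"
    proof (rule AE_I2)
      fix z
      have "(\<lambda>n. cmod (k z - h n z)) \<longlonglongrightarrow> cmod (k z - k z)" by (intro tendsto_intros lim)
      then show "(\<lambda>n. cmod (k z - h n z)) \<longlonglongrightarrow> 0" by simp
    qed
    show "AE z in lborel. norm (cmod (k z - h n z)) \<le> 2 * w z" for n
    proof (rule AE_I2)
      fix z
      show "norm (cmod (k z - h n z)) \<le> 2 * w z"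
        using norm_triangle_ineq4[of "k z" "h n z"] k_le[of z] w(2)[of n z] by simp
    qed
  qed (use w in auto)
  then have L1: "(\<lambda>n. LINT z|lborel. cmod (k z - h n z)) \<longlonglongrightarrow> 0" by simp
  define I where "I n = (LINT z|lborel. cmod (k z - h n z))" for n
  have "compact_form (localization_form (conv f k) \<psi> \<phi>)"
  proof (rule compact_form_limit)
    show "compact_form (localization_form (conv f (h n)) \<psi> \<phi>)" for n
      using h[of n] by (simp add: compact_multiplier_def)
    show "(\<lambda>n. B * (norm \<psi> * norm \<phi>) * I n) \<longlonglongrightarrow> 0"
      unfolding I_def by (intro tendsto_mult_right_zero L1)
    fix n u v
    have diff: "integrable lborel (\<lambda>z. k z - h n z)" using k h_int by simp
    have "conv f k = (\<lambda>z. conv f (h n) z + conv f (\<lambda>z. k z - h n z) z)"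
      using integrable_conv_kernel[OF f k] integrable_conv_kernel[OF f h_int[of n]]
      by (simp add: right_diff_distrib)
    then have "localization_form (conv f k) \<psi> \<phi> u v - localization_form (conv f (h n)) \<psi> \<phi> u v
       = localization_form (conv f (\<lambda>z. k z - h n z)) \<psi> \<phi> u v"
      using localization_form_symbol_add[OF bounded_symbol_conv[OF f h_int[of n]] bounded_symbol_conv[OF f diff]]
      by simp
    also have "cmod \<dots> \<le> B * I n * (norm \<psi> * norm u * (norm \<phi> * norm v))"
      unfolding I_def by (rule localization_form_bound[OF bounded_symbol_conv[OF f diff]])
    finally show "cmod (localization_form (conv f k) \<psi> \<phi> u v - localization_form (conv f (h n)) \<psi> \<phi> u v) \<le> B * (norm \<psi> * norm \<phi>) * I n * (norm u * norm v)"
      by (simp add: mult_ac)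
  qed
  then show ?thesis using k by (simp add: compact_multiplier_def)
qed

text \<open>The hypothesis passes from \<open>f\<close> to \<open>conv f (gauss t)\<close>, because
  smoothing commutes with the convolution by the window and preserves vanishing at infinity. The
  Gaussian identity then applies to the smoothed symbol.\<close>

lemma compact_multiplier_wide_gauss:
  assumes f: "bounded_symbol B f" and lim: "(conv f (berezin_window \<psi> \<phi>) \<longlongrightarrow> 0) at_infinity"
    and s: "0 < s" "s < pi"
  shows "compact_multiplier f \<psi> \<phi> (gauss s)"
proof -
  \<comment> \<open>The solution of \<open>t * pi / (t + pi) = s\<close>; its positivity is what
    requires \<open>s < pi\<close>.\<close>
  define t where "t = s * pi / (pi - s)"
  have t: "t > 0" using s by (simp add: t_def)
  have "t + pi = pi * pi / (pi - s)" using s by (simp add: t_def field_simps)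
  then have ts: "t * pi / (t + pi) = s" using s by (simp add: t_def)
  define c where "c = complex_of_real (sqrt (pi / (t + pi)) ^ DIM('a \<times> 'a))"
  have c: "c \<noteq> 0" using t by (simp add: c_def add_pos_pos less_imp_neq[symmetric])
  have cs: "conv (gauss t) (gauss pi) z = c * gauss s z" for z :: "'a \<times> 'a"
    by (simp only: conv_gauss_gauss[OF t pi_gt_zero] ts c_def)
  have meas: "berezin_window \<psi> \<phi> \<in> borel_measurable borel"
    using borel_measurable_integrable[OF berezin_window_integrable] by simp
  have ft: "bounded_symbol (B * (LINT w|lborel. cmod (gauss t (w :: 'a \<times> 'a)))) (conv f (gauss t))"
    by (rule bounded_symbol_conv[OF f gauss_integrable[OF t]])
  have swap: "conv (conv f (gauss t)) (berezin_window \<psi> \<phi>) = conv (conv f (berezin_window \<psi> \<phi>)) (gauss t)"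
  proof
    fix z
    have "conv (conv f (gauss t)) (berezin_window \<psi> \<phi>) z = conv f (conv (gauss t) (berezin_window \<psi> \<phi>)) z"
      by (rule conv_assoc[OF f gauss_integrable[OF t] berezin_window_integrable])
    also have "\<dots> = conv f (conv (berezin_window \<psi> \<phi>) (gauss t)) z"
      by (simp only: conv_commute[OF gauss_measurable meas])
    also have "\<dots> = conv (conv f (berezin_window \<psi> \<phi>)) (gauss t) z"
      by (rule conv_assoc[OF f berezin_window_integrable gauss_integrable[OF t], symmetric])
    finally show "conv (conv f (gauss t)) (berezin_window \<psi> \<phi>) z = \<dots>" .
  qed
  have "(conv (conv f (berezin_window \<psi> \<phi>)) (gauss t) \<longlongrightarrow> 0) at_infinity"
    by (rule conv_vanishing[OF bounded_symbol_conv[OF f berezin_window_integrable] lim gauss_integrable[OF t]])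
  then have "compact_form (localization_form (conv (conv f (gauss t)) (berezin_window \<psi> \<phi>)) gaussian gaussian)"
    unfolding swap[symmetric] by (rule compact_form_vanishing[OF bounded_symbol_conv[OF ft berezin_window_integrable]])
  moreover have "localization_form (conv (conv f (gauss t)) (gauss pi)) \<psi> \<phi>
      = localization_form (conv (conv f (gauss t)) (berezin_window \<psi> \<phi>)) gaussian gaussian"
    by (intro ext) (rule localization_form_conv_gaussian[OF ft, folded gauss_def])
  ultimately have "compact_form (localization_form (conv (conv f (gauss t)) (gauss pi)) \<psi> \<phi>)"
    by (simp only:)
  also have "conv (conv f (gauss t)) (gauss pi) = conv f (\<lambda>z. c * gauss s z)"
    by (simp only: conv_assoc[OF f gauss_integrable[OF t] gauss_integrable[OF pi_gt_zero]] cs)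
  finally have "compact_multiplier f \<psi> \<phi> (\<lambda>z. c * gauss s z)"
    using gauss_integrable[OF s(1)] unfolding compact_multiplier_def by (intro conjI integrable_mult_right)
  from compact_multiplier_scale[OF this, of "1 / c"] show ?thesis using c by simp
qed

section \<open>Continuation in the Gaussian parameter\<close>

lemma power_div_fact_le_exp:
  fixes x :: real
  assumes "0 \<le> x"
  shows "x ^ k / fact k \<le> exp x" "(\<Sum>k<n. x ^ k / fact k) \<le> exp x"
proof -
  have "exp x = (\<Sum>n. x ^ n / fact n)" by (simp add: exp_def divide_inverse mult.commute)
  moreover have "summable (\<lambda>n. x ^ n / fact n)" using summable_exp[of x] by (simp add: divide_inverse mult.commute)
  ultimately show "x ^ k / fact k \<le> exp x" "(\<Sum>k<n. x ^ k / fact k) \<le> exp x"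
    using sum_le_suminf[of "\<lambda>n. x ^ n / fact n" "{k}"] sum_le_suminf[of "\<lambda>n. x ^ n / fact n" "{..<n}"] assms by auto
qed

text \<open>Half of the exponent pays for the polynomial factor: a power is at most a constant times
  the exponential of \<open>s / 2 * (norm z)\<^sup>2\<close>.\<close>

lemma moment_gauss_integrable:
  assumes s: "s > 0"
  shows "integrable lborel (\<lambda>z. ((norm z)\<^sup>2) ^ k * exp (- s * (norm (z :: 'a::euclidean_space))\<^sup>2))"
proof (rule Bochner_Integration.integrable_bound)
  let ?c = "fact k / (s / 2) ^ k"
  show "integrable lborel (\<lambda>z::'a. ?c * exp (- (s / 2) * (norm z)\<^sup>2))"
    using s by (intro integrable_mult_right gaussian_fourier(1)) simp
  show "AE z in lborel. norm (((norm z)\<^sup>2) ^ k * exp (- s * (norm (z :: 'a))\<^sup>2)) \<le> norm (?c * exp (- (s / 2) * (norm z)\<^sup>2))"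
  proof (rule AE_I2)
    fix z :: 'a
    have "(s / 2 * (norm z)\<^sup>2) ^ k / fact k \<le> exp (s / 2 * (norm z)\<^sup>2)"
      by (rule power_div_fact_le_exp(1)) (use s in simp)
    then have "((norm z)\<^sup>2) ^ k \<le> ?c * exp (s / 2 * (norm z)\<^sup>2)"
      using s by (simp add: power_mult_distrib power_divide field_simps)
    then have "((norm z)\<^sup>2) ^ k * exp (- s * (norm z)\<^sup>2) \<le> ?c * exp (s / 2 * (norm z)\<^sup>2) * exp (- s * (norm z)\<^sup>2)"
      by (rule mult_right_mono) simp
    also have "\<dots> = ?c * exp (- (s / 2) * (norm z)\<^sup>2)"
      unfolding mult.assoc exp_add[symmetric] by (simp add: field_simps)
    finally show "norm (((norm z)\<^sup>2) ^ k * exp (- s * (norm z)\<^sup>2)) \<le> norm (?c * exp (- (s / 2) * (norm z)\<^sup>2))"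
      using s by (simp add: abs_mult)
  qed
qed measurable

text \<open>The next moment is the negative derivative in \<open>s\<close> of the present one, a
  limit of difference quotients that belong to the subspace. The bound
  \<open>1 - exp (- x) \<le> x\<close> dominates these quotients by the next moment itself.\<close>

lemma compact_multiplier_moment_gauss:
  assumes f: "bounded_symbol B f" and M: "\<And>s. 0 < s \<Longrightarrow> s < \<sigma> \<Longrightarrow> compact_multiplier f \<psi> \<phi> (gauss s)"
    and s: "0 < s" "s < \<sigma>"
  shows "compact_multiplier f \<psi> \<phi> (\<lambda>z. of_real (((norm z)\<^sup>2) ^ k) * gauss s z)"
  using s
proof (induction k arbitrary: s)
  case 0
  then show ?case using M by simp
next
  case (Suc k)
  \<comment> \<open>A denominator of at least 2 keeps \<open>s + \<delta> n\<close> strictly below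
    \<sigma> already for \<open>n = 0\<close>.\<close>
  define \<delta> where "\<delta> n = (\<sigma> - s) / real (Suc (Suc n))" for n
  have \<delta>: "\<delta> n > 0" "s + \<delta> n < \<sigma>" for n
  proof -
    show "\<delta> n > 0" using Suc.prems by (simp add: \<delta>_def)
    have "(\<sigma> - s) / real (Suc (Suc n)) < (\<sigma> - s) / 1"
      using Suc.prems by (intro divide_strict_left_mono) auto
    then show "s + \<delta> n < \<sigma>" by (simp add: \<delta>_def)
  qed
  have \<delta>_lim: "\<delta> \<longlonglongrightarrow> 0"
  proof -
    have "(\<lambda>n. (\<sigma> - s) * inverse (real (Suc (Suc n)))) \<longlonglongrightarrow> (\<sigma> - s) * 0"
      by (intro tendsto_mult tendsto_const LIMSEQ_Suc[OF LIMSEQ_inverse_real_of_nat])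
    then show ?thesis by (simp add: \<delta>_def[abs_def] divide_inverse)
  qed
  define h where "h n z = (of_real (1 / \<delta> n)) * (of_real (((norm z)\<^sup>2) ^ k) * gauss s z - of_real (((norm z)\<^sup>2) ^ k) * gauss (s + \<delta> n) z)" for n and z :: "'a \<times> 'a"
  have h_eq: "h n z = of_real (((norm z)\<^sup>2) ^ k * exp (- s * (norm z)\<^sup>2) * ((1 - exp (- \<delta> n * (norm z)\<^sup>2)) / \<delta> n))" for n z
  proof -
    have "exp (- (s + \<delta> n) * (norm z)\<^sup>2) = exp (- s * (norm z)\<^sup>2) * exp (- \<delta> n * (norm z)\<^sup>2)"
      unfolding exp_add[symmetric] by (simp add: algebra_simps)
    then show ?thesis unfolding h_def gauss_def by (simp add: algebra_simps diff_divide_distrib)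
  qed
  show ?case
  proof (rule compact_multiplier_limit[OF f, of \<psi> \<phi> h])
    show "compact_multiplier f \<psi> \<phi> (h n)" for n
      unfolding h_def[abs_def]
      by (intro compact_multiplier_scale compact_multiplier_diff[OF f] Suc.IH)
         (use Suc.prems \<delta>[of n] in auto)
    show "integrable lborel (\<lambda>z::'a \<times> 'a. ((norm z)\<^sup>2) ^ Suc k * exp (- s * (norm z)\<^sup>2))"
      by (rule moment_gauss_integrable[OF Suc.prems(1)])
    show "cmod (h n z) \<le> ((norm z)\<^sup>2) ^ Suc k * exp (- s * (norm z)\<^sup>2)" for n z
    proof -
      have "1 - exp (- \<delta> n * (norm z)\<^sup>2) \<le> \<delta> n * (norm z)\<^sup>2"
        using exp_ge_add_one_self[of "- \<delta> n * (norm z)\<^sup>2"] by simp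
      then have "(1 - exp (- \<delta> n * (norm z)\<^sup>2)) / \<delta> n \<le> (norm z)\<^sup>2"
        using \<delta>(1)[of n] by (simp add: field_simps)
      moreover have "0 \<le> (1 - exp (- \<delta> n * (norm z)\<^sup>2)) / \<delta> n" using \<delta>(1)[of n] by simp
      moreover have "\<bar>x * q\<bar> \<le> x * y" if "0 \<le> x" "0 \<le> q" "q \<le> y" for x q y :: real
        using that by (simp add: mult_left_mono)
      ultimately have "\<bar>((norm z)\<^sup>2) ^ k * exp (- s * (norm z)\<^sup>2) * ((1 - exp (- \<delta> n * (norm z)\<^sup>2)) / \<delta> n)\<bar>
         \<le> ((norm z)\<^sup>2) ^ k * exp (- s * (norm z)\<^sup>2) * (norm z)\<^sup>2"
        by (metis exp_ge_zero mult_nonneg_nonneg zero_le_power zero_le_power2)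
      then show ?thesis unfolding h_eq norm_of_real by (simp add: mult_ac)
    qed
    show "(\<lambda>n. h n z) \<longlonglongrightarrow> of_real (((norm z)\<^sup>2) ^ Suc k) * gauss s z" for z
    proof -
      define y where "y = (norm z)\<^sup>2"
      have "((\<lambda>t. exp (- t * y)) has_real_derivative - y * exp (- 0 * y)) (at 0)"
        by (auto intro!: derivative_eq_intros)
      then have "((\<lambda>t. (exp (- (0 + t) * y) - exp (- 0 * y)) / t) \<longlongrightarrow> - y) (at 0)"
        unfolding DERIV_def by simp
      moreover have "filterlim \<delta> (at 0) sequentially"
        using \<delta>_lim \<delta>(1) by (auto simp: filterlim_at intro!: always_eventually less_imp_neq[symmetric])
      ultimately have "(\<lambda>n. (exp (- (0 + \<delta> n) * y) - exp (- 0 * y)) / \<delta> n) \<longlonglongrightarrow> - y"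
        by (rule filterlim_compose)
      then have "(\<lambda>n. - ((exp (- (0 + \<delta> n) * y) - exp (- 0 * y)) / \<delta> n)) \<longlonglongrightarrow> - (- y)"
        by (rule tendsto_minus)
      then have lim: "(\<lambda>n. (1 - exp (- \<delta> n * y)) / \<delta> n) \<longlonglongrightarrow> y"
        by (simp add: minus_divide_left)
      have "(\<lambda>n. h n z) \<longlonglongrightarrow> of_real (y ^ k * exp (- s * y) * y)"
        unfolding h_eq y_def[symmetric] by (intro tendsto_of_real tendsto_mult tendsto_const lim)
      then show ?thesis by (simp add: gauss_def y_def mult_ac)
    qed
  qed
qed

text \<open>The Taylor polynomials about \<open>r\<close> are dominated by
  \<open>exp (- (r - \<bar>r - s\<bar>) * (norm z)\<^sup>2)\<close>, which is integrable as long as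
  \<open>0 < s < 2 * r\<close>. A centre \<open>r\<close> below \<sigma> thus reaches parameters
  beyond \<sigma>.\<close>

lemma compact_multiplier_gauss_extend:
  assumes f: "bounded_symbol B f" and M: "\<And>s. 0 < s \<Longrightarrow> s < \<sigma> \<Longrightarrow> compact_multiplier f \<psi> \<phi> (gauss s)"
    and s: "0 < s" "s < 3 / 2 * \<sigma>"
  shows "compact_multiplier f \<psi> \<phi> (gauss s)"
proof -
  \<comment> \<open>The centre must satisfy \<open>r < \<sigma>\<close> and
    \<open>3 / 2 * \<sigma> \<le> 2 * r\<close>; this is the midpoint between
    \<open>3 / 4 * \<sigma>\<close> and \<sigma>.\<close>
  define r where "r = 7 / 8 * \<sigma>"
  have r: "0 < r" "r < \<sigma>" "\<bar>r - s\<bar> < r" unfolding abs_less_iff r_def using s by linarith+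
  define h where "h n z = (\<Sum>k<n. of_real ((r - s) ^ k / fact k) * (of_real (((norm z)\<^sup>2) ^ k) * gauss r z))" for n and z :: "'a \<times> 'a"
  have h_eq: "h n z = of_real ((\<Sum>k<n. ((r - s) * (norm z)\<^sup>2) ^ k / fact k) * exp (- r * (norm z)\<^sup>2))" for n z
    unfolding h_def gauss_def of_real_mult of_real_sum sum_distrib_right
    by (intro sum.cong refl) (simp add: power_mult_distrib)
  show ?thesis
  proof (rule compact_multiplier_limit[OF f, of \<psi> \<phi> h])
    show "compact_multiplier f \<psi> \<phi> (h n)" for n
      unfolding h_def[abs_def]
      by (intro compact_multiplier_sum[OF f] compact_multiplier_scale)
         (rule compact_multiplier_moment_gauss[OF f _ r(1,2)], erule (1) M)
    show "integrable lborel (\<lambda>z::'a \<times> 'a. exp (- (r - \<bar>r - s\<bar>) * (norm z)\<^sup>2))"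
      using r by (intro gaussian_fourier(1)) simp
    show "cmod (h n z) \<le> exp (- (r - \<bar>r - s\<bar>) * (norm z)\<^sup>2)" for n z
    proof -
      have "\<bar>\<Sum>k<n. ((r - s) * (norm z)\<^sup>2) ^ k / fact k\<bar> \<le> (\<Sum>k<n. (\<bar>r - s\<bar> * (norm z)\<^sup>2) ^ k / fact k)"
        by (rule order_trans[OF sum_abs]) (simp add: abs_mult power_abs)
      also have "\<dots> \<le> exp (\<bar>r - s\<bar> * (norm z)\<^sup>2)"
        by (rule power_div_fact_le_exp(2)) simp
      finally have "\<bar>\<Sum>k<n. ((r - s) * (norm z)\<^sup>2) ^ k / fact k\<bar> * exp (- r * (norm z)\<^sup>2) \<le> exp (\<bar>r - s\<bar> * (norm z)\<^sup>2) * exp (- r * (norm z)\<^sup>2)"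
        by (rule mult_right_mono) simp
      also have "\<dots> = exp (- (r - \<bar>r - s\<bar>) * (norm z)\<^sup>2)"
        unfolding exp_add[symmetric] by (simp add: algebra_simps)
      finally show ?thesis unfolding h_eq norm_of_real abs_mult by simp
    qed
    show "(\<lambda>n. h n z) \<longlonglongrightarrow> gauss s z" for z
    proof -
      have "(\<lambda>k. ((r - s) * (norm z)\<^sup>2) ^ k / fact k) sums exp ((r - s) * (norm z)\<^sup>2)"
        using exp_converges[of "(r - s) * (norm z)\<^sup>2"] by (simp add: divide_inverse mult.commute)
      then have "(\<lambda>n. \<Sum>k<n. ((r - s) * (norm z)\<^sup>2) ^ k / fact k) \<longlonglongrightarrow> exp ((r - s) * (norm z)\<^sup>2)"
        by (simp add: sums_def)
      then have "(\<lambda>n. h n z) \<longlonglongrightarrow> of_real (exp ((r - s) * (norm z)\<^sup>2) * exp (- r * (norm z)\<^sup>2))"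
        unfolding h_eq by (intro tendsto_of_real tendsto_mult tendsto_const)
      also have "exp ((r - s) * (norm z)\<^sup>2) * exp (- r * (norm z)\<^sup>2) = exp (- s * (norm z)\<^sup>2)"
        unfolding exp_add[symmetric] by (simp add: algebra_simps)
      finally show ?thesis by (simp only: gauss_def)
    qed
  qed
qed

text \<open>Each extension enlarges the range of parameters by the factor \<open>3 / 2\<close>,
  starting from \<open>pi\<close>, so every \<open>s\<close> is reached after finitely many.\<close>

lemma compact_multiplier_gauss:
  assumes f: "bounded_symbol B f" and lim: "(conv f (berezin_window \<psi> \<phi>) \<longlongrightarrow> 0) at_infinity"
    and s: "0 < s"
  shows "compact_multiplier f \<psi> \<phi> (gauss s)"
proof -
  have step: "compact_multiplier f \<psi> \<phi> (gauss s)" if "0 < s" "s < (3 / 2) ^ n * pi" for n s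
    using that
  proof (induction n arbitrary: s)
    case 0
    then show ?case using compact_multiplier_wide_gauss[OF f lim] by simp
  next
    case (Suc n)
    show ?case
      by (rule compact_multiplier_gauss_extend[OF f Suc.IH]) (use Suc.prems in auto)
  qed
  obtain n where "s / pi < (3 / 2 :: real) ^ n" using real_arch_pow[of "3 / 2" "s / pi"] by auto
  then show ?thesis using s by (intro step[of s n]) (simp_all add: field_simps)
qed

section \<open>Approximation by narrow Gaussians\<close>

text \<open>With the roles in the convolution exchanged, \<open>h\<close> carries the average and
  \<open>f\<close> stays untouched, so that continuity in the windows can be exploited although
  \<open>f\<close> has none.\<close>

lemma localization_form_conv_window:
  assumes f: "bounded_symbol B f" and h: "integrable lborel h"
  shows "localization_form (conv f h) \<psi> \<phi> u v
    = (LINT w|lborel. h w * localization_form f (tf_shift w \<psi>) (tf_shift w \<phi>) u v)"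
proof -
  have [measurable]: "f \<in> borel_measurable borel" "h \<in> borel_measurable borel"
    using f h by (auto simp: bounded_symbol_def)
  have "integrable (lborel \<Otimes>\<^sub>M lborel) (\<lambda>(z, w). (stft \<psi> u z * cnj (stft \<phi> v z)) * (h w * f (z - w)))"
  proof (rule lborel_Fubini_dominated(1)[where T="\<lambda>z. 0" and G="\<lambda>y. B * cmod (h y)", OF _ _ stft_mult_stft(1)])
    show "integrable lborel (\<lambda>y. B * cmod (h y))" using h by simp
    show "cmod ((stft \<psi> u z * cnj (stft \<phi> v z)) * (h w * f (z - w))) \<le> (cmod (stft \<psi> u z) * cmod (stft \<phi> v z)) * (B * cmod (h (w - 0)))" for z w
      by (simp add: bounded_symbolD[OF f] norm_mult mult_left_mono mult_right_mono mult.commute[of "cmod (h w)"])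
  qed measurable
  from localization_form_conv_kernel[OF _ _ this]
  have "localization_form (conv h f) \<psi> \<phi> u v = (LINT w|lborel. h w * localization_form f (tf_shift w \<psi>) (tf_shift w \<phi>) u v)"
    by (simp add: stft_product_shift_window localization_form_def mult.assoc)
  then show ?thesis by (simp only: conv_commute[OF \<open>f \<in> _\<close> \<open>h \<in> _\<close>])
qed

lemma localization_form_window_diff:
  assumes f: "bounded_symbol B f"
  shows "cmod (localization_form f \<psi>' \<phi>' u v - localization_form f \<psi> \<phi> u v)
    \<le> B * (norm (\<psi>' - \<psi>) * norm \<phi>' + norm \<psi> * norm (\<phi>' - \<phi>)) * (norm u * norm v)"
proof -
  have "localization_form f \<psi>' \<phi>' u v = localization_form f (\<psi>' - \<psi>) \<phi>' u v + localization_form f \<psi> \<phi>' u v"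
    using localization_form_linear(3)[OF f, of "\<psi>' - \<psi>" \<psi> \<phi>' u v] by simp
  moreover have "localization_form f \<psi> \<phi>' u v = localization_form f \<psi> (\<phi>' - \<phi>) u v + localization_form f \<psi> \<phi> u v"
    using localization_form_linear(4)[OF f, of \<psi> "\<phi>' - \<phi>" \<phi> u v] by simp
  ultimately have "localization_form f \<psi>' \<phi>' u v - localization_form f \<psi> \<phi> u v
     = localization_form f (\<psi>' - \<psi>) \<phi>' u v + localization_form f \<psi> (\<phi>' - \<phi>) u v" by simp
  also have "cmod \<dots> \<le> B * (norm (\<psi>' - \<psi>) * norm u * (norm \<phi>' * norm v)) + B * (norm \<psi> * norm u * (norm (\<phi>' - \<phi>) * norm v))"
    by (rule order_trans[OF norm_triangle_ineq add_mono[OF localization_form_bound[OF f] localization_form_bound[OF f]]])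
  finally show ?thesis by (simp add: algebra_simps)
qed

lemma vanishing_imp_compact_form:
  fixes f :: "'a::euclidean_space \<times> 'a \<Rightarrow> complex"
  assumes f: "bounded_symbol B f" and lim: "(conv f (berezin_window \<psi> \<phi>) \<longlongrightarrow> 0) at_infinity"
  shows "compact_form (localization_form f \<psi> \<phi>)"
proof -
  \<comment> \<open>Up to the factor \<open>B\<close>, this bounds the norm by which the form
    changes when both windows are shifted by \<open>w\<close>. It is continuous, vanishes at 0 and
    is bounded by \<open>M\<close>.\<close>
  define m where "m w = norm (tf_shift w \<psi> - \<psi>) * norm \<phi> + norm \<psi> * norm (tf_shift w \<phi> - \<phi>)" for w
  define M where "M = 4 * norm \<psi> * norm \<phi>"
  have m0: "0 \<le> m w" for w by (simp add: m_def)
  have m_le: "m w \<le> M" for w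
  proof -
    have "norm (tf_shift w \<xi> - \<xi>) \<le> 2 * norm \<xi>" for \<xi> :: "'a L2"
      using norm_triangle_ineq4[of "tf_shift w \<xi>" \<xi>] by simp
    then have "m w \<le> 2 * norm \<psi> * norm \<phi> + norm \<psi> * (2 * norm \<phi>)"
      unfolding m_def by (intro add_mono mult_mono) auto
    then show ?thesis by (simp add: M_def mult_ac)
  qed
  have m_cont: "continuous_on UNIV m"
    unfolding m_def[abs_def] by (intro continuous_intros continuous_tf_shift)
  have [measurable]: "m \<in> borel_measurable borel" by (rule borel_measurable_continuous_onI[OF m_cont])
  have [measurable]: "f \<in> borel_measurable borel" using f by (simp add: bounded_symbol_def)
  define E where "E y = exp (- pi * (norm (y :: 'a \<times> 'a))\<^sup>2)" for y
  have E: "integrable lborel E" unfolding E_def by (rule gaussian_fourier(1)) simp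
  have E1: "(LINT y|lborel. E y) = 1" unfolding E_def by (subst gaussian_integral) simp_all
  have E0: "0 \<le> E y" for y by (simp add: E_def)
  have [measurable]: "E \<in> borel_measurable borel" unfolding E_def by measurable
  define c where "c n = 1 / real (Suc n)" for n
  have c: "c n > 0" for n by (simp add: c_def)
  have c_lim: "c \<longlonglongrightarrow> 0" using LIMSEQ_inverse_real_of_nat by (simp add: c_def[abs_def] inverse_eq_divide)
  have "(\<lambda>n. LINT y|lborel. E y * m (c n *\<^sub>R y)) \<longlonglongrightarrow> (LINT y|lborel. E y * m 0)"
  proof (rule integral_dominated_convergence[where w="\<lambda>y. E y * M"])
    show "AE y in lborel. (\<lambda>n. E y * m (c n *\<^sub>R y)) \<longlonglongrightarrow> E y * m 0"
    proof (rule AE_I2)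
      fix y :: "'a \<times> 'a"
      have "(\<lambda>n. c n *\<^sub>R y) \<longlonglongrightarrow> 0 *\<^sub>R y" by (rule tendsto_scaleR[OF c_lim tendsto_const])
      then have "(\<lambda>n. m (c n *\<^sub>R y)) \<longlonglongrightarrow> m 0"
        using continuous_on_tendsto_compose[OF m_cont, of _ 0 sequentially] by simp
      then show "(\<lambda>n. E y * m (c n *\<^sub>R y)) \<longlonglongrightarrow> E y * m 0" by (intro tendsto_intros)
    qed
    show "AE y in lborel. norm (E y * m (c n *\<^sub>R y)) \<le> E y * M" for n
      using E0 m0 m_le by (intro AE_I2) (auto simp: abs_mult intro!: mult_left_mono)
    show "integrable lborel (\<lambda>y. E y * M)" using E by simp
  qed measurable
  then have Em: "(\<lambda>n. LINT y|lborel. E y * m (c n *\<^sub>R y)) \<longlonglongrightarrow> 0" by (simp add: m_def)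
  \<comment> \<open>The dilate of \<open>E\<close> to width \<open>c n\<close>, with mass 1;
    \<open>scale\<close> below moves the dilation onto the other factor, where \<open>c n\<close>
    tends to 0.\<close>
  define h where "h n w = exp (- (pi / (c n)\<^sup>2) * (norm (w :: 'a \<times> 'a))\<^sup>2) / c n ^ DIM('a \<times> 'a)" for n w
  have h0: "0 \<le> h n w" for n w using c[of n] by (simp add: h_def)
  have h: "integrable lborel (h n)" for n
    unfolding h_def using c[of n] by (intro integrable_divide gaussian_fourier(1)) simp
  have [measurable]: "h n \<in> borel_measurable borel" for n using h by auto
  have scale: "(LINT w|lborel. h n w * q w) = (LINT y|lborel. E y * q (c n *\<^sub>R y))" if "q \<in> borel_measurable borel" for q n
    using gaussian_dilation[OF that c, of n 0] c[of n] by (simp add: h_def E_def)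
  have h1: "(LINT w|lborel. h n w) = 1" for n using scale[of "\<lambda>_. 1"] E1 by simp
  have hc: "integrable lborel (\<lambda>w. complex_of_real (h n w))" for n using h by simp
  show ?thesis
  proof (rule compact_form_limit)
    fix n
    have a: "pi / (c n)\<^sup>2 > 0" using c[of n] by simp
    have "compact_multiplier f \<psi> \<phi> (\<lambda>w. of_real (h n w))"
      using compact_multiplier_scale[OF compact_multiplier_gauss[OF f lim a], of "of_real (1 / c n ^ DIM('a \<times> 'a))"]
      by (simp add: h_def gauss_def)
    then show "compact_form (localization_form (conv f (\<lambda>w. of_real (h n w))) \<psi> \<phi>)"
      by (simp add: compact_multiplier_def)
    fix u v
    define L where "L w = localization_form f (tf_shift w \<psi>) (tf_shift w \<phi>) u v" for w
    define L0 where "L0 = localization_form f \<psi> \<phi> u v"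
    \<comment> \<open>Moving the shift from the windows back to the argument exhibits
      \<open>L\<close> as a parameter integral of a jointly measurable function.\<close>
    have "L = (\<lambda>w. LINT z|lborel. f z * (stft \<psi> u (z + w) * cnj (stft \<phi> v (z + w))))"
      unfolding L_def localization_form_def stft_product_shift_window by (simp only: mult.assoc)
    also have "\<dots> \<in> borel_measurable borel" by measurable
    finally have [measurable]: "L \<in> borel_measurable borel" .
    have le: "norm (of_real (h n w) * (L0 - L w)) \<le> (B * (norm u * norm v)) * (h n w * m w)" for w
    proof -
      have "cmod (L w - L0) \<le> B * m w * (norm u * norm v)"
        using localization_form_window_diff[OF f, of "tf_shift w \<psi>" "tf_shift w \<phi>" u v \<psi> \<phi>]
        by (simp add: L_def L0_def m_def)
      from mult_left_mono[OF this h0[of n w]] show ?thesis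
        using h0[of n w] by (simp add: norm_mult norm_minus_commute mult_ac)
    qed
    have "integrable lborel (\<lambda>w. h n w * m w)"
    proof (rule integral_dominated(1))
      show "integrable lborel (\<lambda>w. h n w * M)" using h by simp
      show "norm (h n w * m w) \<le> h n w * M" for w
        using h0 m0 m_le by (simp add: abs_mult mult_left_mono)
    qed measurable
    note dom = integral_dominated[OF integrable_mult_right[OF this] _ le]
    have int: "integrable lborel (\<lambda>w. of_real (h n w) * (L0 - L w))" by (rule dom(1)) measurable
    have int0: "integrable lborel (\<lambda>w. of_real (h n w) * L0)" using hc by simp
    have "(LINT w|lborel. of_real (h n w) * L0) = L0"
      by (simp only: integral_mult_left_zero integral_complex_of_real h1 of_real_1 mult_1)
    then have "L0 - localization_form (conv f (\<lambda>w. of_real (h n w))) \<psi> \<phi> u v = (LINT w|lborel. of_real (h n w) * (L0 - L w))"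
      unfolding localization_form_conv_window[OF f hc] L_def[symmetric]
      using Bochner_Integration.integral_diff[OF int0 int] by (simp add: algebra_simps)
    also have "cmod \<dots> \<le> (LINT w|lborel. (B * (norm u * norm v)) * (h n w * m w))"
      by (rule dom(2)) measurable
    also have "\<dots> = B * (LINT y|lborel. E y * m (c n *\<^sub>R y)) * (norm u * norm v)" by (simp add: scale)
    finally show "cmod (localization_form f \<psi> \<phi> u v - localization_form (conv f (\<lambda>w. of_real (h n w))) \<psi> \<phi> u v)
        \<le> B * (LINT y|lborel. E y * m (c n *\<^sub>R y)) * (norm u * norm v)"
      unfolding L0_def .
  next
    show "(\<lambda>n. B * (LINT y|lborel. E y * m (c n *\<^sub>R y))) \<longlonglongrightarrow> 0" by (rule tendsto_mult_right_zero[OF Em])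
  qed
qed

theorem proposition5p7:
  fixes f :: "(real ^ 'n) \<times> (real ^ 'n) \<Rightarrow> complex"
    and \<psi>\<^sub>1 \<psi>\<^sub>2 :: "(real ^ 'n) L2"
  assumes "f \<in> Linfinity"
  shows "compact_operator (localization_operator f \<psi>\<^sub>1 \<psi>\<^sub>2) \<longleftrightarrow>
    fun_convolution f (\<lambda>z. stft gaussian \<psi>\<^sub>2 z * cnj (stft gaussian \<psi>\<^sub>1 z)) \<in> C0"
proof -
  \<comment> \<open>The Borel symbol \<open>g\<close> replaces \<open>f\<close> on both sides of the
    equivalence.\<close>
  obtain B g where g: "bounded_symbol B g"
    and fg: "\<And>h :: _ \<Rightarrow> complex. h \<in> borel_measurable borel \<Longrightarrow> (LINT z|lebesgue. f z * h z) = (LINT z|lborel. g z * h z)"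
    using Linfinity_bounded_symbol[OF assms] by blast
  let ?T = "localization_operator f \<psi>\<^sub>1 \<psi>\<^sub>2"
  note T = cinner_localization_operator[OF g fg, of \<psi>\<^sub>1 \<psi>\<^sub>2]
  have conv: "fun_convolution f (\<lambda>z. stft gaussian \<psi>\<^sub>2 z * cnj (stft gaussian \<psi>\<^sub>1 z)) = conv g (berezin_window \<psi>\<^sub>1 \<psi>\<^sub>2)"
    unfolding fun_convolution_def[abs_def] berezin_window_def[abs_def] by (rule ext, rule fg) measurable
  have form: "(\<lambda>u v. cinner_L2 (?T u) v) = localization_form g \<psi>\<^sub>1 \<psi>\<^sub>2"
    by (intro ext T)
  show ?thesis
  proof
    assume "compact_operator ?T"
    from compact_operator_imp_Berezin_vanishing[OF this]
    have "(conv g (berezin_window \<psi>\<^sub>1 \<psi>\<^sub>2) \<longlongrightarrow> 0) at_infinity"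
      by (simp only: T berezin_transform)
    then show "fun_convolution f (\<lambda>z. stft gaussian \<psi>\<^sub>2 z * cnj (stft gaussian \<psi>\<^sub>1 z)) \<in> C0"
      unfolding conv C0_def using continuous_conv_berezin_window[OF g] by blast
  next
    assume "fun_convolution f (\<lambda>z. stft gaussian \<psi>\<^sub>2 z * cnj (stft gaussian \<psi>\<^sub>1 z)) \<in> C0"
    then have "compact_form (localization_form g \<psi>\<^sub>1 \<psi>\<^sub>2)"
      unfolding conv C0_def by (intro vanishing_imp_compact_form[OF g]) blast
    then have "compact_form (\<lambda>u v. cinner_L2 (?T u) v)" unfolding form .
    \<comment> \<open>Linearity of the operator is read off from its form, since inner products
      determine \<open>?T u\<close>.\<close>
    then show "compact_operator ?T"
      by (intro compact_form_imp_compact_operator cinner_L2_left_eqI)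
         (simp_all add: T cinner_L2_add_left cinner_L2_scaleC_left localization_form_linear[OF g] localization_form_scaleC)
  qed
qed

end
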